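(* Let $K\subseteq\mathbb{R}^2$ be a closed convex set with non-empty interior whose interior contains no point of $\mathbb{Z}^2$. Let $w:=w(K)$ be its lattice width and $A:=A(K)\in(0,\infty]$ its area. Then \begin{align*} A&\le\infty &&\text{for } 0<w\le 1,\\ A&\le \frac{w^2}{2(w-1)} &&\text{for } 1<w\le 2,\\ A&\le \frac{3w^2}{3w+1-\sqrt{1+6w-3w^2}} &&\text{for } 2<w\le 1+\tfrac{2}{\sqrt3},\\ A&\ge \tfrac38 w^2 &&\text{for } 0<w\le 1+\tfrac{2}{\sqrt3}. \end{align*} Furthermore: (I) Equality in the first bound (i.e. $A=\infty$ with $0<w\le1$) holds if and only if $K$ is unbounded and contained in a split. (II) For $1<w\le2$, equality $A=\frac{w^2}{2(w-1)}$ holds if and only if, up to a unimodular transformation, $K=\operatorname{conv}(I_1\cup I_2)$, where $I_1$ is a translate of the segment $\operatorname{conv}\{(0,0),(w,0)\}$, $I_2$ is a translate of the segment $\operatorname{conv}\{(0,0),(0,\frac{w}{w-1})\}$, and $I_1\cap I_2\neq\emptyset$. (III) For $2<w\le 1+\frac{2}{\sqrt3}$, equality $A=\frac{3w^2}{3w+1-\sqrt{1+6w-3w^2}}$ holds if and only if $K$ is a triangle with vertices $q_0,q_1,q_2$ such that for every $i\in\{0,1,2\}$ (indices modulo $3$) the point $p_i:=\lambda q_{i+1}+(1-\lambda)q_{i+2}$ belongs to $\mathbb{Z}^2$, where $\lambda:=\frac{3w+1-\sqrt{1+6w-3w^2}}{6w}$. (IV) If $0<w\le2$, then equality $A=\frac38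 w^2$ holds if and only if, up to a unimodular transformation, $K$ is a translate of $\frac{w}{2}\operatorname{conv}\{(1,0),(0,1),(-1,-1)\}$.
   Context: For $u\in\mathbb{R}^2$ the width function is $w(K,u):=\sup\{u^\top x:x\in K\}-\inf\{u^\top x:x\in K\}$ (possibly $+\infty$), and the lattice width is $w(K):=\min\{w(K,u):u\in\mathbb{Z}^2\setminus\{o\}\}$. A unimodular transformation is an affine bijection of $\mathbb{R}^2$ mapping $\mathbb{Z}^2$ onto $\mathbb{Z}^2$. A strip is $\operatorname{conv}(l^1\cup l^2)$ for distinct parallel lines $l^1,l^2$; a split is a strip whose interior contains no integer points and such that $l^1\cap\mathbb{Z}^2$ and $l^2\cap\mathbb{Z}^2$ are affine images of $\mathbb{Z}$ (equivalently, a set $\{x: b\le a_1x_1+a_2x_2\le b+1\}$ with $a_1,a_2$ coprime integers and $b\in\mathbb{Z}$). *)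

theory Defs
  imports "HOL-Analysis.Analysis"
begin

definition Z2 :: "(real \<times> real) set" where
  "Z2 = (\<int> \<times> \<int>)"

definition width_fun :: "(real \<times> real) set \<Rightarrow> real \<times> real \<Rightarrow> ereal" where
  "width_fun K u = (SUP x\<in>K. ereal (u \<bullet> x)) - (INF x\<in>K. ereal (u \<bullet> x))"

definition lattice_width :: "(real \<times> real) set \<Rightarrow> ereal" where
  "lattice_width K = (INF u\<in>Z2 - {0}. width_fun K u)"

definition area :: "(real \<times> real) set \<Rightarrow> ennreal" where
  "area K = emeasure lborel K"

definition unimodular :: "(real \<times> real \<Rightarrow> real \<times> real) \<Rightarrow> bool" where
  "unimodular T \<longleftrightarrow> (\<exists>L b. linear L \<and> T = (\<lambda>x. L x + b)) \<and> bij T \<and> T ` Z2 = Z2"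

definition is_split :: "(real \<times> real) set \<Rightarrow> bool" where
  "is_split S \<longleftrightarrow> (\<exists>a1 a2 b :: int. coprime a1 a2 \<and>
      S = {x. of_int b \<le> of_int a1 * fst x + of_int a2 * snd x
              \<and> of_int a1 * fst x + of_int a2 * snd x \<le> of_int b + 1})"

end

theory Submission
  imports Defs
begin

text \<open>Lower bound: in suitable lattice coordinates a body of lattice width w contains chords w(1,a),
  w(c,1) and w(1-n,-n), and its area is at least half the cross product of any two of them; the estimate
  is immediate unless a, c, n lie strictly between 0 and 1. Since a(1-a), c(1-c), n(1-n) are at most 1/4, one of ac, (1-a)(1-n), (1-c)n is at
  most 1/4, and the corresponding pair of chords spans area at least 3/8 w^2.

  Upper bound for widths in (1,2]: let the width be attained in direction (1,0). A lattice line x = i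
  through the interior meets the body in a segment between consecutive lattice points, so the supporting
  lines at these two points confine the body to a trapezoid. One or two such lines exist, and the slopes
  of the supporting lines are limited by the two ends of the body.

  Upper bound for widths above 2: the body is enclosed in as few halfplanes as possible whose open
  intersection contains no lattice point. Each boundary line can be pushed outwards until it meets a
  lattice point inside all the other halfplanes. No two of these points are congruent modulo 2, since
  their midpoint would be uncovered, so there are at most four. Four points span a fundamental
  parallelogram, which forces width at most 2. Three points span a unimodular triangle, and the area and
  the lattice width of the circumscribed triangle are rational functions of the ratios in which the
  points divide its sides.

  Unbounded bodies recede in a rational direction by Kronecker's theorem, hence lie in a split.\<close>

section \<open>Planar area\<close>

text \<open>Every equality case rests on one principle: a compact set that meets a convex body with
  interior in the body's full area contains the body. A tight estimate, by an enclosing region or by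
  a hull of chords, therefore determines the extremal shape. The constant 3/8 is (1 - 1/4) / 2: a
  pair of normalised chords has cross product w^2 (1 - p) up to sign, where p is one of the three
  products, and for parameters in (0,1) these multiply to at most (1/4)^3. The threshold 2 acts from
  both sides. Below it, 1 / (w - 1) \<ge> 1 makes the trapezoid areas grow with the slopes. Above
  it, four points and all non-cyclic positions of three lines are excluded because their width is
  too small. The ratio \<open>lam w\<close> is the smaller root of w (1 - 3 l + 3 l^2) = l; this
  equation says that the triangle whose sides are divided cyclically in the ratio l : 1 - l by a
  unimodular triangle has width w in the three directions belonging to that triangle. The limit 1 +
  2 / sqrt 3 is where the two roots merge.\<close>

definition cross2 :: "real \<times> real \<Rightarrow> real \<times> real \<Rightarrow> real" where
  "cross2 u v = fst u * snd v - snd u * fst v"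

text \<open>Only meaningful for sets of finite area: the junk value for infinite area is 0.\<close>

definition ar :: "(real \<times> real) set \<Rightarrow> real" where
  "ar S = measure lborel S"

text \<open>The formula for the area of a triangle and the determinant rule for linear images are
  applied in \<open>real ^ 2\<close>; \<open>vec2\<close> and \<open>unvec2\<close> carry pairs
  there and back.\<close>

definition vec2 :: "real \<times> real \<Rightarrow> real ^ 2" where
  "vec2 z = (\<chi> i. if i = 1 then fst z else snd z)"

definition unvec2 :: "real ^ 2 \<Rightarrow> real \<times> real" where
  "unvec2 v = (v $ 1, v $ 2)"

lemma vec2_unvec2 [simp]: "vec2 (unvec2 v) = v"
  by (auto simp: vec2_def unvec2_def vec_eq_iff) (metis exhaust_2)

lemma unvec2_vec2 [simp]: "unvec2 (vec2 z) = z"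
  by (simp add: vec2_def unvec2_def)

lemma linear_vec2: "linear vec2"
  by (rule linearI) (auto simp: vec2_def vec_eq_iff)

lemma linear_unvec2: "linear unvec2"
  by (rule linearI) (auto simp: unvec2_def)

lemma vimage_unvec2: "unvec2 -` S = vec2 ` S"
  by (auto simp: image_iff) (metis vec2_unvec2)

text \<open>Lebesgue measure is determined by its values on boxes, and \<open>unvec2\<close> pulls a
  box back to the box with the same side lengths.\<close>

lemma lborel_unvec2: "distr lborel borel unvec2 = (lborel :: (real \<times> real) measure)"
proof (rule sym, rule lborel_eqI)
  have m: "unvec2 \<in> borel_measurable borel"
    by (intro borel_measurable_continuous_onI linear_continuous_on linear_conv_bounded_linear[THEN iffD1] linear_unvec2)
  fix l u :: "real \<times> real"
  assume lu: "\<And>b. b \<in> Basis \<Longrightarrow> l \<bullet> b \<le> u \<bullet> b"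
  have b: "fst l \<le> fst u" "snd l \<le> snd u"
    using lu[of "(1,0)"] lu[of "(0,1)"] by (auto simp: Basis_prod_def inner_prod_def)
  have "unvec2 -` box l u = box (vec2 l) (vec2 u)"
    by (cases l, cases u) (auto simp: mem_box_cart vec2_def unvec2_def forall_2 mem_box Basis_prod_def)
  then have "emeasure (distr lborel borel unvec2) (box l u) = emeasure lborel (box (vec2 l) (vec2 u))"
    using m by (subst emeasure_distr) auto
  also have "\<dots> = ennreal (\<Prod>b\<in>Basis. (vec2 u - vec2 l) \<bullet> b)"
    using b by (intro emeasure_lborel_box) (auto simp: Basis_vec_def inner_axis vec2_def)
  also have "(\<Prod>b\<in>Basis. (vec2 u - vec2 l) \<bullet> b) = (fst u - fst l) * (snd u - snd l)"
  proof -
    have B: "Basis = {axis 1 1, axis 2 1 :: real ^ 2}"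
      unfolding Basis_vec_def by (auto simp: UNIV_2)
    have "axis 1 1 \<noteq> (axis 2 1 :: real ^ 2)"
      by (simp add: axis_eq_axis)
    then show ?thesis
      unfolding B by (simp add: inner_axis vec2_def)
  qed
  also have "\<dots> = (\<Prod>b\<in>Basis. (u - l) \<bullet> b)"
    by (simp add: Basis_prod_def inner_prod_def insert_commute)
  finally show "emeasure (distr lborel borel unvec2) (box l u) = (\<Prod>b\<in>Basis. (u - l) \<bullet> b)" .
qed simp

lemma ar_vec2:
  assumes "S \<in> sets borel"
  shows "ar S = measure lborel (vec2 ` S)"
proof -
  have m: "unvec2 \<in> borel_measurable borel"
    by (intro borel_measurable_continuous_onI linear_continuous_on linear_conv_bounded_linear[THEN iffD1] linear_unvec2)
  have "ar S = measure (distr lborel borel unvec2) S"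
    by (simp add: ar_def lborel_unvec2)
  also have "\<dots> = measure lborel (unvec2 -` S)"
    using m assms by (subst measure_distr) auto
  finally show ?thesis by (simp add: vimage_unvec2)
qed

lemma ar_triangle: "ar (convex hull {a, b, c}) = \<bar>cross2 (b - a) (c - a)\<bar> / 2"
proof -
  have "compact (convex hull {a, b, c})"
    by (simp add: finite_imp_compact_convex_hull)
  then have "ar (convex hull {a, b, c}) = measure lborel (vec2 ` (convex hull {a, b, c}))"
    by (intro ar_vec2) (simp add: compact_imp_closed)
  also have "vec2 ` (convex hull {a, b, c}) = convex hull {vec2 a, vec2 b, vec2 c}"
    by (simp add: convex_hull_linear_image[OF linear_vec2])
  finally show ?thesis
    by (simp add: content_triangle cross2_def vec2_def abs_if algebra_simps)
qed

lemma area_compact: "compact S \<Longrightarrow> area S = ennreal (ar S)"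
  unfolding area_def ar_def
  by (metis emeasure_compact_finite emeasure_eq_ennreal_measure top.not_eq_extremum infinity_ennreal_def)

lemma compact_fmeasurable: "compact S \<Longrightarrow> S \<in> fmeasurable (lborel :: (real \<times> real) measure)"
  using emeasure_compact_finite[of S] by (simp add: fmeasurable_def borel_compact less_top)

lemma ar_nonneg: "0 \<le> ar S" by (simp add: ar_def)

lemma ar_mono: "compact S \<Longrightarrow> compact T \<Longrightarrow> S \<subseteq> T \<Longrightarrow> ar S \<le> ar T"
  unfolding ar_def
  by (intro measure_mono_fmeasurable compact_fmeasurable) (auto simp: compact_imp_closed)

lemma ar_Un_le: "compact S \<Longrightarrow> compact T \<Longrightarrow> ar (S \<union> T) \<le> ar S + ar T"
  unfolding ar_def by (intro measure_Un_le) (auto simp: compact_imp_closed)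

lemma ar_Un_eq:
  assumes "compact S" "compact T" "S \<inter> T \<subseteq> {x. a \<bullet> x = b}" "a \<noteq> 0"
  shows "ar (S \<union> T) = ar S + ar T"
proof -
  have "negligible {x. a \<bullet> x = b}"
    using assms by (intro negligible_hyperplane) auto
  then have "negligible (S \<inter> T)"
    using assms(3) negligible_subset by blast
  then have "S \<inter> T \<in> null_sets lborel"
    using assms by (simp add: negligible_iff_null_sets null_sets_completion_iff compact_Int compact_imp_closed
      null_sets_def)
  then have 0: "ar (S \<inter> T) = 0"
    by (simp add: ar_def measure_eq_0_null_sets)
  have "measure lborel (S \<union> T) = measure lborel S + measure lborel T - measure lborel (S \<inter> T)"
    using assms by (intro measure_Un3 compact_fmeasurable)
  then show ?thesis using 0 by (simp add: ar_def)
qed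

lemma ar_pos_open:
  assumes "open U" "U \<noteq> {}" "U \<subseteq> S" "compact S"
  shows "0 < ar S"
proof -
  have "emeasure lborel U > 0"
  proof (rule ccontr)
    assume "\<not> ?thesis"
    then have "U \<in> null_sets lborel" using assms by (simp add: null_sets_def)
    then have "negligible U"
      by (simp add: negligible_iff_null_sets null_sets_completionI)
    with assms open_not_negligible show False by blast
  qed
  then have "emeasure lborel S > 0"
    using assms by (metis emeasure_mono order_less_le_trans sets_lborel borel_compact)
  then show ?thesis
    using area_compact[OF assms(4)] by (simp add: area_def ennreal_less_zero_iff)
qed

text \<open>A point of R outside C has interior points of R arbitrarily close to it, by convexity,
  so a whole ball inside R misses C. Its positive area contradicts the inequality of areas.\<close>

lemma convex_ar_eq_imp_subset:
  assumes R: "compact R" "convex R" "interior R \<noteq> {}" and C: "compact C"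
    and le: "ar R \<le> ar (C \<inter> R)"
  shows "R \<subseteq> C"
proof (rule ccontr)
  assume "\<not> R \<subseteq> C"
  then obtain x where x: "x \<in> R" "x \<notin> C" by auto
  have "x \<in> closure (interior R)"
    using x R by (simp add: convex_closure_interior compact_imp_closed)
  moreover have "open (- C)" using C by (simp add: compact_imp_closed open_Compl)
  ultimately have ne: "(- C) \<inter> interior R \<noteq> {}"
    using x by (auto simp: closure_iff_nhds_not_empty)
  define U where "U = (- C) \<inter> interior R"
  have U: "open U" "U \<noteq> {}" using ne \<open>open (- C)\<close> by (auto simp: U_def)
  then obtain y e where e: "e > 0" "cball y e \<subseteq> U"
    by (meson all_not_in_conv open_contains_cball)
  have ey: "cball y e \<inter> (C \<inter> R) = {}" "cball y e \<subseteq> R"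
    using e interior_subset by (auto simp: U_def)
  have p: "0 < ar (cball y e)"
    using e by (intro ar_pos_open[of "ball y e"]) auto
  \<comment> \<open>The two sets are disjoint, so any line may serve as the one containing their
    overlap; here it is x = 0.\<close>
  have "ar (cball y e \<union> (C \<inter> R)) = ar (cball y e) + ar (C \<inter> R)"
    using R C ey by (intro ar_Un_eq[of _ _ "(1,0)" 0]) (auto simp: compact_Int zero_prod_def)
  moreover have "ar (cball y e \<union> (C \<inter> R)) \<le> ar R"
    using R C ey by (intro ar_mono) (auto simp: compact_Int)
  ultimately show False using p le by simp
qed

lemma triangle_memI:
  assumes "0 \<le> r" "0 \<le> s" "0 \<le> t" "r + s + t = 1" "z = r *\<^sub>R a + s *\<^sub>R b + t *\<^sub>R c"
  shows "z \<in> convex hull {a, b, c}"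
  using assms by (auto simp: convex_hull_3)

lemma triangle_subset:
  assumes "convex K" "a \<in> K" "b \<in> K" "c \<in> K"
  shows "convex hull {a, b, c} \<subseteq> K"
  using assms by (intro hull_minimal) auto

lemma compact_triangle: "compact (convex hull {a, b, c :: real \<times> real})"
  by (simp add: finite_imp_compact_convex_hull)

text \<open>The cross product with y - x is affine in z and vanishes at x and y, so only the weight
  t of p survives.\<close>

lemma cross2_hull:
  assumes "z \<in> convex hull {x, y, p}"
  obtains t where "0 \<le> t" "cross2 (y - x) (z - x) = t * cross2 (y - x) (p - x)"
proof -
  obtain r s t where rst: "0 \<le> t" "r + s + t = 1" "z = r *\<^sub>R x + s *\<^sub>R y + t *\<^sub>R p"
    using assms by (auto simp: convex_hull_3)
  have r: "r = 1 - s - t" using rst by simp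
  have "cross2 (y - x) (z - x) = t * cross2 (y - x) (p - x)"
    unfolding rst(3) r by (simp add: cross2_def algebra_simps)
  with rst(1) that show thesis by blast
qed

lemma cross2_hull_le: "z \<in> convex hull {x, y, p} \<Longrightarrow> cross2 (y - x) (p - x) \<le> 0 \<Longrightarrow> cross2 (y - x) (z - x) \<le> 0"
  by (metis cross2_hull mult_nonneg_nonpos)

lemma cross2_hull_ge: "z \<in> convex hull {x, y, p} \<Longrightarrow> 0 \<le> cross2 (y - x) (p - x) \<Longrightarrow> 0 \<le> cross2 (y - x) (z - x)"
  by (metis cross2_hull mult_nonneg_nonneg)

text \<open>The triangles lie on opposite sides of the line through x and y. They overlap in a null
  set, and by linearity the two signed areas combine into a single cross product.\<close>

lemma ar_opposite_triangles:
  assumes "cross2 (y - x) (p - x) \<le> 0" "0 \<le> cross2 (y - x) (q - x)" "x \<noteq> y"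
  shows "ar (convex hull {x, y, p} \<union> convex hull {x, y, q}) = \<bar>cross2 (y - x) (q - p)\<bar> / 2"
proof -
  let ?a = "(- snd (y - x), fst (y - x))"
  have "convex hull {x, y, p} \<inter> convex hull {x, y, q} \<subseteq> {z. ?a \<bullet> z = ?a \<bullet> x}"
  proof
    fix z assume "z \<in> convex hull {x, y, p} \<inter> convex hull {x, y, q}"
    then have "cross2 (y - x) (z - x) = 0"
      using cross2_hull_le[of z x y p] cross2_hull_ge[of z x y q] assms by auto
    then show "z \<in> {z. ?a \<bullet> z = ?a \<bullet> x}"
      by (simp add: cross2_def inner_prod_def algebra_simps)
  qed
  moreover have "?a \<noteq> 0" using assms(3) by (auto simp: prod_eq_iff)
  ultimately have "ar (convex hull {x, y, p} \<union> convex hull {x, y, q}) =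
      ar (convex hull {x, y, p}) + ar (convex hull {x, y, q})"
    by (intro ar_Un_eq) (auto simp: compact_triangle)
  moreover have "cross2 (y - x) (q - p) = cross2 (y - x) (q - x) - cross2 (y - x) (p - x)"
    by (simp add: cross2_def algebra_simps)
  ultimately show ?thesis
    using assms by (simp add: ar_triangle)
qed

text \<open>The closed quadrilateral path through the endpoints of two chords encloses half the cross
  product of the chords; if both endpoints of the second chord lie on one side of the first, a single
  triangle is already large enough.\<close>

lemma two_chords:
  assumes K: "compact K" "convex K" and in_K: "x \<in> K" "y \<in> K" "p \<in> K" "q \<in> K"
  shows "\<bar>cross2 (y - x) (q - p)\<bar> / 2 \<le> ar K"
proof (cases "x = y")
  case True
  then show ?thesis by (simp add: cross2_def ar_nonneg)
next
  case xy: False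
  have opp: "\<bar>cross2 (y - x) (q - p)\<bar> / 2 \<le> ar K"
    if "cross2 (y - x) (p - x) \<le> 0" "0 \<le> cross2 (y - x) (q - x)" "p \<in> K" "q \<in> K" for p q
  proof -
    have "convex hull {x, y, p} \<union> convex hull {x, y, q} \<subseteq> K"
      using K in_K that triangle_subset[of K] by blast
    then show ?thesis
      using ar_opposite_triangles[OF that(1,2) xy] K
      by (metis ar_mono compact_Un compact_triangle)
  qed
  have e: "cross2 (y - x) (q - p) = cross2 (y - x) (q - x) - cross2 (y - x) (p - x)"
    by (simp add: cross2_def algebra_simps)
  have tri: "\<bar>cross2 (y - x) (z - x)\<bar> / 2 \<le> ar K" if "z \<in> K" for z
    using K in_K that triangle_subset[of K x y z] ar_mono[OF compact_triangle K(1), of x y z]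
    by (simp add: ar_triangle)
  consider "cross2 (y - x) (p - x) \<le> 0" "0 \<le> cross2 (y - x) (q - x)"
    | "cross2 (y - x) (q - x) \<le> 0" "0 \<le> cross2 (y - x) (p - x)"
    | "cross2 (y - x) (p - x) > 0" "cross2 (y - x) (q - x) > 0"
    | "cross2 (y - x) (p - x) < 0" "cross2 (y - x) (q - x) < 0"
    by linarith
  then show ?thesis
  proof cases
    case 1 then show ?thesis using opp in_K by blast
  next
    case 2
    then have "\<bar>cross2 (y - x) (p - q)\<bar> / 2 \<le> ar K" using opp in_K by blast
    moreover have "cross2 (y - x) (p - q) = - cross2 (y - x) (q - p)"
      by (simp add: cross2_def algebra_simps)
    ultimately show ?thesis by simp
  next
    case 3 then show ?thesis using e tri[of p] tri[of q] in_K by linarith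
  next
    case 4 then show ?thesis using e tri[of p] tri[of q] in_K by linarith
  qed
qed

section \<open>Unimodular maps and lattice triangles\<close>

text \<open>Matrix entries and translation are explicit integer parameters, so that inverses,
  compositions and determinants become integer algebra.\<close>

definition umap :: "int \<Rightarrow> int \<Rightarrow> int \<Rightarrow> int \<Rightarrow> int \<Rightarrow> int \<Rightarrow> real \<times> real \<Rightarrow> real \<times> real" where
  "umap a b c d e f z = (of_int a * fst z + of_int b * snd z + of_int e,
                         of_int c * fst z + of_int d * snd z + of_int f)"

lemma Z2_iff: "z \<in> Z2 \<longleftrightarrow> fst z \<in> \<int> \<and> snd z \<in> \<int>"
  by (auto simp: Z2_def mem_Times_iff)

lemma Z2_pair [simp]: "(x, y) \<in> Z2 \<longleftrightarrow> x \<in> \<int> \<and> y \<in> \<int>"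
  by (simp add: Z2_iff)

lemma Z2_cases:
  assumes "z \<in> Z2"
  obtains i j :: int where "z = (of_int i, of_int j)"
  using assms by (metis Z2_iff Ints_cases prod.collapse)

lemma Z2_add: "x \<in> Z2 \<Longrightarrow> y \<in> Z2 \<Longrightarrow> x + y \<in> Z2"
  by (simp add: Z2_iff)
lemma Z2_diff: "x \<in> Z2 \<Longrightarrow> y \<in> Z2 \<Longrightarrow> x - y \<in> Z2"
  by (simp add: Z2_iff)
lemma Z2_scale: "x \<in> Z2 \<Longrightarrow> r \<in> \<int> \<Longrightarrow> r *\<^sub>R x \<in> Z2"
  by (simp add: Z2_iff)

lemma umap_Z2: "z \<in> Z2 \<Longrightarrow> umap a b c d e f z \<in> Z2"
  by (simp add: Z2_iff umap_def)

lemma umap_inverse: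
  assumes "\<bar>a * d - b * c\<bar> = 1"
  obtains a' b' c' d' e' f' where "\<bar>a' * d' - b' * c'\<bar> = 1"
    "\<And>z. umap a' b' c' d' e' f' (umap a b c d e f z) = z"
    "\<And>z. umap a b c d e f (umap a' b' c' d' e' f' z) = z"
proof -
  \<comment> \<open>The determinant k is 1 or -1 and hence its own inverse: the inverse matrix is
    the adjugate multiplied by k, without division.\<close>
  define k where "k = a * d - b * c"
  have kk: "k * k = 1" using assms abs_mult_self_eq[of k] unfolding k_def by simp
  have K: "real_of_int k * real_of_int k = 1" using kk by (metis of_int_1 of_int_mult)
  have k: "real_of_int k = a * d - b * c" by (simp add: k_def)
  have "(k * d) * (k * a) - (- (k * b)) * (- (k * c)) = (k * k) * (a * d - b * c)"
    by algebra
  then have 1: "\<bar>(k * d) * (k * a) - (- (k * b)) * (- (k * c))\<bar> = 1"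
    using assms kk by (simp only: mult_1)
  define g where "g = umap (k * d) (- (k * b)) (- (k * c)) (k * a) (k * (b * f - d * e)) (k * (c * e - a * f))"
  have 2: "g (umap a b c d e f z) = z" for z
  proof -
    have "fst (g (umap a b c d e f z)) = (real_of_int k * real_of_int (a * d - b * c)) * fst z"
         "snd (g (umap a b c d e f z)) = (real_of_int k * real_of_int (a * d - b * c)) * snd z"
      by (simp_all add: g_def umap_def algebra_simps)
    then show ?thesis by (simp add: prod_eq_iff K flip: k_def)
  qed
  have 3: "umap a b c d e f (g z) = z" for z
  proof -
    have "fst (umap a b c d e f (g z)) = (real_of_int k * real_of_int (a * d - b * c)) * (fst z - e) + e"
         "snd (umap a b c d e f (g z)) = (real_of_int k * real_of_int (a * d - b * c)) * (snd z - f) + f"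
      by (simp_all add: g_def umap_def algebra_simps)
    then show ?thesis by (simp add: prod_eq_iff K flip: k_def)
  qed
  show thesis using that[OF 1 2[unfolded g_def] 3[unfolded g_def]] .
qed

lemma unimodular_umap:
  assumes det: "\<bar>a * d - b * c\<bar> = 1"
  shows "unimodular (umap a b c d e f)"
proof -
  obtain a' b' c' d' e' f' where inv: "\<bar>a' * d' - b' * c'\<bar> = 1"
    "\<And>z. umap a' b' c' d' e' f' (umap a b c d e f z) = z"
    "\<And>z. umap a b c d e f (umap a' b' c' d' e' f' z) = z"
    by (rule umap_inverse[OF det, of e f]) blast
  have "linear (\<lambda>z. (real_of_int a * fst z + of_int b * snd z, real_of_int c * fst z + of_int d * snd z))"
    by (rule linearI) (auto simp: algebra_simps)
  moreover have "umap a b c d e f =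
      (\<lambda>z. (real_of_int a * fst z + of_int b * snd z, real_of_int c * fst z + of_int d * snd z) + (of_int e, of_int f))"
    by (auto simp: umap_def)
  moreover have "bij (umap a b c d e f)"
    by (rule bij_betw_byWitness[where f' = "umap a' b' c' d' e' f'"]) (auto simp: inv)
  moreover have "umap a b c d e f ` Z2 = Z2"
  proof
    show "umap a b c d e f ` Z2 \<subseteq> Z2" using umap_Z2 by blast
    show "Z2 \<subseteq> umap a b c d e f ` Z2"
    proof
      fix z assume "z \<in> Z2"
      then have "umap a' b' c' d' e' f' z \<in> Z2" by (rule umap_Z2)
      then show "z \<in> umap a b c d e f ` Z2" using inv(3)[of z] by (metis imageI)
    qed
  qed
  ultimately show ?thesis
    unfolding unimodular_def by blast
qed

text \<open>The columns of the matrix are images of unit vectors and hence integral. Lattice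
  preimages of the unit vectors form an integral right inverse, so two integer determinants multiply
  to 1.\<close>

lemma unimodular_cases:
  assumes "unimodular T"
  obtains a b c d e f where "\<bar>a * d - b * c\<bar> = 1" "T = umap a b c d e f"
proof -
  from assms obtain L t where L: "linear L" "T = (\<lambda>x. L x + t)" and im: "T ` Z2 = Z2"
    by (auto simp: unimodular_def)
  have L0: "L 0 = 0" using L(1) by (rule linear_0)
  have t: "t \<in> Z2"
  proof -
    have "T 0 \<in> Z2" using im by (metis Z2_pair Ints_0 image_eqI zero_prod_def)
    then show ?thesis using L L0 by simp
  qed
  have LZ: "L z \<in> Z2" if "z \<in> Z2" for z
  proof -
    have "T z \<in> Z2" using im that by blast
    then have "T z - t \<in> Z2" by (rule Z2_diff[OF _ t])
    then show ?thesis by (simp add: L(2))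
  qed
  obtain a c where ac: "L (1, 0) = (of_int a, of_int c)" using Z2_cases[OF LZ[of "(1,0)"]] by auto
  obtain b d where bd: "L (0, 1) = (of_int b, of_int d)" using Z2_cases[OF LZ[of "(0,1)"]] by auto
  obtain e f where ef: "t = (of_int e, of_int f)" using t by (auto elim: Z2_cases)
  have Lz: "L z = (of_int a * fst z + of_int b * snd z, of_int c * fst z + of_int d * snd z)" for z
  proof -
    have "L z = L (fst z *\<^sub>R (1, 0) + snd z *\<^sub>R (0, 1))" by simp
    also have "\<dots> = fst z *\<^sub>R L (1, 0) + snd z *\<^sub>R L (0, 1)"
      by (simp only: linear_add[OF L(1)] linear_scale[OF L(1)])
    finally show ?thesis by (simp add: ac bd algebra_simps)
  qed
  have T: "T = umap a b c d e f"
    using L(2) by (auto simp: umap_def Lz ef fun_eq_iff)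
  have pre: "\<exists>z\<in>Z2. L z = w" if "w \<in> Z2" for w
  proof -
    have "w + t \<in> T ` Z2" using that t im Z2_add by simp
    then show ?thesis using L(2) by auto
  qed
  obtain z1 z2 where z: "z1 \<in> Z2" "L z1 = (1, 0)" "z2 \<in> Z2" "L z2 = (0, 1)"
    using pre[of "(1,0)"] pre[of "(0,1)"] by auto
  obtain i j k l where ij: "z1 = (of_int i, of_int j)" "z2 = (of_int k, of_int l)"
    using Z2_cases[OF z(1)] Z2_cases[OF z(3)] by metis
  have "a * i + b * j = 1" "c * i + d * j = 0" "a * k + b * l = 0" "c * k + d * l = 1"
    using z(2,4) unfolding ij Lz by (simp_all flip: of_int_mult of_int_add)
  then have "(a * d - b * c) * (i * l - j * k) = 1" by algebra
  then have "\<bar>a * d - b * c\<bar> = 1" using abs_zmult_eq_1[of "a * d - b * c" "i * l - j * k"] by simp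
  with T that show thesis by blast
qed

lemma unimodular_inverse:
  assumes "unimodular T"
  obtains S where "unimodular S" "\<And>z. S (T z) = z" "\<And>z. T (S z) = z"
proof -
  obtain a b c d e f where T: "\<bar>a * d - b * c\<bar> = 1" "T = umap a b c d e f"
    using assms by (rule unimodular_cases)
  obtain a' b' c' d' e' f' where "\<bar>a' * d' - b' * c'\<bar> = 1"
    "\<And>z. umap a' b' c' d' e' f' (umap a b c d e f z) = z"
    "\<And>z. umap a b c d e f (umap a' b' c' d' e' f' z) = z"
    by (rule umap_inverse[OF T(1), of e f]) blast
  with that unimodular_umap T(2) show thesis by blast
qed

lemma unimodular_comp:
  assumes "unimodular S" "unimodular T"
  shows "unimodular (S \<circ> T)"
proof -
  obtain a b c d e f where S: "\<bar>a * d - b * c\<bar> = 1" "S = umap a b c d e f"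
    using assms(1) by (rule unimodular_cases)
  obtain a' b' c' d' e' f' where T: "\<bar>a' * d' - b' * c'\<bar> = 1" "T = umap a' b' c' d' e' f'"
    using assms(2) by (rule unimodular_cases)
  have "S \<circ> T = umap (a * a' + b * c') (a * b' + b * d') (c * a' + d * c') (c * b' + d * d')
      (a * e' + b * f' + e) (c * e' + d * f' + f)"
    by (auto simp: S T umap_def fun_eq_iff algebra_simps)
  moreover have "(a * a' + b * c') * (c * b' + d * d') - (a * b' + b * d') * (c * a' + d * c') =
      (a * d - b * c) * (a' * d' - b' * c')" by algebra
  then have "\<bar>(a * a' + b * c') * (c * b' + d * d') - (a * b' + b * d') * (c * a' + d * c')\<bar> = 1"
    using S T by (simp add: abs_mult)
  ultimately show ?thesis using unimodular_umap by simp
qed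

lemma unimodular_id: "unimodular (\<lambda>z. z)"
  using unimodular_umap[of 1 1 0 0 0 0] by (simp add: umap_def[abs_def])

lemma continuous_umap: "continuous_on S (umap a b c d e f)"
  unfolding umap_def by (intro continuous_intros)

lemma unimodular_continuous: "unimodular T \<Longrightarrow> continuous_on S T"
  using unimodular_cases continuous_umap by metis

lemma unimodular_Z2: "unimodular T \<Longrightarrow> T z \<in> Z2 \<longleftrightarrow> z \<in> Z2"
proof -
  assume T: "unimodular T"
  obtain S where S: "unimodular S" "\<And>z. S (T z) = z" "\<And>z. T (S z) = z"
    using unimodular_inverse[OF T] by blast
  have "unimodular R \<Longrightarrow> z \<in> Z2 \<Longrightarrow> R z \<in> Z2" for R z
    by (metis unimodular_cases umap_Z2)
  from this[OF T, of z] this[OF S(1), of "T z"] show ?thesis by (auto simp: S)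
qed

lemma unimodular_affine_comb:
  assumes "unimodular T" "r + s = 1"
  shows "T (r *\<^sub>R x + s *\<^sub>R y) = r *\<^sub>R T x + s *\<^sub>R T y"
proof -
  obtain a b c d e f where T: "T = umap a b c d e f"
    using assms(1) unimodular_cases by metis
  have "real_of_int e = (r + s) * e" "real_of_int f = (r + s) * f" using assms(2) by simp_all
  then show ?thesis unfolding T umap_def
    by (simp add: algebra_simps)
qed

lemma convex_unimodular: 
  assumes "unimodular T" "convex K"
  shows "convex (T ` K)"
  using assms unfolding convex_def
  by (auto simp: unimodular_affine_comb[symmetric])

lemma compact_unimodular: "unimodular T \<Longrightarrow> compact K \<Longrightarrow> compact (T ` K)"
  by (simp add: compact_continuous_image unimodular_continuous)

lemma interior_unimodular:
  assumes T: "unimodular T"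
  shows "interior (T ` K) = T ` interior K"
proof -
  have le: "T ` interior K \<subseteq> interior (T ` K)" if T: "unimodular T" for T K
  proof -
    obtain S where S: "unimodular S" "\<And>z. S (T z) = z" "\<And>z. T (S z) = z"
      using unimodular_inverse[OF T] by blast
    have "T ` interior K = S -` interior K"
    proof (intro set_eqI iffI)
      fix z assume "z \<in> T ` interior K"
      then show "z \<in> S -` interior K" using S(2) by auto
    next
      fix z assume "z \<in> S -` interior K"
      then show "z \<in> T ` interior K" using S(3)[of z] by (metis imageI vimageD)
    qed
    moreover have "open (S -` interior K)"
      using open_vimage[of "interior K" S] unimodular_continuous[OF S(1)] by simp
    ultimately show ?thesis
      by (metis image_mono interior_maximal interior_subset)
  qed
  obtain S where S: "unimodular S" "\<And>z. S (T z) = z" "\<And>z. T (S z) = z"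
    using unimodular_inverse[OF T] by blast
  have "S ` interior (T ` K) \<subseteq> interior (S ` (T ` K))" by (rule le[OF S(1)])
  also have "S ` (T ` K) = K" by (simp add: image_image S(2))
  finally have "T ` (S ` interior (T ` K)) \<subseteq> T ` interior K" by blast
  moreover have "T ` (S ` interior (T ` K)) = interior (T ` K)" by (simp add: image_image S(3))
  ultimately show ?thesis using le[OF T] by blast
qed

lemma ar_unimodular:
  assumes T: "unimodular T" and K: "compact K"
  shows "ar (T ` K) = ar K"
proof -
  obtain a b c d e f where det: "\<bar>a * d - b * c\<bar> = 1" and Te: "T = umap a b c d e f"
    using T by (rule unimodular_cases)
  define L :: "real ^ 2 \<Rightarrow> real ^ 2" where "L v = vec2 (of_int a * v $ 1 + of_int b * v $ 2, of_int c * v $ 1 + of_int d * v $ 2)" for v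
  have lin: "linear L"
    by (rule linearI) (auto simp: L_def vec2_def vec_eq_iff algebra_simps)
  have "matrix L = (\<chi> i j. if i = 1 then if j = 1 then real_of_int a else real_of_int b
      else if j = 1 then real_of_int c else real_of_int d)"
    unfolding matrix_def by (simp add: L_def vec2_def vec_eq_iff axis_def forall_2)
  then have "det (matrix L) = of_int (a * d - b * c)"
    by (simp add: det_2)
  then have det1: "\<bar>det (matrix L)\<bar> = 1" using det by (metis of_int_1 of_int_abs)
  have cK: "compact (vec2 ` K)"
    by (intro compact_continuous_image linear_continuous_on linear_conv_bounded_linear[THEN iffD1] linear_vec2 K)
  then have lm: "vec2 ` K \<in> lmeasurable" by (rule lmeasurable_compact)
  have im: "vec2 ` (T ` K) = (+) (vec2 (of_int e, of_int f)) ` L ` (vec2 ` K)"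
    unfolding image_image by (rule image_cong) (auto simp: Te umap_def L_def vec2_def vec_eq_iff)
  have bor: "compact S \<Longrightarrow> measure lborel S = measure lebesgue S" for S :: "(real ^ 2) set"
    by (simp add: measure_completion borel_compact)
  have c2: "compact (vec2 ` (T ` K))"
    by (intro compact_continuous_image linear_continuous_on linear_conv_bounded_linear[THEN iffD1] linear_vec2 compact_unimodular T K)
  have "ar (T ` K) = measure lebesgue (vec2 ` (T ` K))"
    using ar_vec2[of "T ` K"] compact_unimodular[OF T K] bor[OF c2] by (simp add: borel_compact)
  also have "\<dots> = measure lebesgue (L ` (vec2 ` K))"
    unfolding im by (rule measure_translation)
  also have "\<dots> = measure lebesgue (vec2 ` K)"
    using measure_linear_image[OF lin lm] det1 by simp
  also have "\<dots> = ar K"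
    using ar_vec2[of K] K bor[OF cK] by (simp add: borel_compact)
  finally show ?thesis .
qed

section \<open>Lattice width in terms of chords\<close>

definition wide :: "(real \<times> real) set \<Rightarrow> real \<Rightarrow> bool" where
  "wide K w \<longleftrightarrow> (\<forall>u \<in> Z2 - {0}. \<exists>x\<in>K. \<exists>y\<in>K. w \<le> u \<bullet> (x - y))"

text \<open>\<open>wide K w\<close> and \<open>thin K w\<close> are the two halves of the claim that
  a compact body has lattice width w. Stated by pairs of points they avoid suprema and extended
  reals, and \<open>wide\<close> directly supplies the chords for the area estimates.\<close>

definition thin :: "(real \<times> real) set \<Rightarrow> real \<Rightarrow> bool" where
  "thin K w \<longleftrightarrow> (\<exists>u \<in> Z2 - {0}. \<forall>x\<in>K. \<forall>y\<in>K. u \<bullet> (x - y) \<le> w)"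

text \<open>The vector v is the transposed matrix applied to u; it is nonzero because the
  determinant is.\<close>

lemma unimodular_dual:
  assumes T: "unimodular T" and u: "u \<in> Z2 - {0}"
  obtains v where "v \<in> Z2 - {0}" "\<And>x y. u \<bullet> (T x - T y) = v \<bullet> (x - y)"
proof -
  obtain a b c d e f where det: "\<bar>a * d - b * c\<bar> = 1" and Te: "T = umap a b c d e f"
    using T by (rule unimodular_cases)
  obtain i j where ij: "u = (of_int i, of_int j)" using u by (auto elim: Z2_cases)
  define v where "v = (real_of_int (a * i + c * j), real_of_int (b * i + d * j))"
  have e: "u \<bullet> (T x - T y) = v \<bullet> (x - y)" for x y
    by (simp add: v_def ij Te umap_def inner_prod_def algebra_simps)
  have "v \<noteq> 0"
  proof
    assume "v = 0"
    then have "a * i + c * j = 0" "b * i + d * j = 0" by (simp_all add: v_def zero_prod_def del: of_int_add of_int_mult)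
    then have "(a * d - b * c) * i = 0" "(a * d - b * c) * j = 0" by algebra+
    then show False using det u ij by (auto simp: zero_prod_def)
  qed
  then have "v \<in> Z2 - {0}" by (simp add: v_def del: of_int_add of_int_mult)
  with e that show thesis by blast
qed

lemma wide_unimodular: "unimodular T \<Longrightarrow> wide K w \<Longrightarrow> wide (T ` K) w"
  unfolding wide_def by (metis image_eqI unimodular_dual)

lemma wideD:
  assumes "wide K w" "\<bar>i\<bar> + \<bar>j\<bar> > (0::int)"
  obtains x y where "x \<in> K" "y \<in> K" "w \<le> of_int i * (fst x - fst y) + of_int j * (snd x - snd y)"
proof -
  have "(real_of_int i, real_of_int j) \<in> Z2 - {0}" using assms(2) by (auto simp: zero_prod_def)
  then obtain x y where "x \<in> K" "y \<in> K" "w \<le> (real_of_int i, real_of_int j) \<bullet> (x - y)"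
    using assms(1) unfolding wide_def by blast
  then show thesis by (intro that[of x y]) (simp_all add: inner_prod_def)
qed

text \<open>After division by the gcd the direction is primitive, and Bezout coefficients complete
  it to the first row of a unimodular matrix.\<close>

lemma thin_fst:
  assumes "thin K w" "K \<noteq> {}" and w: "0 \<le> w"
  obtains T where "unimodular T" "\<And>x y. x \<in> T ` K \<Longrightarrow> y \<in> T ` K \<Longrightarrow> fst x - fst y \<le> w"
proof -
  obtain u where u: "u \<in> Z2 - {0}" "\<And>x y. x \<in> K \<Longrightarrow> y \<in> K \<Longrightarrow> u \<bullet> (x - y) \<le> w"
    using assms(1) by (auto simp: thin_def)
  obtain i j where ij: "u = (of_int i, of_int j)" using u by (auto elim: Z2_cases)
  define g where "g = gcd i j"
  have "i \<noteq> 0 \<or> j \<noteq> 0" using u(1) ij by (auto simp: zero_prod_def)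
  then have g: "g \<ge> 1" unfolding g_def by (metis gcd_eq_0_iff gcd_ge_0_int int_one_le_iff_zero_less order_le_less)
  obtain p q where pq: "i = g * p" "j = g * q" "coprime p q"
    using g unfolding g_def by (metis gcd_coprime_exists mult.commute not_one_le_zero)
  obtain r s where rs: "r * p + s * q = 1" using pq(3) by (metis bezout_int coprime_imp_gcd_eq_1)
  have det: "\<bar>p * r - q * (- s)\<bar> = 1" using rs by (simp add: algebra_simps)
  show thesis
  proof (rule that[OF unimodular_umap[OF det, of 0 0]])
    fix x y assume "x \<in> umap p q (- s) r 0 0 ` K" "y \<in> umap p q (- s) r 0 0 ` K"
    then obtain x' y' where xy: "x' \<in> K" "y' \<in> K" "x = umap p q (- s) r 0 0 x'" "y = umap p q (- s) r 0 0 y'"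
      by blast
    have "of_int g * (fst x - fst y) \<le> w"
      using u(2)[OF xy(1,2)] by (simp add: xy umap_def ij pq inner_prod_def algebra_simps)
    \<comment> \<open>Dividing the direction by \<open>g\<close> can only shrink a nonnegative
      difference; negative ones are below w anyway.\<close>
    moreover have "of_int g * (fst x - fst y) \<ge> fst x - fst y" if "fst x - fst y \<ge> 0"
      using g that mult_right_mono[of 1 "real_of_int g" "fst x - fst y"] by simp
    ultimately show "fst x - fst y \<le> w" using w by linarith
  qed
qed

text \<open>If a lattice point were not an integral combination of the two edge vectors, its fractional part,
  possibly reflected in the midpoint of the third edge, would be a further lattice point of the triangle.\<close>

lemma empty_lattice_triangle:
  assumes Z: "p0 \<in> Z2" "p1 \<in> Z2" "p2 \<in> Z2" and ne: "cross2 (p1 - p0) (p2 - p0) \<noteq> 0"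
    and empty: "\<And>z. z \<in> Z2 \<Longrightarrow> z \<in> convex hull {p0, p1, p2} \<Longrightarrow> z \<in> {p0, p1, p2}"
  shows "\<bar>cross2 (p1 - p0) (p2 - p0)\<bar> = 1"
proof -
  define v1 v2 where "v1 = p1 - p0" and "v2 = p2 - p0"
  define d where "d = cross2 v1 v2"
  have d0: "d \<noteq> 0" using ne by (simp add: d_def v1_def v2_def)
  have vZ: "v1 \<in> Z2" "v2 \<in> Z2" using Z by (auto simp: v1_def v2_def Z2_diff)
  have uniq: "s = s' \<and> t = t'" if "s *\<^sub>R v1 + t *\<^sub>R v2 = s' *\<^sub>R v1 + t' *\<^sub>R v2" for s t s' t'
  proof -
    have "fst (s *\<^sub>R v1 + t *\<^sub>R v2) = fst (s' *\<^sub>R v1 + t' *\<^sub>R v2)"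
         "snd (s *\<^sub>R v1 + t *\<^sub>R v2) = snd (s' *\<^sub>R v1 + t' *\<^sub>R v2)" using that by simp_all
    then have "(s - s') * d = 0" "(t - t') * d = 0" unfolding d_def cross2_def by simp_all algebra+
    then show ?thesis using d0 by simp
  qed
  have int: "s \<in> \<int> \<and> t \<in> \<int>" if z: "z \<in> Z2" "z = s *\<^sub>R v1 + t *\<^sub>R v2" for z s t
  proof -
    define s' t' where "s' = frac s" and "t' = frac t"
    have r: "0 \<le> s'" "s' < 1" "0 \<le> t'" "t' < 1" by (auto simp: s'_def t'_def frac_lt_1)
    have y: "s' *\<^sub>R v1 + t' *\<^sub>R v2 = z - (of_int \<lfloor>s\<rfloor> *\<^sub>R v1 + of_int \<lfloor>t\<rfloor> *\<^sub>R v2)"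
      by (simp add: s'_def t'_def frac_def z(2) algebra_simps)
    have yZ: "s' *\<^sub>R v1 + t' *\<^sub>R v2 \<in> Z2"
      unfolding y using z vZ by (intro Z2_diff Z2_add Z2_scale) auto
    have "s' = 0 \<and> t' = 0"
    proof (cases "s' + t' \<le> 1")
      case True
      have "p0 + (s' *\<^sub>R v1 + t' *\<^sub>R v2) \<in> convex hull {p0, p1, p2}"
        using True r by (intro triangle_memI[of "1 - s' - t'" s' t']) (auto simp: v1_def v2_def algebra_simps)
      then have "p0 + (s' *\<^sub>R v1 + t' *\<^sub>R v2) \<in> {p0, p1, p2}"
        using empty Z2_add[OF Z(1) yZ] by blast
      then have "s' *\<^sub>R v1 + t' *\<^sub>R v2 \<in> {0 *\<^sub>R v1 + 0 *\<^sub>R v2, 1 *\<^sub>R v1 + 0 *\<^sub>R v2, 0 *\<^sub>R v1 + 1 *\<^sub>R v2}"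
        by (auto simp: v1_def v2_def algebra_simps)
      then show ?thesis using uniq r by fastforce
    next
      case False
      have mem: "p1 + p2 - p0 - (s' *\<^sub>R v1 + t' *\<^sub>R v2) \<in> convex hull {p0, p1, p2}"
        using False r by (intro triangle_memI[of "s' + t' - 1" "1 - s'" "1 - t'"]) (auto simp: v1_def v2_def algebra_simps)
      moreover have "p1 + p2 - p0 - (s' *\<^sub>R v1 + t' *\<^sub>R v2) \<in> Z2"
        by (rule Z2_diff[OF Z2_diff[OF Z2_add[OF Z(2,3)] Z(1)] yZ])
      ultimately have "p1 + p2 - p0 - (s' *\<^sub>R v1 + t' *\<^sub>R v2) \<in> {p0, p1, p2}"
        using empty by blast
      then have "s' *\<^sub>R v1 + t' *\<^sub>R v2 \<in> {1 *\<^sub>R v1 + 1 *\<^sub>R v2, 0 *\<^sub>R v1 + 1 *\<^sub>R v2, 1 *\<^sub>R v1 + 0 *\<^sub>R v2}"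
        by (auto simp: v1_def v2_def algebra_simps)
      then show ?thesis using uniq r by fastforce
    qed
    then show ?thesis by (simp add: s'_def t'_def)
  qed
  have e: "fst v1 * snd v2 = d + fst v2 * snd v1" by (simp add: d_def cross2_def)
  \<comment> \<open>By Cramer's rule these are the coordinates of the unit vectors in the basis v1,
    v2, that is, the entries of the inverse matrix. Its determinant 1 / d is therefore an integer,
    and so is d.\<close>
  have "snd v2 / d \<in> \<int> \<and> - snd v1 / d \<in> \<int>"
    using d0 by (intro int[of "(1,0)"]) (auto simp: prod_eq_iff field_simps e)
  moreover have "- fst v2 / d \<in> \<int> \<and> fst v1 / d \<in> \<int>"
    using d0 by (intro int[of "(0,1)"]) (auto simp: prod_eq_iff field_simps e)
  ultimately have "(fst v1 / d) * (snd v2 / d) - (- snd v1 / d) * (- fst v2 / d) \<in> \<int>"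
    by (intro Ints_diff Ints_mult) auto
  also have "(fst v1 / d) * (snd v2 / d) - (- snd v1 / d) * (- fst v2 / d) = (fst v1 * snd v2 - snd v1 * fst v2) / (d * d)"
    by (simp add: diff_divide_distrib)
  also have "\<dots> = 1 / d" using d0 by (simp add: d_def cross2_def)
  finally obtain k where k: "1 / d = of_int k" by (auto elim: Ints_cases)
  have "d \<in> \<int>" using vZ by (auto simp: d_def cross2_def Z2_iff)
  then obtain m where m: "d = of_int m" by (auto elim: Ints_cases)
  have "m * k = 1" using k m d0 by (simp add: field_simps flip: of_int_mult)
  then have "\<bar>m\<bar> = 1" by (metis abs_zmult_eq_1 abs_1)
  then show ?thesis using m by (simp add: d_def v1_def v2_def flip: of_int_abs)
qed

lemma lattice_triangle_normal_form:
  assumes Z: "p0 \<in> Z2" "p1 \<in> Z2" "p2 \<in> Z2" and det: "\<bar>cross2 (p1 - p0) (p2 - p0)\<bar> = 1"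
  obtains T where "unimodular T" "T p0 = (0, 0)" "T p1 = (1, 0)" "T p2 = (0, 1)"
proof -
  obtain e f where p0: "p0 = (of_int e, of_int f)" using Z(1) by (rule Z2_cases)
  obtain a c where v1: "p1 - p0 = (of_int a, of_int c)" using Z2_diff[OF Z(2,1)] by (rule Z2_cases)
  obtain b d where v2: "p2 - p0 = (of_int b, of_int d)" using Z2_diff[OF Z(3,1)] by (rule Z2_cases)
  have "real_of_int \<bar>a * d - b * c\<bar> = 1" using det by (simp add: cross2_def v1 v2 mult.commute)
  then have u: "unimodular (umap a b c d e f)" by (intro unimodular_umap) linarith
  have "umap a b c d e f (0, 0) = p0" by (simp add: umap_def p0)
  moreover have "umap a b c d e f (1, 0) = p1" using v1 by (simp add: umap_def p0 algebra_simps)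
  moreover have "umap a b c d e f (0, 1) = p2" using v2 by (simp add: umap_def p0 algebra_simps)
  ultimately show thesis using unimodular_inverse[OF u] that by metis
qed

section \<open>Unbounded lattice-free sets and the lattice width\<close>

text \<open>The direction r is a limit point of the directions from a fixed point x0 of K to points
  \<open>y n\<close> that run off to infinity.\<close>

lemma unbounded_convex_ray:
  fixes K :: "'a::euclidean_space set"
  assumes K: "closed K" "convex K" "\<not> bounded K"
  obtains r where "norm r = 1" "\<And>x t. x \<in> K \<Longrightarrow> 0 \<le> t \<Longrightarrow> x + t *\<^sub>R r \<in> K"
proof -
  have "K \<noteq> {}" using K(3) by auto
  then obtain x0 where x0: "x0 \<in> K" by auto
  have "\<exists>y\<in>K. norm (y - x0) > real n" for n
  proof (rule ccontr)
    assume "\<not> ?thesis"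
    then have "K \<subseteq> cball x0 (real n)" by (auto simp: dist_norm norm_minus_commute not_less)
    then show False using K(3) bounded_subset bounded_cball by blast
  qed
  then obtain y where y: "\<And>n. y n \<in> K" "\<And>n. norm (y n - x0) > real n" by metis
  define d where "d n = (y n - x0) /\<^sub>R norm (y n - x0)" for n
  have pos: "norm (y n - x0) > 0" for n
    using y(2)[of n] of_nat_0_le_iff[of n] by linarith
  have "d n \<in> sphere 0 1" for n
    using pos[of n] by (simp add: d_def)
  then obtain r \<phi> where r: "r \<in> sphere 0 1" and \<phi>: "strict_mono \<phi>" and lim: "(d \<circ> \<phi>) \<longlonglongrightarrow> r"
    using compact_sphere[of "0::'a" 1] unfolding compact_def by metis
  show thesis
  proof (rule that)
    show "norm r = 1" using r by simp
    fix x t assume x: "x \<in> K" and t: "(0::real) \<le> t"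
    \<comment> \<open>With this parameter, the point of the segment from x to
      \<open>y (\<phi> n)\<close> is x plus t times the direction \<open>d (\<phi> n)\<close>, up to
      the error \<open>s n *\<^sub>R (x0 - x)\<close>, which tends to 0.\<close>
    define s where "s n = t / norm (y (\<phi> n) - x0)" for n
    have s0: "0 \<le> s n" for n using t by (simp add: s_def)
    have "s \<longlonglongrightarrow> 0"
    proof (rule Lim_null_comparison)
      show "\<forall>\<^sub>F n in sequentially. norm (s n) \<le> t * inverse (real n)"
      proof (rule eventually_sequentiallyI[of 1])
        fix n :: nat assume n: "1 \<le> n"
        have "real n \<le> real (\<phi> n)" using \<phi> seq_suble by auto
        also have "\<dots> < norm (y (\<phi> n) - x0)" by (rule y(2))
        finally have "inverse (norm (y (\<phi> n) - x0)) \<le> inverse (real n)"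
          using n by (intro le_imp_inverse_le) auto
        then show "norm (s n) \<le> t * inverse (real n)"
          using t s0[of n] by (simp add: s_def divide_inverse mult_left_mono)
      qed
      show "(\<lambda>n. t * inverse (real n)) \<longlonglongrightarrow> 0"
        by (intro tendsto_mult_right_zero lim_inverse_n)
    qed
    then have "(\<lambda>n. x + s n *\<^sub>R (x0 - x) + t *\<^sub>R (d \<circ> \<phi>) n) \<longlonglongrightarrow> x + 0 *\<^sub>R (x0 - x) + t *\<^sub>R r"
      by (intro tendsto_intros lim)
    then have l: "(\<lambda>n. x + s n *\<^sub>R (x0 - x) + t *\<^sub>R (d \<circ> \<phi>) n) \<longlonglongrightarrow> x + t *\<^sub>R r" by simp
    have "\<forall>\<^sub>F n in sequentially. s n < 1"
      using \<open>s \<longlonglongrightarrow> 0\<close> by (rule order_tendstoD) simp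
    then have "\<forall>\<^sub>F n in sequentially. x + s n *\<^sub>R (x0 - x) + t *\<^sub>R (d \<circ> \<phi>) n \<in> K"
    proof (rule eventually_mono)
      fix n assume "s n < 1"
      have "x + s n *\<^sub>R (x0 - x) + t *\<^sub>R (d \<circ> \<phi>) n = (1 - s n) *\<^sub>R x + s n *\<^sub>R y (\<phi> n)"
        using pos[of "\<phi> n"] by (simp add: s_def d_def algebra_simps divide_inverse)
      also have "\<dots> \<in> K"
        using \<open>s n < 1\<close> s0[of n] x y(1) by (intro convexD[OF K(2)]) auto
      finally show "x + s n *\<^sub>R (x0 - x) + t *\<^sub>R (d \<circ> \<phi>) n \<in> K" .
    qed
    then show "x + t *\<^sub>R r \<in> K"
      using K(1) l by (intro Lim_in_closed_set[of K _ sequentially]) auto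
  qed
qed

lemma interior_ray:
  fixes K :: "'a::euclidean_space set"
  assumes "\<And>x t. x \<in> K \<Longrightarrow> 0 \<le> t \<Longrightarrow> x + t *\<^sub>R r \<in> K" "x \<in> interior K" "0 \<le> t"
  shows "x + t *\<^sub>R r \<in> interior K"
proof -
  have "(+) (t *\<^sub>R r) ` interior K \<subseteq> interior K"
    using assms(1,3) interior_subset[of K]
    by (intro interior_maximal open_translation open_interior) (auto simp: add.commute)
  then show ?thesis using assms(2) by (auto simp: add.commute)
qed

text \<open>Translates of one ball by multiples of its diameter along a direction of recession are
  disjoint, equally large and all contained in K.\<close>

lemma unbounded_area:
  assumes K: "closed K" "convex K" "\<not> bounded K" and int: "interior K \<noteq> {}"
  shows "area K = \<infinity>"
proof (rule ccontr)
  assume "area K \<noteq> \<infinity>"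
  then obtain a where a: "area K = ennreal a" "0 \<le> a" by (cases "area K") auto
  obtain r where r: "norm r = 1" "\<And>x t. x \<in> K \<Longrightarrow> 0 \<le> t \<Longrightarrow> x + t *\<^sub>R r \<in> K"
    using unbounded_convex_ray[OF K] by blast
  obtain x0 e where e: "e > 0" "ball x0 e \<subseteq> K"
    using int by (meson ex_in_conv mem_interior)
  define B where "B i = ball (x0 + (2 * e * real i) *\<^sub>R r) e" for i
  have BK: "B i \<subseteq> K" for i
  proof
    fix z assume "z \<in> B i"
    then have "z - (2 * e * real i) *\<^sub>R r \<in> ball x0 e" by (simp add: B_def dist_norm algebra_simps)
    then have "z - (2 * e * real i) *\<^sub>R r + (2 * e * real i) *\<^sub>R r \<in> K"
      using e by (intro r(2)) auto
    then show "z \<in> K" by simp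
  qed
  have disj: "disjoint_family B"
    unfolding disjoint_family_on_def
  proof (intro ballI impI, rule ccontr)
    fix i j assume "i \<noteq> j" "B i \<inter> B j \<noteq> {}"
    then obtain z where z: "z \<in> B i" "z \<in> B j" by auto
    have "dist (x0 + (2 * e * real i) *\<^sub>R r) (x0 + (2 * e * real j) *\<^sub>R r) < 2 * e"
      using z dist_triangle_half_l[of "x0 + (2 * e * real i) *\<^sub>R r" z "2 * e" "x0 + (2 * e * real j) *\<^sub>R r"]
      by (simp add: B_def dist_commute)
    also have "dist (x0 + (2 * e * real i) *\<^sub>R r) (x0 + (2 * e * real j) *\<^sub>R r) = norm ((2 * e * (real i - real j)) *\<^sub>R r)"
      by (simp add: dist_norm algebra_simps)
    also have "\<dots> = 2 * e * \<bar>real i - real j\<bar>" using e r(1) by (simp add: abs_mult)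
    finally have "\<bar>real i - real j\<bar> < 1" using e by simp
    then show False using \<open>i \<noteq> j\<close> by linarith
  qed
  define m where "m = unit_ball_vol (real DIM(real \<times> real)) * e ^ DIM(real \<times> real)"
  have m: "m > 0" unfolding m_def using e by (intro mult_pos_pos unit_ball_vol_pos zero_less_power) auto
  have em: "emeasure lborel (B i) = ennreal m" for i
    unfolding B_def m_def using e by (intro emeasure_ball) auto
  have le: "real n * m \<le> a" for n
  proof -
    have "(\<Sum>i<n. emeasure lborel (B i)) = emeasure lborel (\<Union>i<n. B i)"
      using disj by (intro sum_emeasure) (auto simp: disjoint_family_on_def B_def)
    also have "\<dots> \<le> emeasure lborel K"
      using BK K(1) by (intro emeasure_mono) auto
    finally have "of_nat n * ennreal m \<le> ennreal a" using a(1) by (simp add: em area_def)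
    then show ?thesis
      using m a(2) by (simp add: ennreal_of_nat_eq_real_of_nat ennreal_le_iff flip: ennreal_mult)
  qed
  obtain n where "a < real n * m" using m reals_Archimedean3 by blast
  then show False using le[of n] by simp
qed

text \<open>The form \<open>\<phi>\<close> vanishes on the direction of recession. Lattice points on
  a line \<open>\<phi> = m\<close> recur with period (p, q), so an interior ray on such a line would
  hit one. Hence \<open>\<phi>\<close> takes no integer value on the connected interior and stays
  between two consecutive integers.\<close>

lemma ray_split:
  assumes K: "closed K" "convex K" and int: "interior K \<noteq> {}" "interior K \<inter> Z2 = {}"
    and ray: "\<And>x t. x \<in> K \<Longrightarrow> 0 \<le> t \<Longrightarrow> x + t *\<^sub>R r \<in> K"
    and r: "r = s *\<^sub>R (of_int p, of_int q)" "s > 0" "coprime p q"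
  shows "\<exists>S. is_split S \<and> K \<subseteq> S"
proof -
  define \<phi> where "\<phi> z = of_int (- q) * fst z + of_int p * snd z" for z :: "real \<times> real"
  obtain k l where kl: "k * p + l * q = 1" using r(3) by (metis bezout_int coprime_imp_gcd_eq_1)
  have kl': "real_of_int k * of_int p + of_int l * of_int q = 1" using kl by (metis of_int_1 of_int_add of_int_mult)
  have noint: "\<phi> y \<noteq> of_int m" if y: "y \<in> interior K" for y m
  proof
    assume m: "\<phi> y = of_int m"
    \<comment> \<open>The lattice point (- l m, k m) also lies on the line
      \<open>\<phi> = m\<close>; (w1, w2) is the vector from it to y, and \<open>\<tau>\<close>
      measures this vector in units of (p, q).\<close>
    define w1 w2 where "w1 = fst y + of_int (l * m)" and "w2 = snd y - of_int (k * m)"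
    define \<tau> where "\<tau> = of_int k * w1 + of_int l * w2"
    have w0: "- of_int q * w1 + of_int p * w2 = 0"
    proof -
      have "- of_int q * w1 + of_int p * w2 = \<phi> y - (real_of_int k * of_int p + of_int l * of_int q) * of_int m"
        by (simp add: w1_def w2_def \<phi>_def algebra_simps)
      then show ?thesis using m kl' by simp
    qed
    have w: "of_int p * \<tau> = w1" "of_int q * \<tau> = w2"
      unfolding \<tau>_def using w0 kl' by algebra+
    define N where "N = \<lceil>\<tau>\<rceil>"
    have "y + ((of_int N - \<tau>) / s) *\<^sub>R r \<in> interior K"
      using r(2) by (intro interior_ray[OF ray y]) (auto simp: N_def)
    also have "((of_int N - \<tau>) / s) *\<^sub>R r = ((of_int N - \<tau>) * of_int p, (of_int N - \<tau>) * of_int q)"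
      using r(2) by (simp add: r(1))
    also have "y + \<dots> = (of_int (N * p - l * m), of_int (N * q + k * m))"
      using w by (simp add: prod_eq_iff w1_def w2_def algebra_simps)
    finally have "(real_of_int (N * p - l * m), real_of_int (N * q + k * m)) \<in> interior K" .
    moreover have "(real_of_int (N * p - l * m), real_of_int (N * q + k * m)) \<in> Z2"
      by (simp del: of_int_add of_int_mult of_int_diff)
    ultimately show False using int(2) by blast
  qed
  obtain x0 where x0: "x0 \<in> interior K" using int by auto
  define b where "b = \<lfloor>\<phi> x0\<rfloor>"
  have b: "of_int b < \<phi> x0" "\<phi> x0 < of_int (b + 1)"
    using noint[OF x0, of b] noint[OF x0, of "b + 1"] by (auto simp: b_def less_le)
  have "continuous_on (interior K) \<phi>" unfolding \<phi>_def by (intro continuous_intros)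
  then have iv: "is_interval (\<phi> ` interior K)"
    using K(2) by (simp add: is_interval_connected_1 connected_continuous_image convex_connected convex_interior)
  have rng: "of_int b < \<phi> y \<and> \<phi> y < of_int (b + 1)" if y: "y \<in> interior K" for y
  proof (rule ccontr)
    assume n: "\<not> ?thesis"
    have mem: "\<phi> x0 \<in> \<phi> ` interior K" "\<phi> y \<in> \<phi> ` interior K" using x0 y by auto
    have "of_int b \<in> \<phi> ` interior K \<or> of_int (b + 1) \<in> \<phi> ` interior K"
    proof (cases "\<phi> y \<le> of_int b")
      case True
      then show ?thesis using mem_is_interval_1_I[OF iv mem(2,1), of "of_int b"] b by simp
    next
      case False
      then show ?thesis using mem_is_interval_1_I[OF iv mem, of "of_int (b + 1)"] b n by simp
    qed
    then show False using noint by (metis imageE)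
  qed
  define S where "S = {x. of_int b \<le> of_int (- q) * fst x + of_int p * snd x
              \<and> of_int (- q) * fst x + of_int p * snd x \<le> of_int b + (1::real)}"
  have "coprime (- q) p" using r(3) by (simp add: coprime_commute)
  then have "is_split S" unfolding is_split_def S_def by blast
  moreover have "closed S"
    unfolding S_def by (intro closed_Collect_conj closed_Collect_le continuous_intros)
  then have "closure (interior K) \<subseteq> S"
    using rng by (intro closure_minimal) (force simp: S_def \<phi>_def less_imp_le)+
  then have "K \<subseteq> S" using K int(1) by (simp add: convex_closure_interior)
  ultimately show ?thesis by blast
qed

text \<open>For rational slope the direction is a positive multiple of a primitive lattice vector.
  For irrational slope the heights over the vertical lattice lines are dense modulo 1, so the ray
  from an interior point passes so close to a lattice point that the translated ball contains
  it.\<close>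

lemma unbounded_lattice_free_split:
  assumes K: "closed K" "convex K" "\<not> bounded K" and int: "interior K \<noteq> {}" "interior K \<inter> Z2 = {}"
  shows "\<exists>S. is_split S \<and> K \<subseteq> S"
proof -
  obtain r where r: "norm r = 1" and ray: "\<And>x t. x \<in> K \<Longrightarrow> 0 \<le> t \<Longrightarrow> x + t *\<^sub>R r \<in> K"
    using unbounded_convex_ray[OF K] by blast
  have r0: "r \<noteq> 0" using r by auto
  show ?thesis
  proof (cases "fst r = 0")
    case True
    then have "snd r \<noteq> 0" using r0 by (simp add: prod_eq_iff)
    then have "r = \<bar>snd r\<bar> *\<^sub>R (of_int 0, of_int (if snd r > 0 then 1 else -1))"
      using True by (simp add: prod_eq_iff)
    then show ?thesis using \<open>snd r \<noteq> 0\<close>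
      by (intro ray_split[OF K(1,2) int ray, of "\<bar>snd r\<bar>" 0 "if snd r > 0 then 1 else -1"]) auto
  next
    case f0: False
    define \<rho> where "\<rho> = snd r / fst r"
    have rho: "snd r = \<rho> * fst r" using f0 by (simp add: \<rho>_def)
    show ?thesis
    proof (cases "\<rho> \<in> \<rat>")
      case True
      then obtain a b where ab: "b > 0" "coprime a b" "\<rho> = of_int a / of_int b"
        by (metis Rats_cases')
      define g :: int where "g = (if fst r > 0 then 1 else -1)"
      have "r = (\<bar>fst r\<bar> / of_int b) *\<^sub>R (of_int (g * b), of_int (g * a))"
        using ab f0 rho by (simp add: prod_eq_iff g_def)
      moreover have "coprime (g * b) (g * a)" using ab(2) by (simp add: g_def coprime_commute)
      moreover have "\<bar>fst r\<bar> / of_int b > 0" using ab f0 by simp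
      ultimately show ?thesis using ray_split[OF K(1,2) int ray] by blast
    next
      case irr: False
      \<comment> \<open>The sign g lets the density statement, which yields positive k, serve for
        rays running to the left as well.\<close>
      define g where "g = sgn (fst r)"
      have g: "g * g = 1" "g \<noteq> 0" "g = 1 \<or> g = -1" using f0 by (auto simp: g_def sgn_real_def)
      have irr': "g * \<rho> \<notin> \<rat>"
      proof
        assume "g * \<rho> \<in> \<rat>"
        then have "g * (g * \<rho>) \<in> \<rat>" using g(3) by auto
        then show False using irr g(1) by (simp flip: mult.assoc)
      qed
      obtain x0 where x0: "x0 \<in> interior K" using int by auto
      obtain e where e: "e > 0" "ball x0 e \<subseteq> K" using x0 by (meson mem_interior)
      \<comment> \<open>The offset puts every column \<open>g * (k + k0)\<close> with k > 0 ahead of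
        x0 on the ray, so that the parameter t below is nonnegative.\<close>
      define k0 where "k0 = \<lceil>\<bar>fst x0\<bar>\<rceil> + 1"
      \<comment> \<open>The bounded quantity is the height of the ray over the column
        \<open>g * (k + k0)\<close>, minus m.\<close>
      obtain m k where k: "k > 0" and close:
        "\<bar>of_int k * (g * \<rho>) - of_int m - (\<rho> * fst x0 - snd x0 - \<rho> * g * of_int k0)\<bar> < e"
        using sequence_of_fractional_parts_is_dense[OF irr' e(1)] by metis
      define h where "h = g * of_int (k + k0)"
      have hZ: "h \<in> \<int>" using g(3) by (auto simp: h_def)
      define t where "t = (h - fst x0) / fst r"
      have "t \<ge> 0"
      proof -
        have "real_of_int k > 0" using k by simp
        moreover have "real_of_int k0 \<ge> \<bar>fst x0\<bar>" by (simp add: k0_def) linarith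
        ultimately have "g * (h - fst x0) \<ge> 0"
          using g(3) by (auto simp: h_def)
        moreover have "fst r = g * \<bar>fst r\<bar>" by (simp add: g_def sgn_mult_abs)
        moreover have "t = (g * (h - fst x0)) / (g * fst r)" using g(2) by (simp add: t_def)
        ultimately show ?thesis using g(1) by (metis abs_ge_zero divide_nonneg_nonneg mult.assoc mult_1)
      qed
      have y: "x0 + t *\<^sub>R r = (h, snd x0 + \<rho> * (h - fst x0))"
        using f0 by (simp add: prod_eq_iff t_def rho)
      have "\<bar>snd x0 + \<rho> * (h - fst x0) - of_int m\<bar> < e"
        using close by (simp add: h_def algebra_simps)
      then have "(h, of_int m) \<in> ball (x0 + t *\<^sub>R r) e"
        unfolding y by (simp add: dist_prod_def dist_real_def)
      moreover have "ball (x0 + t *\<^sub>R r) e \<subseteq> K"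
      proof
        fix z assume "z \<in> ball (x0 + t *\<^sub>R r) e"
        then have "z - t *\<^sub>R r \<in> K" using e(2) by (auto simp: dist_norm algebra_simps)
        then show "z \<in> K" using ray[of "z - t *\<^sub>R r" t] \<open>t \<ge> 0\<close> by simp
      qed
      ultimately have "(h, of_int m) \<in> interior K"
        using interior_maximal[OF _ open_ball] by blast
      moreover have "(h, of_int m) \<in> Z2" using hZ by simp
      ultimately show ?thesis using int(2) by blast
    qed
  qed
qed

lemma split_lattice_width:
  assumes "is_split S" "K \<subseteq> S" "K \<noteq> {}"
  shows "lattice_width K \<le> 1"
proof -
  obtain a1 a2 b :: int where ab: "coprime a1 a2" "S = {x. of_int b \<le> of_int a1 * fst x + of_int a2 * snd x
              \<and> of_int a1 * fst x + of_int a2 * snd x \<le> of_int b + 1}"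
    using assms(1) unfolding is_split_def by blast
  define u where "u = (real_of_int a1, real_of_int a2)"
  have u: "u \<in> Z2 - {0}" using ab(1) by (auto simp: u_def zero_prod_def)
  have bnd: "of_int b \<le> u \<bullet> x" "u \<bullet> x \<le> of_int b + 1" if "x \<in> K" for x
    using that assms(2) ab(2) by (auto simp: u_def inner_prod_def)
  have "(SUP x\<in>K. ereal (u \<bullet> x)) \<le> ereal (of_int b + 1)"
    using bnd(2) by (intro SUP_least) auto
  moreover have "ereal (of_int b) \<le> (INF x\<in>K. ereal (u \<bullet> x))"
    using bnd(1) by (intro INF_greatest) auto
  ultimately have "width_fun K u \<le> ereal (of_int b + 1) - ereal (of_int b)"
    unfolding width_fun_def by (rule ereal_minus_mono)
  then have "width_fun K u \<le> 1" by (simp add: one_ereal_def)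
  then show ?thesis
    unfolding lattice_width_def using u by (meson INF_lower2)
qed

section \<open>Attainment of the lattice width\<close>

lemma width_fun_compact:
  assumes "compact K" "K \<noteq> {}"
  obtains x y where "x \<in> K" "y \<in> K" "width_fun K u = ereal (u \<bullet> (x - y))"
    "\<And>x' y'. x' \<in> K \<Longrightarrow> y' \<in> K \<Longrightarrow> u \<bullet> (x' - y') \<le> u \<bullet> (x - y)"
proof -
  have c: "continuous_on K (\<lambda>x. u \<bullet> x)" by (intro continuous_intros)
  obtain x where x: "x \<in> K" "\<And>z. z \<in> K \<Longrightarrow> u \<bullet> z \<le> u \<bullet> x"
    using continuous_attains_sup[OF assms c] by blast
  obtain y where y: "y \<in> K" "\<And>z. z \<in> K \<Longrightarrow> u \<bullet> y \<le> u \<bullet> z"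
    using continuous_attains_inf[OF assms c] by blast
  have "(SUP z\<in>K. ereal (u \<bullet> z)) = ereal (u \<bullet> x)"
    using x by (intro SUP_eqI) auto
  moreover have "(INF z\<in>K. ereal (u \<bullet> z)) = ereal (u \<bullet> y)"
    using y by (intro INF_eqI) auto
  ultimately have "width_fun K u = ereal (u \<bullet> (x - y))"
    by (simp add: width_fun_def inner_diff_right)
  moreover have "u \<bullet> (x' - y') \<le> u \<bullet> (x - y)" if "x' \<in> K" "y' \<in> K" for x' y'
    using x(2)[OF that(1)] y(2)[OF that(2)] by (simp add: inner_diff_right)
  ultimately show thesis using that x(1) y(1) by blast
qed

lemma finite_Z2_bounded: "finite {u \<in> Z2. norm u \<le> R}"
proof -
  have "{u \<in> Z2. norm u \<le> R} \<subseteq> (\<lambda>(i, j). (of_int i, of_int j)) ` ({-\<lceil>R\<rceil>..\<lceil>R\<rceil>} \<times> {-\<lceil>R\<rceil>..\<lceil>R\<rceil>})"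
  proof
    fix u assume u: "u \<in> {u \<in> Z2. norm u \<le> R}"
    then obtain i j where ij: "u = (of_int i, of_int j)" by (auto elim: Z2_cases)
    have "\<bar>real_of_int i\<bar> \<le> R" "\<bar>real_of_int j\<bar> \<le> R"
      using u norm_fst_le[of "real_of_int i" "real_of_int j"] norm_snd_le[of "real_of_int j" "real_of_int i"]
      by (auto simp: ij)
    then have "\<bar>i\<bar> \<le> \<lceil>R\<rceil>" "\<bar>j\<bar> \<le> \<lceil>R\<rceil>" by linarith+
    then show "u \<in> (\<lambda>(i, j). (of_int i, of_int j)) ` ({-\<lceil>R\<rceil>..\<lceil>R\<rceil>} \<times> {-\<lceil>R\<rceil>..\<lceil>R\<rceil>})"
      by (auto simp: ij intro!: image_eqI[of _ _ "(i, j)"])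
  qed
  then show ?thesis by (rule finite_subset) auto
qed

text \<open>K contains a ball of radius e, so its width in direction u is at least 2 e |u|. Only
  finitely many u can then undercut (1, 0), and the infimum is a minimum.\<close>

lemma compact_lattice_width:
  assumes K: "compact K" and int: "interior K \<noteq> {}"
  obtains w where "lattice_width K = ereal w" "0 < w" "wide K w" "thin K w"
proof -
  obtain c e where e: "e > 0" "cball c e \<subseteq> K"
    using int by (meson ex_in_conv mem_interior_cball)
  have ne: "K \<noteq> {}" using int by auto
  have cK: "c \<in> K" using e by auto
  have "\<exists>g. width_fun K u = ereal g \<and> (\<exists>x\<in>K. \<exists>y\<in>K. g = u \<bullet> (x - y)) \<and>
      (\<forall>x\<in>K. \<forall>y\<in>K. u \<bullet> (x - y) \<le> g)" for u
    using width_fun_compact[OF K ne, of u] by metis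
  then obtain g where g: "\<And>u. width_fun K u = ereal (g u)" "\<And>u. \<exists>x\<in>K. \<exists>y\<in>K. g u = u \<bullet> (x - y)"
      "\<And>u x y. x \<in> K \<Longrightarrow> y \<in> K \<Longrightarrow> u \<bullet> (x - y) \<le> g u"
    by metis
  have low: "2 * e * norm u \<le> g u" for u
  proof (cases "u = 0")
    case True then show ?thesis using g(3)[OF cK cK, of u] by simp
  next
    case False
    have "c + (e / norm u) *\<^sub>R u \<in> K" "c - (e / norm u) *\<^sub>R u \<in> K"
      using e False by (auto intro!: subsetD[OF e(2)] simp: dist_norm)
    from g(3)[OF this, of u] show ?thesis
      using False by (simp add: inner_add_right inner_diff_right dot_square_norm power2_eq_square)
  qed
  define U where "U = {u \<in> Z2. norm u \<le> g (1,0) / (2 * e)} - {0}"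
  have "finite U" by (simp add: U_def finite_Z2_bounded)
  moreover have U1: "(1,0) \<in> U"
    using low[of "(1,0)"] e by (simp add: U_def zero_prod_def norm_prod_def field_simps)
  ultimately obtain v where v: "v \<in> U" "\<And>u. u \<in> U \<Longrightarrow> g v \<le> g u"
    by (metis empty_iff finite_has_minimal2 arg_min_if_finite(1) arg_min_least)
  have vmin: "g v \<le> g u" if u: "u \<in> Z2 - {0}" for u
  proof (cases "u \<in> U")
    case True then show ?thesis by (rule v)
  next
    case False
    then have "g (1,0) < 2 * e * norm u" using u e by (simp add: U_def field_simps)
    then show ?thesis using v(2)[OF U1] low[of u] by linarith
  qed
  have vZ: "v \<in> Z2 - {0}" using v(1) by (auto simp: U_def)
  show thesis
  proof (rule that)
    show "lattice_width K = ereal (g v)"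
      unfolding lattice_width_def g(1) using vmin vZ by (intro INF_eqI) auto
    have "0 < norm v" using vZ by simp
    then show "0 < g v" using low[of v] e by (meson mult_pos_pos order_less_le_trans zero_less_numeral)
    show "wide K (g v)" unfolding wide_def using vmin g(2) by metis
    show "thin K (g v)" unfolding thin_def using vZ g(3) by blast
  qed
qed

section \<open>Separation and vertical sections\<close>

lemma separating_point_interior:
  fixes K :: "'a::euclidean_space set"
  assumes K: "convex K" "interior K \<noteq> {}" and z: "z \<notin> interior K"
  obtains a where "a \<noteq> 0" "\<And>x. x \<in> K \<Longrightarrow> 0 \<le> a \<bullet> (x - z)"
proof -
  have "\<exists>a b. a \<noteq> 0 \<and> (\<forall>x\<in>{z}. a \<bullet> x \<le> b) \<and> (\<forall>x\<in>interior K. a \<bullet> x \<ge> b)"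
    using K z by (intro separating_hyperplane_sets) (auto simp: convex_interior)
  then obtain a b where ab: "a \<noteq> 0" "a \<bullet> z \<le> b" "\<And>x. x \<in> interior K \<Longrightarrow> b \<le> a \<bullet> x" by auto
  have "closure (interior K) \<subseteq> {x. b \<le> a \<bullet> x}"
    using ab(3) by (intro closure_minimal) (auto simp: closed_halfspace_ge)
  moreover have "K \<subseteq> closure (interior K)"
    using K by (simp add: convex_closure_interior closure_subset)
  ultimately show thesis using ab by (intro that[of a]) (auto simp: inner_diff_right)
qed

text \<open>Shrinking an end point of K towards an interior point on the other side of the line x =
  i passes through the line, and every point reached after the start is interior.\<close>

lemma column_interior:
  fixes K :: "(real \<times> real) set"
  assumes K: "convex K" "interior K \<noteq> {}" and lr: "l \<in> K" "r \<in> K" "fst l < i" "i < fst r"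
  obtains y where "(i, y) \<in> interior K"
proof -
  obtain c where c: "c \<in> interior K" using K(2) by auto
  have seg: "\<exists>y. (i, y) \<in> interior K" if x: "x \<in> K" "(fst c < i \<and> i < fst x) \<or> (fst x < i \<and> i < fst c)" for x
  proof -
    define e where "e = (fst x - i) / (fst x - fst c)"
    have e: "0 < e" "e \<le> 1" using x(2) by (auto simp: e_def field_simps)
    have "x - e *\<^sub>R (x - c) \<in> interior K"
      using mem_interior_convex_shrink[OF K(1) c x(1) e] .
    moreover have "fst (x - e *\<^sub>R (x - c)) = i" using x(2) by (auto simp: e_def)
    ultimately show ?thesis by (metis prod.collapse)
  qed
  consider "fst c < i" | "fst c = i" | "i < fst c" by linarith
  then have "\<exists>y. (i, y) \<in> interior K"
  proof cases
    case 2 then show ?thesis using c by (metis prod.collapse)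
  qed (use seg lr in blast)+
  then show thesis using that by blast
qed

section \<open>The lower bound\<close>

text \<open>The three products multiply to at least 1/64, while the regrouped product consists of
  three factors x (1 - x), none above 1/4. So each factor equals 1/4.\<close>

lemma six_factor_bound:
  fixes a c n :: real
  assumes "0 < a" "a < 1" "0 < c" "c < 1" "0 < n" "n < 1"
    and "1/4 \<le> a * c" "1/4 \<le> (1 - a) * (1 - n)" "1/4 \<le> (1 - c) * n"
  shows "a = 1/2 \<and> c = 1/2 \<and> n = 1/2"
proof -
  have q: "x * (1 - x) \<le> 1/4" for x :: real
    using zero_le_power2[of "x - 1/2"] by (simp add: power2_eq_square algebra_simps)
  have pos: "0 < a * (1 - a)" "0 < c * (1 - c)" "0 < n * (1 - n)" using assms by auto
  have "(1/4) * (1/4) \<le> (a * c) * ((1 - a) * (1 - n))"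
    using assms(7,8) by (intro mult_mono) auto
  then have "((1/4) * (1/4)) * (1/4) \<le> ((a * c) * ((1 - a) * (1 - n))) * ((1 - c) * n)"
    using assms(9) pos by (intro mult_mono[of "(1/4) * (1/4)" _ "1/4"]) linarith+
  then have P: "1/64 \<le> (a * (1 - a)) * (c * (1 - c)) * (n * (1 - n))"
    by (simp add: algebra_simps)
  have eq: "x = 1/2" if "1/4 \<le> x * (1 - x)" for x :: real
  proof -
    have "(x - 1/2)\<^sup>2 \<le> 0" using that by (simp add: power2_eq_square algebra_simps)
    then show ?thesis by simp
  qed
  have bound: "1/4 \<le> u" if "1/64 \<le> u * v * w" "0 < u" "0 < v" "v \<le> 1/4" "0 < w" "w \<le> 1/4" for u v w :: real
  proof -
    have "v * w \<le> (1/4) * (1/4)" using that by (intro mult_mono) auto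
    then have "u * (v * w) \<le> u * (1/16)" using that by (intro mult_left_mono) auto
    then show ?thesis using that(1) unfolding mult.assoc by linarith
  qed
  have "1/4 \<le> a * (1 - a)"
    by (rule bound[OF P]) (use pos q in auto)
  moreover have "1/4 \<le> c * (1 - c)"
    by (rule bound[of _ "a * (1 - a)" "n * (1 - n)"]) (use pos q P in \<open>auto simp: ac_simps\<close>)
  moreover have "1/4 \<le> n * (1 - n)"
    by (rule bound[of _ "a * (1 - a)" "c * (1 - c)"]) (use pos q P in \<open>auto simp: ac_simps\<close>)
  ultimately show ?thesis using eq by blast
qed

lemma convex_chord_scale:
  assumes "convex K" "x \<in> K" "y \<in> K" "0 \<le> s" "s \<le> 1"
  shows "\<exists>x'\<in>K. \<exists>y'\<in>K. x' - y' = s *\<^sub>R (x - y)"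
proof -
  have "s *\<^sub>R x + (1 - s) *\<^sub>R y \<in> K" using assms by (intro convexD) auto
  moreover have "s *\<^sub>R x + (1 - s) *\<^sub>R y - y = s *\<^sub>R (x - y)" by (simp add: algebra_simps)
  ultimately show ?thesis using assms(3) by blast
qed

text \<open>Shortening a chord makes its length in the given direction exactly w, which normalises
  the chords used below.\<close>

lemma wide_chord:
  assumes K: "convex K" "wide K w" "0 < w" and ij: "\<bar>i\<bar> + \<bar>j\<bar> > (0::int)"
  obtains x y where "x \<in> K" "y \<in> K" "of_int i * (fst x - fst y) + of_int j * (snd x - snd y) = w"
proof -
  obtain x y where xy: "x \<in> K" "y \<in> K" "w \<le> of_int i * (fst x - fst y) + of_int j * (snd x - snd y)"
    using wideD[OF K(2) ij] by blast
  define W where "W = of_int i * (fst x - fst y) + of_int j * (snd x - snd y)"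
  obtain x' y' where x': "x' \<in> K" "y' \<in> K" "x' - y' = (w / W) *\<^sub>R (x - y)"
    using convex_chord_scale[OF K(1) xy(1,2), of "w / W"] xy(3) K(3) by (auto simp: W_def)
  have "fst x' - fst y' = (w / W) * (fst x - fst y)" "snd x' - snd y' = (w / W) * (snd x - snd y)"
    using x'(3) by (simp_all add: prod_eq_iff)
  then have "of_int i * (fst x' - fst y') + of_int j * (snd x' - snd y') = (w / W) * W"
    by (simp only: W_def distrib_left mult.left_commute)
  also have "\<dots> = w" using xy(3) K(3) by (simp add: W_def)
  finally show thesis using that x' by blast
qed

text \<open>A shear brings the slope a of the chord realising the width into [0,1). This is what confines the
  parameters c and n of the other two chords to the unit interval as well.\<close>

lemma area_le_forces_chords:
  assumes K: "compact K" "convex K" "wide K w" "0 < w"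
    and thin: "\<And>x y. x \<in> K \<Longrightarrow> y \<in> K \<Longrightarrow> fst x - fst y \<le> w"
    and lr: "l \<in> K" "r \<in> K" "r - l = (w, a * w)" "0 \<le> a" "a < 1"
    and A: "ar K \<le> 3/8 * w\<^sup>2"
  shows "ar K = 3/8 * w\<^sup>2 \<and> a = 1/2 \<and> (\<exists>b\<in>K. \<exists>t\<in>K. t - b = (w/2, w)) \<and> (\<exists>p\<in>K. \<exists>q\<in>K. p - q = (w/2, - (w/2)))"
proof -
  obtain t b where tb: "t \<in> K" "b \<in> K" "snd t - snd b = w"
    by (rule wide_chord[OF K(2,3,4), of 0 1]) auto
  obtain p q where pq: "p \<in> K" "q \<in> K" "(fst p - fst q) - (snd p - snd q) = w"
    by (rule wide_chord[OF K(2,3,4), of 1 "-1"]) (auto simp: algebra_simps)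
  \<comment> \<open>With these parameters the chord for direction (0, 1) is w (c, 1), and the one
    for direction (1, -1) is w (1 - n, - n).\<close>
  define c where "c = (fst t - fst b) / w"
  define n where "n = (snd q - snd p) / w"
  have dt: "t - b = (c * w, w)" using tb K(4) by (simp add: c_def prod_eq_iff)
  have dp: "p - q = ((1 - n) * w, - n * w)"
  proof -
    have "n * w = snd q - snd p" using K(4) by (simp add: n_def)
    then show ?thesis using pq by (simp add: prod_eq_iff algebra_simps)
  qed
  \<comment> \<open>The horizontal extent of K is at most w, which bounds the first component of the
    second chord.\<close>
  have c1: "c \<le> 1"
    using thin[OF tb(1,2)] K(4) by (simp add: c_def)
  have w2: "w\<^sup>2 > 0" using K(4) by simp
  have A1: "\<bar>1 - a * c\<bar> * w\<^sup>2 / 2 \<le> ar K"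
  proof -
    have "cross2 (r - l) (t - b) = (1 - a * c) * w\<^sup>2"
      unfolding lr(3) dt by (simp add: cross2_def power2_eq_square algebra_simps)
    then show ?thesis using two_chords[OF K(1,2) lr(1,2) tb(2,1)] by (simp add: abs_mult)
  qed
  have A2: "\<bar>1 - (1 - a) * (1 - n)\<bar> * w\<^sup>2 / 2 \<le> ar K"
  proof -
    have "cross2 (r - l) (p - q) = - ((1 - (1 - a) * (1 - n)) * w\<^sup>2)"
      unfolding lr(3) dp by (simp add: cross2_def power2_eq_square algebra_simps)
    then show ?thesis using two_chords[OF K(1,2) lr(1,2) pq(2,1)] by (simp add: abs_mult)
  qed
  have A3: "\<bar>1 - (1 - c) * n\<bar> * w\<^sup>2 / 2 \<le> ar K"
  proof -
    have "cross2 (t - b) (p - q) = - ((1 - (1 - c) * n) * w\<^sup>2)"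
      unfolding dt dp by (simp add: cross2_def power2_eq_square algebra_simps)
    then show ?thesis using two_chords[OF K(1,2) tb(2,1) pq(2,1)] by (simp add: abs_mult)
  qed
  \<comment> \<open>An area of at most 3/8 w^2 allows cross products of at most 3/4 w^2, so each of
    the three products is at least 1/4.\<close>
  have cut: "1/4 \<le> x" if "\<bar>1 - x\<bar> * w\<^sup>2 / 2 \<le> ar K" for x
  proof -
    have "\<bar>1 - x\<bar> * w\<^sup>2 \<le> (3/4) * w\<^sup>2" using that A by simp
    then have "\<bar>1 - x\<bar> \<le> 3/4" using w2 by simp
    then show ?thesis by linarith
  qed
  note B = cut[OF A1] cut[OF A2] cut[OF A3]
  have a: "a > 0" using B(1) lr(4) by (cases "a = 0") auto
  have c0: "c > 0"
  proof (rule ccontr)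
    assume "\<not> c > 0"
    then have "a * c \<le> 0" using a by (simp add: mult_nonneg_nonpos)
    then show False using B(1) by simp
  qed
  have cl1: "c < 1" using B(3) c1 by (cases "c = 1") auto
  have n0: "n > 0"
  proof (rule ccontr)
    assume "\<not> n > 0"
    then have "(1 - c) * n \<le> 0" using cl1 by (simp add: mult_nonneg_nonpos)
    then show False using B(3) by simp
  qed
  have n1: "n < 1"
  proof (rule ccontr)
    assume "\<not> n < 1"
    then have "(1 - a) * (1 - n) \<le> 0" using lr by (simp add: mult_nonneg_nonpos)
    then show False using B(2) by simp
  qed
  have half: "a = 1/2 \<and> c = 1/2 \<and> n = 1/2"
    using six_factor_bound[OF a lr(5) c0 cl1 n0 n1 B] .
  have "ar K = 3/8 * w\<^sup>2" using A A1 half by simp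
  moreover have "t - b = (w/2, w)" "p - q = (w/2, - (w/2))" using dt dp half by simp_all
  ultimately show ?thesis using half tb pq by blast
qed

lemma lower_bound_normal_position:
  assumes K: "compact K" "convex K" "K \<noteq> {}" "wide K w" "thin K w" "0 < w"
  obtains T l r a where "unimodular T" "\<And>x y. x \<in> T ` K \<Longrightarrow> y \<in> T ` K \<Longrightarrow> fst x - fst y \<le> w"
    "l \<in> T ` K" "r \<in> T ` K" "r - l = (w, a * w)" "0 \<le> a" "a < 1"
proof -
  obtain S where S: "unimodular S" "\<And>x y. x \<in> S ` K \<Longrightarrow> y \<in> S ` K \<Longrightarrow> fst x - fst y \<le> w"
    using thin_fst[OF K(5,3)] K(6) by auto
  have SK: "convex (S ` K)" "wide (S ` K) w"
    using wide_unimodular convex_unimodular S(1) K by auto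
  obtain r l where rl: "r \<in> S ` K" "l \<in> S ` K" "fst r - fst l = w"
    by (rule wide_chord[OF SK K(6), of 1 0]) auto
  define a where "a = (snd r - snd l) / w"
  define k where "k = \<lfloor>a\<rfloor>"
  define U where "U = umap 1 0 (- k) 1 0 0"
  have U: "unimodular U" unfolding U_def by (intro unimodular_umap) simp
  show thesis
  proof (rule that[of "U \<circ> S" "U l" "U r" "frac a"])
    show "unimodular (U \<circ> S)" by (rule unimodular_comp[OF U S(1)])
    show "fst x - fst y \<le> w" if "x \<in> (U \<circ> S) ` K" "y \<in> (U \<circ> S) ` K" for x y
    proof -
      obtain x' y' where "x' \<in> K" "y' \<in> K" "x = U (S x')" "y = U (S y')" using \<open>x \<in> _\<close> \<open>y \<in> _\<close> by auto
      then show ?thesis using S(2)[of "S x'" "S y'"] by (simp add: U_def umap_def)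
    qed
    show "U l \<in> (U \<circ> S) ` K" "U r \<in> (U \<circ> S) ` K"
      using rl by (auto simp: image_comp[symmetric])
    have "snd r - snd l = a * w" using K(6) by (simp add: a_def)
    then show "U r - U l = (w, frac a * w)"
      using rl(3) by (simp add: U_def umap_def frac_def k_def prod_eq_iff algebra_simps)
  qed (auto simp: frac_lt_1)
qed

text \<open>A body violating the bound would satisfy the hypotheses of
  \<open>area_le_forces_chords\<close>, whose conclusion is that the bound is attained.\<close>

theorem area_lower_bound:
  assumes K: "compact K" "convex K" "K \<noteq> {}" "wide K w" "thin K w" "0 < w"
  shows "3/8 * w\<^sup>2 \<le> ar K"
proof (rule ccontr)
  assume n: "\<not> ?thesis"
  obtain T l r a where T: "unimodular T" "\<And>x y. x \<in> T ` K \<Longrightarrow> y \<in> T ` K \<Longrightarrow> fst x - fst y \<le> w"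
    "l \<in> T ` K" "r \<in> T ` K" "r - l = (w, a * w)" "0 \<le> a" "a < 1"
    using lower_bound_normal_position[OF K] by blast
  have "ar (T ` K) = 3/8 * w\<^sup>2"
    using area_le_forces_chords[OF compact_unimodular[OF T(1) K(1)] convex_unimodular[OF T(1) K(2)]
      wide_unimodular[OF T(1) K(4)] K(6) T(2-7)] n ar_unimodular[OF T(1) K(1)] by simp
  then show False using n ar_unimodular[OF T(1) K(1)] by simp
qed

text \<open>By the two-chord estimate every difference of points of an extremal body has cross product at most
  3/4 w^2 with each of the three forced chords, which confines the body to a hexagon with one free
  parameter b; the area leaves only the two triangles b = 0 and b = 1.\<close>

lemma forced_chords_triangle:
  assumes K: "compact K" "convex K" and w: "0 < w" and A: "ar K = 3/8 * w\<^sup>2"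
    and lr: "l \<in> K" "r \<in> K" "r - l = (w, w/2)"
    and bt: "b \<in> K" "t \<in> K" "t - b = (w/2, w)"
    and pq: "p \<in> K" "q \<in> K" "p - q = (w/2, - (w/2))"
  shows "K = convex hull {l, l + (w, w/2), l + (w/2, w)} \<or> K = convex hull {r, r - (w, w/2), r - (w/2, w)}"
proof -
  define D where "D = 3/4 * w\<^sup>2"
  have D: "D > 0" using w by (simp add: D_def)
  \<comment> \<open>Coordinates with origin l in the basis (w, w/2), (w/2, w) of two forced chord
    vectors; D is the determinant of this basis.\<close>
  define \<xi> \<eta> where "\<xi> z = (4/3 * (fst z - fst l) - 2/3 * (snd z - snd l)) / w"
    and "\<eta> z = (4/3 * (snd z - snd l) - 2/3 * (fst z - fst l)) / w" for z
  have repr: "z = l + \<xi> z *\<^sub>R (w, w/2) + \<eta> z *\<^sub>R (w/2, w)" for z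
    using w by (simp add: \<xi>_def \<eta>_def prod_eq_iff field_simps)
  have e1: "\<bar>\<eta> x - \<eta> y\<bar> \<le> 1" if "x \<in> K" "y \<in> K" for x y
  proof -
    have "cross2 (r - l) (x - y) = D * (\<eta> x - \<eta> y)"
      unfolding lr(3) using w by (simp add: cross2_def \<eta>_def D_def power2_eq_square field_simps)
    then have "\<bar>D * (\<eta> x - \<eta> y)\<bar> / 2 \<le> 3/8 * w\<^sup>2"
      using two_chords[OF K lr(1,2) that(2,1)] A by simp
    then have "D * \<bar>\<eta> x - \<eta> y\<bar> \<le> D * 1" using D by (simp add: abs_mult D_def)
    then show ?thesis using D by (simp add: mult_le_cancel_left)
  qed
  have e2: "\<bar>\<xi> x - \<xi> y\<bar> \<le> 1" if "x \<in> K" "y \<in> K" for x y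
  proof -
    have "cross2 (t - b) (x - y) = - (D * (\<xi> x - \<xi> y))"
      unfolding bt(3) using w by (simp add: cross2_def \<xi>_def D_def power2_eq_square field_simps)
    then have "\<bar>D * (\<xi> x - \<xi> y)\<bar> / 2 \<le> 3/8 * w\<^sup>2"
      using two_chords[OF K bt(1,2) that(2,1)] A by simp
    then have "D * \<bar>\<xi> x - \<xi> y\<bar> \<le> D * 1" using D by (simp add: abs_mult D_def)
    then show ?thesis using D by (simp add: mult_le_cancel_left)
  qed
  have e3: "\<bar>(\<xi> x + \<eta> x) - (\<xi> y + \<eta> y)\<bar> \<le> 1" if "x \<in> K" "y \<in> K" for x y
  proof -
    have "cross2 (p - q) (x - y) = D * ((\<xi> x + \<eta> x) - (\<xi> y + \<eta> y))"
      unfolding pq(3) using w by (simp add: cross2_def \<xi>_def \<eta>_def D_def power2_eq_square field_simps)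
    then have "\<bar>D * ((\<xi> x + \<eta> x) - (\<xi> y + \<eta> y))\<bar> / 2 \<le> 3/8 * w\<^sup>2"
      using two_chords[OF K pq(2,1) that(2,1)] A by simp
    then have "D * \<bar>(\<xi> x + \<eta> x) - (\<xi> y + \<eta> y)\<bar> \<le> D * 1" using D by (simp add: abs_mult D_def)
    then show ?thesis using D by (simp add: mult_le_cancel_left)
  qed
  have l0: "\<xi> l = 0" "\<eta> l = 0" by (simp_all add: \<xi>_def \<eta>_def)
  have diff: "\<xi> x - \<xi> y = (4/3 * fst (x - y) - 2/3 * snd (x - y)) / w"
             "\<eta> x - \<eta> y = (4/3 * snd (x - y) - 2/3 * fst (x - y)) / w" for x y
    using w by (simp_all add: \<xi>_def \<eta>_def field_simps)
  have r1: "\<xi> r = 1" "\<eta> r = 0"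
    using diff[of r l] w unfolding l0 lr(3) by (simp_all add: field_simps)
  have tb': "\<xi> t = \<xi> b" "\<eta> t = \<eta> b + 1"
    using diff[of t b] w unfolding bt(3) by (simp_all add: field_simps)
  have pq': "\<xi> p = \<xi> q + 1" "\<eta> p = \<eta> q - 1"
    using diff[of p q] w unfolding pq(3) by (simp_all add: field_simps)
  have x01: "0 \<le> \<xi> z" "\<xi> z \<le> 1" and s01: "0 \<le> \<xi> z + \<eta> z" "\<xi> z + \<eta> z \<le> 1" if z: "z \<in> K" for z
    using e2[OF z lr(1)] e2[OF z lr(2)] e3[OF z lr(1)] e3[OF z lr(2)] l0 r1 by linarith+
  \<comment> \<open>The chord from b to t raises \<open>\<xi> + \<eta>\<close> by 1, and this sum
    lies in [0,1] on K. So it is 0 at b and 1 at t, and a single parameter remains.\<close>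
  define \<beta> where "\<beta> = \<xi> b"
  have b: "\<xi> b = \<beta>" "\<eta> b = - \<beta>" "\<xi> t = \<beta>" "\<eta> t = 1 - \<beta>"
    using s01[OF bt(1)] s01[OF bt(2)] tb' by (simp_all add: \<beta>_def)
  have \<beta>: "0 \<le> \<beta>" "\<beta> \<le> 1" using x01[OF bt(1)] b by simp_all
  have y: "- \<beta> \<le> \<eta> z" "\<eta> z \<le> 1 - \<beta>" if z: "z \<in> K" for z
    using e1[OF z bt(1)] e1[OF z bt(2)] b by linarith+
  have pc: "\<xi> p = 1" "\<eta> p = - \<beta>" "\<xi> q = 0" "\<eta> q = 1 - \<beta>"
    using x01[OF pq(1)] x01[OF pq(2)] y[OF pq(1)] y[OF pq(2)] pq' by linarith+
  \<comment> \<open>For \<open>\<beta>\<close> strictly between 0 and 1 the triangles over l r with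
    apexes p and t already have the full area of K and would exhaust it, but b lies in
    neither.\<close>
  have "\<beta> = 0 \<or> \<beta> = 1"
  proof (rule ccontr)
    assume nb: "\<not> ?thesis"
    then have \<beta>': "0 < \<beta>" "\<beta> < 1" using \<beta> by auto
    have cr: "cross2 (r - l) (z - l) = D * \<eta> z" for z
      unfolding lr(3) using w by (simp add: cross2_def \<eta>_def D_def power2_eq_square field_simps)
    have sub: "convex hull {l, r, p} \<union> convex hull {l, r, t} \<subseteq> K"
      using triangle_subset[OF K(2)] lr pq bt by blast
    have cpt: "compact (convex hull {l, r, p} \<union> convex hull {l, r, t})"
      by (intro compact_Un compact_triangle)
    have "l \<noteq> r" using lr(3) w by (auto simp: zero_prod_def)
    then have "ar (convex hull {l, r, p} \<union> convex hull {l, r, t}) = \<bar>cross2 (r - l) (t - p)\<bar> / 2"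
      using D \<beta>' by (intro ar_opposite_triangles) (auto simp: cr pc b)
    also have "cross2 (r - l) (t - p) = cross2 (r - l) (t - l) - cross2 (r - l) (p - l)"
      by (simp add: cross2_def algebra_simps)
    also have "\<dots> = D" by (simp add: cr pc b algebra_simps)
    finally have eqA: "ar (convex hull {l, r, p} \<union> convex hull {l, r, t}) = ar K" using A D by (simp add: D_def)
    have "interior K \<noteq> {}"
    proof
      assume "interior K = {}"
      then have "negligible K" using K(2) by (simp add: negligible_convex_interior)
      then have "K \<in> null_sets lebesgue" by (simp add: negligible_iff_null_sets)
      then have "measure lebesgue K = 0" by (simp add: measure_eq_0_null_sets)
      then have "ar K = 0" using K(1) by (simp add: ar_def measure_completion borel_compact)
      then show False using A w by simp
    qed
    then have "K \<subseteq> convex hull {l, r, p} \<union> convex hull {l, r, t}"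
      using convex_ar_eq_imp_subset[OF K(1,2) _ cpt] eqA sub by (simp add: inf_absorb1)
    moreover have "b \<notin> convex hull {l, r, t}"
    proof
      assume "b \<in> convex hull {l, r, t}"
      then have "0 \<le> cross2 (r - l) (b - l)"
        using D \<beta>' by (intro cross2_hull_ge[of b l r t]) (auto simp: cr b)
      moreover have "0 < D * \<beta>" using D \<beta>' by simp
      ultimately show False by (simp add: cr b)
    qed
    moreover have "b \<notin> convex hull {l, r, p}"
    proof
      assume "b \<in> convex hull {l, r, p}"
      then obtain u v s where uvs: "0 \<le> u" "0 \<le> v" "0 \<le> s" "u + v + s = 1" "b = u *\<^sub>R l + v *\<^sub>R r + s *\<^sub>R p"
        by (auto simp: convex_hull_3)
      have aff: "\<xi> (u *\<^sub>R l + v *\<^sub>R r + s *\<^sub>R p) = u * \<xi> l + v * \<xi> r + s * \<xi> p"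
                "\<eta> (u *\<^sub>R l + v *\<^sub>R r + s *\<^sub>R p) = u * \<eta> l + v * \<eta> r + s * \<eta> p"
      proof -
        have u: "u = 1 - v - s" using uvs by simp
        show "\<xi> (u *\<^sub>R l + v *\<^sub>R r + s *\<^sub>R p) = u * \<xi> l + v * \<xi> r + s * \<xi> p"
             "\<eta> (u *\<^sub>R l + v *\<^sub>R r + s *\<^sub>R p) = u * \<eta> l + v * \<eta> r + s * \<eta> p"
          unfolding u \<xi>_def \<eta>_def using w by (simp_all add: field_simps)
      qed
      have "\<beta> = v + s" "\<beta> = s * \<beta>"
        using aff uvs(5) b l0 r1 pc by auto
      then show False using \<beta>' uvs by auto
    qed
    ultimately show False using bt(1) by blast
  qed
  then show ?thesis
  proof
    assume \<beta>0: "\<beta> = 0"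
    have "t = l + (w/2, w)" using repr[of t] b \<beta>0 by (simp add: prod_eq_iff)
    moreover have "r = l + (w, w/2)" using lr(3) by (simp add: prod_eq_iff)
    ultimately have "convex hull {l, l + (w, w/2), l + (w/2, w)} \<subseteq> K"
      using triangle_subset[OF K(2) lr(1,2) bt(2)] by simp
    moreover have "z \<in> convex hull {l, l + (w, w/2), l + (w/2, w)}" if z: "z \<in> K" for z
    proof (rule triangle_memI[of "1 - \<xi> z - \<eta> z" "\<xi> z" "\<eta> z"])
      show "z = (1 - \<xi> z - \<eta> z) *\<^sub>R l + \<xi> z *\<^sub>R (l + (w, w/2)) + \<eta> z *\<^sub>R (l + (w/2, w))"
        by (subst repr[of z]) (simp add: scaleR_add_right scaleR_diff_left)
    qed (use x01[OF z] s01[OF z] y[OF z] \<beta>0 in auto)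
    ultimately show ?thesis by blast
  next
    assume \<beta>1: "\<beta> = 1"
    have rr: "r = l + (w, w/2)" using lr(3) by (simp add: prod_eq_iff)
    have "l = r - (w, w/2)" using lr(3) by (simp add: prod_eq_iff)
    moreover have "p = r - (w/2, w)" using repr[of p] pc \<beta>1 rr by (simp add: prod_eq_iff)
    ultimately have "convex hull {r, r - (w, w/2), r - (w/2, w)} \<subseteq> K"
      using triangle_subset[OF K(2) lr(2,1) pq(1)] by simp
    moreover have "z \<in> convex hull {r, r - (w, w/2), r - (w/2, w)}" if z: "z \<in> K" for z
    proof (rule triangle_memI[of "\<xi> z + \<eta> z" "1 - \<xi> z" "- \<eta> z"])
      show "z = (\<xi> z + \<eta> z) *\<^sub>R r + (1 - \<xi> z) *\<^sub>R (r - (w, w/2)) + (- \<eta> z) *\<^sub>R (r - (w/2, w))"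
        by (subst repr[of z]) (simp add: rr prod_eq_iff field_simps)
    qed (use x01[OF z] s01[OF z] y[OF z] \<beta>1 in auto)
    ultimately show ?thesis by blast
  qed
qed

text \<open>Brings the normalised triangle of the statement into the form of one corner and two edge
  vectors that \<open>forced_chords_triangle\<close> produces.\<close>

lemma scaled_triangle_image:
  "(\<lambda>x. t + x) ` ((\<lambda>x. (w / 2) *\<^sub>R x) ` (convex hull {(1, 0), (0, 1), (-1, -1)})) =
   convex hull {t - (w/2, w/2), t - (w/2, w/2) + (w, w/2), t - (w/2, w/2) + (w/2, w)}"
proof -
  have "(\<lambda>x. t + x) ` ((\<lambda>x. (w / 2) *\<^sub>R x) ` (convex hull {(1, 0), (0, 1), (-1, -1)})) =
      convex hull ((\<lambda>x. t + x) ` (\<lambda>x. (w / 2) *\<^sub>R x) ` {(1, 0), (0, 1), (-1, -1)})"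
    by (simp only: convex_hull_scaling convex_hull_translation)
  also have "(\<lambda>x. t + x) ` (\<lambda>x. (w / 2) *\<^sub>R x) ` {(1, 0), (0, 1), (-1, -1)} =
      {t - (w/2, w/2), t - (w/2, w/2) + (w, w/2), t - (w/2, w/2) + (w/2, w)}"
    by (cases t) (auto simp: image_iff)
  finally show ?thesis .
qed

definition scaled_triangle :: "(real \<times> real) set \<Rightarrow> real \<Rightarrow> bool" where
  "scaled_triangle K w \<longleftrightarrow> (\<exists>T t. unimodular T \<and>
     T ` K = (\<lambda>x. t + x) ` ((\<lambda>x. (w / 2) *\<^sub>R x) ` (convex hull {(1, 0), (0, 1), (-1, -1)})))"

theorem area_lower_bound_eq:
  assumes K: "compact K" "convex K" "K \<noteq> {}" "wide K w" "thin K w" "0 < w"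
  shows "ar K = 3/8 * w\<^sup>2 \<longleftrightarrow> scaled_triangle K w"
proof
  assume A: "ar K = 3/8 * w\<^sup>2"
  obtain T l r a where T: "unimodular T" "\<And>x y. x \<in> T ` K \<Longrightarrow> y \<in> T ` K \<Longrightarrow> fst x - fst y \<le> w"
    "l \<in> T ` K" "r \<in> T ` K" "r - l = (w, a * w)" "0 \<le> a" "a < 1"
    using lower_bound_normal_position[OF K] by blast
  have A': "ar (T ` K) = 3/8 * w\<^sup>2" using A ar_unimodular[OF T(1) K(1)] by simp
  note TK = compact_unimodular[OF T(1) K(1)] convex_unimodular[OF T(1) K(2)]
  have F: "a = 1/2" "\<exists>b\<in>T ` K. \<exists>t\<in>T ` K. t - b = (w/2, w)" "\<exists>p\<in>T ` K. \<exists>q\<in>T ` K. p - q = (w/2, - (w/2))"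
    using area_le_forces_chords[OF TK wide_unimodular[OF T(1) K(4)] K(6) T(2-7)] A' by simp_all
  obtain b t where bt: "b \<in> T ` K" "t \<in> T ` K" "t - b = (w/2, w)" using F(2) by blast
  obtain p q where pq: "p \<in> T ` K" "q \<in> T ` K" "p - q = (w/2, - (w/2))" using F(3) by blast
  have rl: "r - l = (w, w/2)" using T(5) F(1) by simp
  consider "T ` K = convex hull {l, l + (w, w/2), l + (w/2, w)}" |
     "T ` K = convex hull {r, r - (w, w/2), r - (w/2, w)}"
    using forced_chords_triangle[OF TK K(6) A' T(3,4) rl bt pq] by blast
  then show "scaled_triangle K w"
  proof cases
    case 1
    then have "T ` K = (\<lambda>x. (l + (w/2, w/2)) + x) ` ((\<lambda>x. (w / 2) *\<^sub>R x) ` (convex hull {(1, 0), (0, 1), (-1, -1)}))"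
      unfolding scaled_triangle_image by simp
    with T(1) show ?thesis unfolding scaled_triangle_def by blast
  next
    case 2
    \<comment> \<open>The second triangle is a point reflection of the first, so -1 composed with T
      restores the normal form.\<close>
    define N where "N = umap (-1) 0 0 (-1) 0 0"
    have N: "unimodular N" unfolding N_def by (intro unimodular_umap) simp
    have Nm: "N = (\<lambda>z. (-1) *\<^sub>R z)" by (auto simp: N_def umap_def fun_eq_iff)
    have "(N \<circ> T) ` K = N ` (convex hull {r, r - (w, w/2), r - (w/2, w)})"
      using 2 by (simp only: image_comp[symmetric])
    also have "\<dots> = convex hull (N ` {r, r - (w, w/2), r - (w/2, w)})"
      unfolding Nm by (simp only: convex_hull_scaling)
    also have "N ` {r, r - (w, w/2), r - (w/2, w)} = {- r, - r + (w, w/2), - r + (w/2, w)}"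
      by (simp add: Nm)
    finally have "(N \<circ> T) ` K = (\<lambda>x. (- r + (w/2, w/2)) + x) ` ((\<lambda>x. (w / 2) *\<^sub>R x) ` (convex hull {(1, 0), (0, 1), (-1, -1)}))"
      unfolding scaled_triangle_image by simp
    with unimodular_comp[OF N T(1)] show ?thesis unfolding scaled_triangle_def by blast
  qed
next
  assume "scaled_triangle K w"
  then obtain T t where T: "unimodular T" "T ` K = (\<lambda>x. t + x) ` ((\<lambda>x. (w / 2) *\<^sub>R x) ` (convex hull {(1, 0), (0, 1), (-1, -1)}))"
    unfolding scaled_triangle_def by blast
  have "ar K = ar (T ` K)" using ar_unimodular[OF T(1) K(1)] by simp
  also have "\<dots> = 3/8 * w\<^sup>2"
    unfolding T(2) scaled_triangle_image ar_triangle by (simp add: cross2_def power2_eq_square)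
  finally show "ar K = 3/8 * w\<^sup>2" .
qed

section \<open>Lattice width at most 2\<close>

definition trap :: "real \<Rightarrow> real \<Rightarrow> real \<Rightarrow> real \<Rightarrow> real \<Rightarrow> real \<Rightarrow> (real \<times> real) set" where
  "trap a c n n0 m m0 = {z. a \<le> fst z \<and> fst z \<le> c \<and> n * fst z + n0 \<le> snd z \<and> snd z \<le> m * fst z + m0}"

text \<open>The diagonal from the lower left to the upper right corner splits the trapezoid. The
  inclusion suffices for compactness and for the upper area bound.\<close>

lemma trap_triangles:
  assumes ac: "a < c" and la: "n * a + n0 \<le> m * a + m0" and lc: "n * c + n0 \<le> m * c + m0"
  shows "trap a c n n0 m m0 \<subseteq>
     convex hull {(a, n * a + n0), (c, m * c + m0), (a, m * a + m0)} \<union>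
     convex hull {(a, n * a + n0), (c, m * c + m0), (c, n * c + n0)}"
proof
  fix z assume "z \<in> trap a c n n0 m m0"
  then obtain x y where z: "z = (x, y)" and x: "a \<le> x" "x \<le> c" and y: "n * x + n0 \<le> y" "y \<le> m * x + m0"
    by (cases z) (auto simp: trap_def)
  define \<theta> where "\<theta> = (x - a) / (c - a)"
  have \<theta>: "0 \<le> \<theta>" "\<theta> \<le> 1" using x ac by (auto simp: \<theta>_def)
  have "\<theta> * (c - a) = x - a" using ac by (simp add: \<theta>_def)
  then have xe: "x = (1 - \<theta>) * a + \<theta> * c" by (simp add: algebra_simps)
  define fa ga fc gc where "fa = n * a + n0" and "ga = m * a + m0" and "fc = n * c + n0" and "gc = m * c + m0"
  have f: "n * x + n0 = (1 - \<theta>) * fa + \<theta> * fc" and g: "m * x + m0 = (1 - \<theta>) * ga + \<theta> * gc"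
    by (simp_all add: xe fa_def fc_def ga_def gc_def algebra_simps)
  \<comment> \<open>The height of the diagonal over x; it decides which triangle contains z.\<close>
  define h where "h = (1 - \<theta>) * fa + \<theta> * gc"
  have le: "fa \<le> ga" "fc \<le> gc" using la lc by (simp_all add: fa_def fc_def ga_def gc_def)
  show "z \<in> convex hull {(a, n * a + n0), (c, m * c + m0), (a, m * a + m0)} \<union>
     convex hull {(a, n * a + n0), (c, m * c + m0), (c, n * c + n0)}"
  proof (cases "h \<le> y")
    case True
    \<comment> \<open>If the left side has length 0, then y = h, and the weight 0 replaces the
      meaningless quotient.\<close>
    define \<kappa> where "\<kappa> = (if fa = ga then 0 else (y - h) / (ga - fa))"
    have yh: "y - h \<le> (1 - \<theta>) * (ga - fa)" using y(2) g by (simp add: h_def algebra_simps)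
    have k: "\<kappa> * (ga - fa) = y - h" "0 \<le> \<kappa>"
      using True yh le by (auto simp: \<kappa>_def)
    have "\<kappa> \<le> 1 - \<theta>" using yh k \<theta> le by (cases "fa = ga") (auto simp: \<kappa>_def divide_le_eq)
    moreover have "y = (1 - \<theta> - \<kappa>) * fa + \<theta> * gc + \<kappa> * ga" using k(1) by (simp add: h_def algebra_simps)
    ultimately have "z \<in> convex hull {(a, fa), (c, gc), (a, ga)}"
      using \<theta> k(2) by (intro triangle_memI[of "1 - \<theta> - \<kappa>" \<theta> \<kappa>]) (auto simp: z xe algebra_simps)
    then show ?thesis by (simp add: fa_def ga_def gc_def)
  next
    case False
    define \<kappa> where "\<kappa> = (if fc = gc then 0 else (h - y) / (gc - fc))"
    have yh: "h - y \<le> \<theta> * (gc - fc)" using y(1) f by (simp add: h_def algebra_simps)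
    have k: "\<kappa> * (gc - fc) = h - y" "0 \<le> \<kappa>"
      using False yh le by (auto simp: \<kappa>_def)
    have "\<kappa> \<le> \<theta>" using yh k \<theta> le by (cases "fc = gc") (auto simp: \<kappa>_def divide_le_eq)
    moreover have "y = (1 - \<theta>) * fa + (\<theta> - \<kappa>) * gc + \<kappa> * fc" using k(1) by (simp add: h_def algebra_simps)
    ultimately have "z \<in> convex hull {(a, fa), (c, gc), (c, fc)}"
      using \<theta> k(2) by (intro triangle_memI[of "1 - \<theta>" "\<theta> - \<kappa>" \<kappa>]) (auto simp: z xe algebra_simps)
    then show ?thesis by (simp add: fa_def fc_def gc_def)
  qed
qed

lemma closed_trap: "closed (trap a c n n0 m m0)"
  unfolding trap_def by (intro closed_Collect_conj closed_Collect_le continuous_intros)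

lemma convex_trap: "convex (trap a c n n0 m m0)"
proof -
  have "trap a c n n0 m m0 = {z. (-1, 0) \<bullet> z \<le> - a} \<inter> {z. (1, 0) \<bullet> z \<le> c} \<inter>
      {z. (n, -1) \<bullet> z \<le> - n0} \<inter> {z. (- m, 1) \<bullet> z \<le> m0}"
    by (auto simp: trap_def inner_prod_def)
  then show ?thesis by (simp only:) (intro convex_Int convex_halfspace_le)
qed

lemma
  assumes ac: "a < c" and la: "n * a + n0 \<le> m * a + m0" and lc: "n * c + n0 \<le> m * c + m0"
  shows compact_trap: "compact (trap a c n n0 m m0)"
    and ar_trap_le: "ar (trap a c n n0 m m0) \<le> (c - a) * ((m * a + m0 - (n * a + n0)) + (m * c + m0 - (n * c + n0))) / 2"
proof -
  let ?T1 = "convex hull {(a, n * a + n0), (c, m * c + m0), (a, m * a + m0)}"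
  let ?T2 = "convex hull {(a, n * a + n0), (c, m * c + m0), (c, n * c + n0)}"
  have "bounded (?T1 \<union> ?T2)"
    by (intro compact_imp_bounded compact_Un compact_triangle)
  then show c: "compact (trap a c n n0 m m0)"
    using trap_triangles[OF assms] closed_trap bounded_subset compact_eq_bounded_closed by blast
  have "ar (trap a c n n0 m m0) \<le> ar (?T1 \<union> ?T2)"
    using c trap_triangles[OF assms] by (intro ar_mono compact_Un compact_triangle) auto
  also have "\<dots> \<le> ar ?T1 + ar ?T2" by (intro ar_Un_le compact_triangle)
  also have "ar ?T1 = (c - a) * (m * a + m0 - (n * a + n0)) / 2"
  proof -
    have "cross2 ((c, m * c + m0) - (a, n * a + n0)) ((a, m * a + m0) - (a, n * a + n0)) =
        (c - a) * (m * a + m0 - (n * a + n0))" by (simp add: cross2_def)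
    then show ?thesis using ac la by (simp add: ar_triangle abs_mult)
  qed
  also have "ar ?T2 = (c - a) * (m * c + m0 - (n * c + n0)) / 2"
  proof -
    have "cross2 ((c, m * c + m0) - (a, n * a + n0)) ((c, n * c + n0) - (a, n * a + n0)) =
        - ((c - a) * (m * c + m0 - (n * c + n0)))" by (simp add: cross2_def algebra_simps)
    then show ?thesis using ac lc by (simp add: ar_triangle abs_mult)
  qed
  finally show "ar (trap a c n n0 m m0) \<le> (c - a) * ((m * a + m0 - (n * a + n0)) + (m * c + m0 - (n * c + n0))) / 2"
    by (simp add: algebra_simps add_divide_distrib diff_divide_distrib)
qed

lemma interior_trap:
  assumes ac: "a < c" and l: "0 < (m * a + m0 - (n * a + n0)) + (m * c + m0 - (n * c + n0))"
  shows "interior (trap a c n n0 m m0) \<noteq> {}"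
proof -
  define U where "U = {z. a < fst z \<and> fst z < c \<and> n * fst z + n0 < snd z \<and> snd z < m * fst z + m0}"
  have "open U" unfolding U_def by (intro open_Collect_conj open_Collect_less continuous_intros)
  moreover have "U \<subseteq> trap a c n n0 m m0" by (auto simp: U_def trap_def)
  moreover have "((a + c) / 2, (n * ((a + c) / 2) + n0 + (m * ((a + c) / 2) + m0)) / 2) \<in> U"
    using assms by (simp add: U_def field_simps)
  ultimately show ?thesis using interior_maximal[of U] by blast
qed

section \<open>Hulls of two crossing segments\<close>

definition cross_hull :: "(real \<times> real) set \<Rightarrow> real \<Rightarrow> bool" where
  "cross_hull K w \<longleftrightarrow> (\<exists>T t1 t2. unimodular T \<and>
     (let I1 = (\<lambda>x. t1 + x) ` (convex hull {(0, 0), (w, 0)});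
          I2 = (\<lambda>x. t2 + x) ` (convex hull {(0, 0), (0, w / (w - 1))})
      in I1 \<inter> I2 \<noteq> {} \<and> T ` K = convex hull (I1 \<union> I2)))"

lemma cross_hull_image:
  assumes "unimodular T" "cross_hull (T ` K) w"
  shows "cross_hull K w"
proof -
  obtain S t1 t2 where S: "unimodular S" "(let I1 = (\<lambda>x. t1 + x) ` (convex hull {(0, 0), (w, 0)});
          I2 = (\<lambda>x. t2 + x) ` (convex hull {(0, 0), (0, w / (w - 1))})
      in I1 \<inter> I2 \<noteq> {} \<and> S ` (T ` K) = convex hull (I1 \<union> I2))"
    using assms(2) unfolding cross_hull_def by blast
  have "(S \<circ> T) ` K = S ` (T ` K)" by (simp only: image_comp)
  then show ?thesis
    unfolding cross_hull_def using S unimodular_comp[OF S(1) assms(1)] by metis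
qed

lemma translated_segment:
  "(\<lambda>x. t + x) ` (convex hull {0, d}) = convex hull {t, t + d :: real \<times> real}"
  by (simp add: convex_hull_translation[symmetric])

text \<open>The segments meet at (fst b, snd l). By the two-chord estimate their hull already has
  area w^2 / (2 (w - 1)), which is all that K may have, so nothing of K lies outside it.\<close>

lemma cross_hullI:
  assumes K: "compact K" "convex K" "interior K \<noteq> {}" and w: "1 < w"
    and mem: "l \<in> K" "r \<in> K" "b \<in> K" "u \<in> K"
    and d: "r - l = (w, 0)" "u - b = (0, w / (w - 1))"
    and x: "fst l \<le> fst b" "fst b \<le> fst r" "snd b \<le> snd l" "snd l \<le> snd u"
    and A: "ar K \<le> w\<^sup>2 / (2 * (w - 1))"
  shows "cross_hull K w"
proof -
  define I1 where "I1 = (\<lambda>x. l + x) ` (convex hull {(0, 0), (w, 0)})"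
  define I2 where "I2 = (\<lambda>x. b + x) ` (convex hull {(0, 0), (0, w / (w - 1))})"
  have r: "r = l + (w, 0)" and u: "u = b + (0, w / (w - 1))" using d by (simp_all add: prod_eq_iff)
  have I1: "I1 = convex hull {l, r}" and I2: "I2 = convex hull {b, u}"
    unfolding I1_def I2_def r u using translated_segment[of l "(w, 0)"] translated_segment[of b "(0, w / (w - 1))"]
    by (simp_all add: zero_prod_def)
  have sub: "I1 \<subseteq> K" "I2 \<subseteq> K"
    unfolding I1 I2 using mem K(2) by (simp_all add: hull_minimal)
  have "(fst b, snd l) \<in> I1"
  proof -
    define s where "s = (fst b - fst l) / w"
    have s: "0 \<le> s" "s \<le> 1" "s * w = fst b - fst l" using x r w by (auto simp: s_def)
    have "(fst b, snd l) = (1 - s) *\<^sub>R l + s *\<^sub>R r"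
      using s(3) unfolding r by (simp add: prod_eq_iff algebra_simps)
    then show ?thesis unfolding I1 convex_hull_2_alt using s by (auto simp: algebra_simps)
  qed
  moreover have "(fst b, snd l) \<in> I2"
  proof -
    define h where "h = w / (w - 1)"
    have h: "h > 0" using w by (simp add: h_def)
    define s where "s = (snd l - snd b) / h"
    have uu: "u = b + (0, h)" using u by (simp add: h_def)
    have s: "0 \<le> s" "s \<le> 1" "s * h = snd l - snd b" using x uu h by (auto simp: s_def)
    have "(fst b, snd l) = (1 - s) *\<^sub>R b + s *\<^sub>R u"
      using s(3) unfolding uu by (simp add: prod_eq_iff algebra_simps)
    then show ?thesis unfolding I2 convex_hull_2_alt using s by (auto simp: algebra_simps)
  qed
  ultimately have ne: "I1 \<inter> I2 \<noteq> {}" by blast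
  define H where "H = convex hull (I1 \<union> I2)"
  have HK: "H \<subseteq> K" unfolding H_def using sub K(2) by (intro hull_minimal) auto
  have cH: "compact H" "convex H"
    unfolding H_def I1 I2 by (intro compact_convex_hull compact_Un finite_imp_compact convex_convex_hull; simp)+
  have memH: "l \<in> H" "r \<in> H" "b \<in> H" "u \<in> H"
    unfolding H_def I1 I2 by (auto intro!: hull_inc[of _ "_ \<union> _"] intro: hull_inc)
  have "\<bar>cross2 (r - l) (u - b)\<bar> / 2 \<le> ar H" by (rule two_chords[OF cH memH])
  moreover have "cross2 (r - l) (u - b) = w\<^sup>2 / (w - 1)"
    unfolding d by (simp add: cross2_def power2_eq_square)
  then have "\<bar>cross2 (r - l) (u - b)\<bar> / 2 = w\<^sup>2 / (2 * (w - 1))" using w by simp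
  ultimately have "ar K \<le> ar H" using A by linarith
  then have "K \<subseteq> H"
    using convex_ar_eq_imp_subset[OF K cH(1)] HK by (simp add: inf_absorb1)
  then have "K = H" using HK by blast
  then show ?thesis
    unfolding cross_hull_def
    by (intro exI[of _ "\<lambda>z. z"] exI[of _ l] exI[of _ b])
       (use ne in \<open>simp add: unimodular_id I1_def I2_def H_def Let_def\<close>)
qed

section \<open>Lattice columns and area bounds up to width 2\<close>

text \<open>Neither (i, j) nor (i, j + 1) is interior, so each lies on a line with K on one side.
  These lines are not vertical, because K has points on both sides of x = i; their slopes are n and
  m.\<close>

lemma column_lines:
  fixes i j :: int
  assumes K: "convex K" "interior K \<inter> Z2 = {}" and y: "(of_int i, y) \<in> interior K" "of_int j < y" "y < of_int j + 1"
  obtains n m where "\<And>z. z \<in> K \<Longrightarrow> n * (fst z - of_int i) + of_int j \<le> snd z"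
    "\<And>z. z \<in> K \<Longrightarrow> snd z \<le> m * (fst z - of_int i) + of_int j + 1"
proof -
  have ne: "interior K \<noteq> {}" using y(1) by blast
  obtain e where e: "e > 0" "ball (of_int i, y) e \<subseteq> K" using y(1) by (meson mem_interior)
  have near: "(of_int i + e / 2, y) \<in> K" "(of_int i - e / 2, y) \<in> K" "(of_int i, y) \<in> K"
    using e by (auto intro!: subsetD[OF e(2)] simp: dist_prod_def dist_real_def)
  \<comment> \<open>The sign g treats both lattice points at once: 1 for the line below (i, y), -1
    for the line above.\<close>
  have slope: "\<exists>s. \<forall>z\<in>K. 0 \<le> g * (snd z - Y - s * (fst z - of_int i))"
    if z: "(of_int i, Y) \<notin> interior K" and g: "g * (y - Y) > 0" "g = 1 \<or> g = -1" for Y g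
  proof -
    obtain a where a: "a \<noteq> 0" "\<And>x. x \<in> K \<Longrightarrow> 0 \<le> a \<bullet> (x - (of_int i, Y))"
      using separating_point_interior[OF K(1) ne z] by blast
    obtain \<alpha> \<beta> where ab: "a = (\<alpha>, \<beta>)" by (cases a)
    have h: "0 \<le> \<alpha> * (fst x - of_int i) + \<beta> * (snd x - Y)" if "x \<in> K" for x
      using a(2)[OF that] by (simp add: ab inner_prod_def)
    have "\<beta> \<noteq> 0"
    proof
      assume "\<beta> = 0"
      then have "0 \<le> \<alpha> * (e / 2)" "0 \<le> \<alpha> * (- e / 2)" using h[OF near(1)] h[OF near(2)] by simp_all
      then have "\<alpha> = 0" using e(1) by (simp add: zero_le_mult_iff mult_le_0_iff)
      then show False using a(1) ab \<open>\<beta> = 0\<close> by (simp add: zero_prod_def)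
    qed
    moreover have "0 \<le> \<beta> * (y - Y)" using h[OF near(3)] by simp
    ultimately have \<beta>: "g * \<beta> > 0" using g by (auto simp: zero_le_mult_iff mult_less_0_iff)
    have "0 \<le> g * (snd x - Y - (- \<alpha> / \<beta>) * (fst x - of_int i))" if "x \<in> K" for x
    proof -
      have "g * (snd x - Y - (- \<alpha> / \<beta>) * (fst x - of_int i)) =
          (\<alpha> * (fst x - of_int i) + \<beta> * (snd x - Y)) * (g / \<beta>)"
        using \<open>\<beta> \<noteq> 0\<close> by (simp add: field_simps)
      moreover have "g / \<beta> \<ge> 0" using \<beta> g(2) by (auto simp: zero_le_divide_iff)
      ultimately show ?thesis using mult_nonneg_nonneg[OF h[OF that], of "g / \<beta>"] by (simp only:)
    qed
    then show ?thesis by blast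
  qed
  have nz: "(of_int i, of_int j) \<notin> interior K" "(of_int i, of_int j + 1) \<notin> interior K"
  proof -
    have "(of_int i, of_int j) \<in> Z2" "(of_int i, of_int j + 1) \<in> Z2" by simp_all
    then show "(of_int i, of_int j) \<notin> interior K" "(of_int i, of_int j + 1) \<notin> interior K" using K(2) by blast+
  qed
  obtain n where n: "\<forall>z\<in>K. 0 \<le> 1 * (snd z - of_int j - n * (fst z - of_int i))"
    using slope[OF nz(1), of 1] y by auto
  obtain m where m: "\<forall>z\<in>K. 0 \<le> -1 * (snd z - (of_int j + 1) - m * (fst z - of_int i))"
    using slope[OF nz(2), of "-1"] y by auto
  show thesis by (rule that[of n m]) (use n m in \<open>auto simp: algebra_simps\<close>)
qed

text \<open>The strip between the columns is divided at x = s in the ratio t : t', and each part of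
  K is compared with the trapezoid of its own column. Shrinking the outer ends to points maximises
  the trapezoid areas, and these maxima sum to the bound.\<close>

lemma two_column_bound:
  assumes K: "compact K" "convex K" "interior K \<noteq> {}" "wide K w"
    and t: "0 < t" "0 < t'" "t + t' = w - 1" "w \<le> 2"
    and range: "\<And>z. z \<in> K \<Longrightarrow> - t \<le> fst z" "\<And>z. z \<in> K \<Longrightarrow> fst z \<le> 1 + t'"
    and ends: "l \<in> K" "fst l = - t" "r \<in> K" "fst r = 1 + t'"
    and cols: "(0, y0) \<in> K" "0 < y0" "y0 < 1" "(1, y1) \<in> K" "0 < y1" "y1 < 1"
    and lines: "\<And>z. z \<in> K \<Longrightarrow> n1 * fst z \<le> snd z" "\<And>z. z \<in> K \<Longrightarrow> snd z \<le> m1 * fst z + 1"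
      "\<And>z. z \<in> K \<Longrightarrow> n2 * (fst z - 1) \<le> snd z" "\<And>z. z \<in> K \<Longrightarrow> snd z \<le> m2 * (fst z - 1) + 1"
  shows "ar K \<le> w\<^sup>2 / (2 * (w - 1)) \<and> (ar K = w\<^sup>2 / (2 * (w - 1)) \<longrightarrow> cross_hull K w)"
proof -
  \<comment> \<open>k + 1 equals w / (w - 1), the length of the vertical segment in the extremal
    bodies, and w \<le> 2 becomes k \<ge> 1.\<close>
  define k where "k = 1 / (w - 1)"
  have w1: "1 < w" using t by linarith
  have k1: "1 \<le> k" using t w1 by (simp add: k_def field_simps)
  have kt: "k * t + k * t' = 1"
  proof -
    have "k * (t + t') = 1" unfolding t(3) k_def using w1 by simp
    then show ?thesis by (simp add: distrib_left)
  qed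
  have val: "w\<^sup>2 / (2 * (w - 1)) = t * (k + 1)\<^sup>2 / 2 + t' * (k + 1)\<^sup>2 / 2"
  proof -
    have kw: "(k + 1) * (w - 1) = w" using w1 by (simp add: k_def field_simps)
    have "t * (k + 1)\<^sup>2 / 2 + t' * (k + 1)\<^sup>2 / 2 = (t + t') * (k + 1)\<^sup>2 / 2" by (simp add: algebra_simps add_divide_distrib)
    also have "\<dots> = ((k + 1) * (w - 1))\<^sup>2 / (2 * (w - 1))"
    proof -
      have e: "v * (k + 1)\<^sup>2 / 2 = ((k + 1) * v)\<^sup>2 / (2 * v)" if "0 < v" for v
        using that by (simp add: power2_eq_square)
      have "0 < w - 1" using w1 by simp
      from e[OF this] show ?thesis unfolding t(3) .
    qed
    finally show ?thesis by (simp add: kw)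
  qed
  define s where "s = k * t"
  have s': "1 - s = k * t'" using kt by (simp add: s_def)
  have s01: "0 < s" "s < 1" using t k1 s' by (auto simp: s_def) (smt (verit) mult_pos_pos)
  \<comment> \<open>The left trapezoid has vertical length \<open>1 - \<kappa>1\<close> at x = - t
    and \<open>1 + \<kappa>1 * k\<close> at x = s, symmetrically on the right. The points of K over
    the ends force both parameters to be at most 1.\<close>
  define \<kappa>1 \<kappa>2 where "\<kappa>1 = (m1 - n1) * t" and "\<kappa>2 = (n2 - m2) * t'"
  have \<kappa>: "\<kappa>1 \<le> 1" "\<kappa>2 \<le> 1"
    using lines(1,2)[OF ends(1)] lines(3,4)[OF ends(3)] ends by (simp_all add: \<kappa>1_def \<kappa>2_def algebra_simps)
  \<comment> \<open>Each pair of lines must also leave room for the point of K on the other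
    column.\<close>
  have ge: "- 1 \<le> m1 - n1" "- 1 \<le> n2 - m2"
    using lines(1,2)[OF cols(4)] lines(3,4)[OF cols(1)] by simp_all
  have p1: "0 < 1 + (m1 - n1) * s" "0 < 1 + (n2 - m2) * (1 - s)"
  proof -
    have "0 < 1 + d * x" if "- 1 \<le> d" "0 < x" "x < 1" for d x :: real
      using mult_right_mono[OF that(1), of x] that by linarith
    then show "0 < 1 + (m1 - n1) * s" "0 < 1 + (n2 - m2) * (1 - s)" using s01 ge by simp_all
  qed
  define R1 where "R1 = trap (- t) s n1 0 m1 1"
  define R2 where "R2 = trap s (1 + t') n2 (- n2) m2 (1 - m2)"
  have len1: "n1 * - t + 0 \<le> m1 * - t + 1" "n1 * s + 0 \<le> m1 * s + 1"
    using \<kappa>(1) p1 by (simp_all add: \<kappa>1_def algebra_simps)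
  have len2: "n2 * s + - n2 \<le> m2 * s + (1 - m2)" "n2 * (1 + t') + - n2 \<le> m2 * (1 + t') + (1 - m2)"
    using \<kappa>(2) p1 by (simp_all add: \<kappa>2_def algebra_simps)
  have st: "- t < s" "s < 1 + t'" using s01 t by linarith+
  note c1 = compact_trap[OF st(1) len1, folded R1_def] and c2 = compact_trap[OF st(2) len2, folded R2_def]
  have V1: "ar R1 \<le> t * (k + 1) * (2 + \<kappa>1 * (k - 1)) / 2"
  proof -
    have "(s - - t) * ((m1 * - t + 1 - (n1 * - t + 0)) + (m1 * s + 1 - (n1 * s + 0))) / 2
        = t * (k + 1) * (2 + \<kappa>1 * (k - 1)) / 2"
      by (simp add: s_def \<kappa>1_def algebra_simps)
    then show ?thesis using ar_trap_le[OF st(1) len1] by (simp add: R1_def)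
  qed
  have V2: "ar R2 \<le> t' * (k + 1) * (2 + \<kappa>2 * (k - 1)) / 2"
  proof -
    have se: "s = 1 - k * t'" using s' by simp
    have "(1 + t' - s) * ((m2 * s + (1 - m2) - (n2 * s + - n2)) + (m2 * (1 + t') + (1 - m2) - (n2 * (1 + t') + - n2))) / 2
        = t' * (k + 1) * (2 + \<kappa>2 * (k - 1)) / 2"
      by (simp add: se \<kappa>2_def algebra_simps)
    then show ?thesis using ar_trap_le[OF st(2) len2] by (simp add: R2_def)
  qed
  have U1: "t * (k + 1) * (2 + \<kappa>1 * (k - 1)) / 2 \<le> t * (k + 1)\<^sup>2 / 2"
  proof -
    have "\<kappa>1 * (k - 1) \<le> 1 * (k - 1)" using \<kappa> k1 by (intro mult_right_mono) auto
    then have "t * (k + 1) * (2 + \<kappa>1 * (k - 1)) \<le> t * (k + 1) * (k + 1)"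
      using t k1 by (intro mult_left_mono) auto
    then show ?thesis unfolding power2_eq_square mult.assoc by (rule divide_right_mono) simp
  qed
  have U2: "t' * (k + 1) * (2 + \<kappa>2 * (k - 1)) / 2 \<le> t' * (k + 1)\<^sup>2 / 2"
  proof -
    have "\<kappa>2 * (k - 1) \<le> 1 * (k - 1)" using \<kappa> k1 by (intro mult_right_mono) auto
    then have "t' * (k + 1) * (2 + \<kappa>2 * (k - 1)) \<le> t' * (k + 1) * (k + 1)"
      using t k1 by (intro mult_left_mono) auto
    then show ?thesis unfolding power2_eq_square mult.assoc by (rule divide_right_mono) simp
  qed
  have KR: "z \<in> (if fst z \<le> s then R1 else R2)" if "z \<in> K" for z
    using range[OF that] lines[OF that] by (auto simp: R1_def R2_def trap_def algebra_simps)
  have "ar K = ar ((K \<inter> R1) \<union> (K \<inter> R2))"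
  proof -
    have "K \<subseteq> R1 \<union> R2" using KR by (metis UnCI subsetI)
    then have "K = (K \<inter> R1) \<union> (K \<inter> R2)" by blast
    then show ?thesis by simp
  qed
  also have "\<dots> \<le> ar (K \<inter> R1) + ar (K \<inter> R2)"
    using K(1) c1 c2 by (intro ar_Un_le compact_Int)
  finally have split: "ar K \<le> ar (K \<inter> R1) + ar (K \<inter> R2)" .
  have part: "ar (K \<inter> R1) \<le> ar R1" "ar (K \<inter> R2) \<le> ar R2"
    using K(1) c1 c2 by (intro ar_mono compact_Int; simp)+
  have bound: "ar K \<le> w\<^sup>2 / (2 * (w - 1))" using split part V1 V2 U1 U2 val by linarith
  have "cross_hull K w" if eq: "ar K = w\<^sup>2 / (2 * (w - 1))"
  proof -
    have eqs: "ar R1 \<le> ar (K \<inter> R1)" "ar R2 \<le> ar (K \<inter> R2)"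
      "t * (k + 1) * (2 + \<kappa>1 * (k - 1)) / 2 = t * (k + 1)\<^sup>2 / 2"
      using split part V1 V2 U1 U2 val eq by linarith+
    have i1: "interior R1 \<noteq> {}" unfolding R1_def using len1 p1 st by (intro interior_trap) (simp_all add: algebra_simps)
    have i2: "interior R2 \<noteq> {}" unfolding R2_def using len2 p1 st by (intro interior_trap) (simp_all add: algebra_simps)
    have sub: "R1 \<subseteq> K" "R2 \<subseteq> K"
      using convex_ar_eq_imp_subset[OF c1 _ i1 K(1) eqs(1)] convex_ar_eq_imp_subset[OF c2 _ i2 K(1) eqs(2)]
        convex_trap by (auto simp: R1_def R2_def)
    \<comment> \<open>Both trapezoids lie in K, so each satisfies the lines of the other; hence
      their sides on x = s coincide.\<close>
    have top: "m1 * s + 1 = m2 * (s - 1) + 1" and bot: "n1 * s = n2 * (s - 1)"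
    proof -
      have "(s, n1 * s) \<in> R1" "(s, m1 * s + 1) \<in> R1" using len1 st by (auto simp: R1_def trap_def)
      moreover have "(s, n2 * (s - 1)) \<in> R2" "(s, m2 * (s - 1) + 1) \<in> R2"
        using len2 st by (auto simp: R2_def trap_def algebra_simps)
      ultimately have "(s, n1 * s) \<in> K" "(s, m1 * s + 1) \<in> K" "(s, n2 * (s - 1)) \<in> K" "(s, m2 * (s - 1) + 1) \<in> K"
        using sub by blast+
      from lines(3)[OF this(1)] lines(4)[OF this(2)] lines(1)[OF this(3)] lines(2)[OF this(4)]
      show "m1 * s + 1 = m2 * (s - 1) + 1" "n1 * s = n2 * (s - 1)" by simp_all
    qed
    have sm: "s - 1 = - (k * t')" using s' by simp
    \<comment> \<open>It follows that the left and right ends of K lie at the same heights, so that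
      horizontal chords join them.\<close>
    have mt: "m1 * t = - (m2 * t')" and nt: "n1 * t = - (n2 * t')"
    proof -
      have "k * (m1 * t + m2 * t') = 0" "k * (n1 * t + n2 * t') = 0"
        using top bot unfolding sm by (simp_all add: s_def algebra_simps)
      then have "m1 * t + m2 * t' = 0" "n1 * t + n2 * t' = 0" using k1 by simp_all
      then show "m1 * t = - (m2 * t')" "n1 * t = - (n2 * t')" by linarith+
    qed
    have L: "(- t, 1 - m1 * t) \<in> K" "(- t, - (n1 * t)) \<in> K"
      using len1 st by (auto intro!: subsetD[OF sub(1)] simp: R1_def trap_def)
    have R: "(1 + t', 1 - m1 * t) \<in> K" "(1 + t', - (n1 * t)) \<in> K"
      using len2 st mt nt by (auto intro!: subsetD[OF sub(2)] simp: R2_def trap_def algebra_simps)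
    define \<theta> where "\<theta> = (s + t) / w"
    have \<theta>: "0 \<le> \<theta>" "\<theta> \<le> 1" "\<theta> * w = s + t" using st t w1 by (auto simp: \<theta>_def)
    have mid: "(s, Y) \<in> K" if "(- t, Y) \<in> K" "(1 + t', Y) \<in> K" for Y
    proof -
      have "(1 - \<theta>) *\<^sub>R (- t, Y) + \<theta> *\<^sub>R (1 + t', Y) \<in> K" using that \<theta> by (intro convexD[OF K(2)]) auto
      also have "(1 - \<theta>) *\<^sub>R (- t, Y) + \<theta> *\<^sub>R (1 + t', Y) = (\<theta> * (1 + t + t') - t, Y)" by (simp add: algebra_simps)
      also have "1 + t + t' = w" using t by simp
      finally show ?thesis using \<theta>(3) by simp
    qed
    have m1: "0 \<le> m1"
    proof -
      have "0 \<le> m1 * (s + t)" using lines(2)[OF mid[OF L(1) R(1)]] by (simp add: algebra_simps)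
      then show ?thesis using st by (simp add: zero_le_mult_iff)
    qed
    have n1: "n1 \<le> 0"
    proof -
      have "n1 * (s + t) \<le> 0" using lines(1)[OF mid[OF L(2) R(2)]] by (simp add: algebra_simps)
      then show ?thesis using st by (simp add: mult_le_0_iff)
    qed
    have m2: "m2 \<le> 0" and n2: "0 \<le> n2"
    proof -
      have "0 \<le> - (m2 * t')" using mt m1 t by (metis less_imp_le mult_nonneg_nonneg)
      then show "m2 \<le> 0" using t by (simp add: mult_le_0_iff)
      have "n1 * t \<le> 0" using n1 t by (simp add: mult_nonpos_nonneg)
      then have "0 \<le> n2 * t'" using nt by linarith
      then show "0 \<le> n2" using t by (simp add: zero_le_mult_iff)
    qed
    \<comment> \<open>For w < 2 the equality of areas forces this. For w = 2 the area bound does not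
      depend on \<open>\<kappa>1\<close>; there the width in direction (0, 1) decides, as the
      vertical extent of K is at most \<open>1 + \<kappa>1\<close>.\<close>
    have \<kappa>1: "\<kappa>1 = 1"
    proof (cases "k = 1")
      case False
      have "2 + \<kappa>1 * (k - 1) = k + 1" using eqs(3) t k1 by (simp add: power2_eq_square)
      then have "(\<kappa>1 - 1) * (k - 1) = 0" by (simp add: algebra_simps)
      then show ?thesis using False by simp
    next
      case True
      have w2: "w = 2" using True w1 by (simp add: k_def field_simps)
      have up: "snd z \<le> 1 + m1 * s" and dn: "n1 * s \<le> snd z" if z: "z \<in> K" for z
      proof -
        show "snd z \<le> 1 + m1 * s"
        proof (cases "fst z \<le> s")
          case True
          then show ?thesis using lines(2)[OF z] mult_left_mono[OF True m1] by linarith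
        next
          case False
          then have "m2 * (fst z - 1) \<le> m2 * (s - 1)" using m2 by (intro mult_left_mono_neg) auto
          then show ?thesis using lines(4)[OF z] top by linarith
        qed
        show "n1 * s \<le> snd z"
        proof (cases "fst z \<le> s")
          case True
          then show ?thesis using lines(1)[OF z] mult_left_mono_neg[OF True n1] by linarith
        next
          case False
          then have "n2 * (s - 1) \<le> n2 * (fst z - 1)" using n2 by (intro mult_left_mono) auto
          then show ?thesis using lines(3)[OF z] bot by linarith
        qed
      qed
      obtain x y where "x \<in> K" "y \<in> K" "w \<le> of_int 0 * (fst x - fst y) + of_int 1 * (snd x - snd y)"
        by (rule wideD[OF K(4), of 0 1]) auto
      then have "2 \<le> 1 + m1 * s - n1 * s" using up[of x] dn[of y] w2 by simp
      then have "1 \<le> \<kappa>1" using True by (simp add: \<kappa>1_def s_def algebra_simps)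
      then show ?thesis using \<kappa> by simp
    qed
    have B: "(s, n1 * s) \<in> K" and U: "(s, m1 * s + 1) \<in> K"
      using len1 st by (auto intro!: subsetD[OF sub(1)] simp: R1_def trap_def)
    show ?thesis
    proof (rule cross_hullI[OF K(1-3) w1 L(2) R(2) B U])
      show "(1 + t', - (n1 * t)) - (- t, - (n1 * t)) = (w, 0)" using t(3) by simp
      have "m1 * s + 1 - n1 * s = 1 + \<kappa>1 * k" by (simp add: \<kappa>1_def s_def algebra_simps)
      also have "\<dots> = w / (w - 1)" using w1 by (simp add: \<kappa>1 k_def field_simps)
      finally show "(s, m1 * s + 1) - (s, n1 * s) = (0, w / (w - 1))" by simp
      show "fst (- t, - (n1 * t)) \<le> fst (s, n1 * s)" "fst (s, n1 * s) \<le> fst (1 + t', - (n1 * t))" using st by simp_all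
      have "n1 * s \<le> 0" "n1 * t \<le> 0" "0 \<le> m1 * s" "0 \<le> m1 * t" using n1 m1 s01 t by (simp_all add: mult_nonpos_nonneg)
      then show "snd (s, n1 * s) \<le> snd (- t, - (n1 * t))" "snd (- t, - (n1 * t)) \<le> snd (s, m1 * s + 1)"
        using \<kappa>1 by (simp_all add: \<kappa>1_def algebra_simps)
    qed (use eq in simp)
  qed
  then show ?thesis using bound by blast
qed

text \<open>The enclosing trapezoid has area at most w - \<sigma> w (p - q) / 2 with \<sigma> = m -
  n. Nonemptiness at the short end bounds - \<sigma> by 1 / q, and q \<ge> w - 1 because p \<le> 1.
  Having n in [0,1) positions the chords in the equality cases.\<close>

lemma one_column_bound_aux:
  assumes K: "compact K" "convex K" "interior K \<noteq> {}" "wide K w"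
    and t: "0 < q" "q \<le> p" "p \<le> 1" "p + q = w" "1 < w"
    and range: "\<And>z. z \<in> K \<Longrightarrow> - p \<le> fst z" "\<And>z. z \<in> K \<Longrightarrow> fst z \<le> q"
    and ends: "l \<in> K" "fst l = - p" "r \<in> K" "fst r = q"
    and lines: "\<And>z. z \<in> K \<Longrightarrow> n * fst z \<le> snd z" "\<And>z. z \<in> K \<Longrightarrow> snd z \<le> m * fst z + 1"
    and n: "0 \<le> n" "n < 1"
  shows "ar K \<le> w\<^sup>2 / (2 * (w - 1)) \<and> (ar K = w\<^sup>2 / (2 * (w - 1)) \<longrightarrow> cross_hull K w)"
proof -
  define \<sigma> where "\<sigma> = m - n"
  have \<sigma>: "\<sigma> * p \<le> 1" "- 1 \<le> \<sigma> * q"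
    using lines[OF ends(1)] lines[OF ends(3)] ends by (simp_all add: \<sigma>_def algebra_simps)
  define R where "R = trap (- p) q n 0 m 1"
  have len: "n * - p + 0 \<le> m * - p + 1" "n * q + 0 \<le> m * q + 1"
    using \<sigma> by (simp_all add: \<sigma>_def algebra_simps)
  have pq: "- p < q" using t by linarith
  note cR = compact_trap[OF pq len, folded R_def]
  have V: "ar R \<le> w + (- \<sigma>) * (w * (p - q)) / 2"
  proof -
    have "(q - - p) * ((m * - p + 1 - (n * - p + 0)) + (m * q + 1 - (n * q + 0))) / 2 = (p + q) + (- \<sigma>) * ((p + q) * (p - q)) / 2"
      by (simp add: \<sigma>_def field_simps)
    then show ?thesis using ar_trap_le[OF pq len] t(4) by (simp add: R_def)
  qed
  have \<sigma>q: "- \<sigma> \<le> 1 / q" using \<sigma>(2) t(1) by (simp add: field_simps)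
  have U: "w + (- \<sigma>) * (w * (p - q)) / 2 \<le> w + (1 / q) * (w * (p - q)) / 2"
  proof -
    have "0 \<le> w * (p - q)" using t by simp
    from mult_right_mono[OF \<sigma>q this] show ?thesis by (intro add_left_mono divide_right_mono) auto
  qed
  have Uval: "w + (1 / q) * (w * (p - q)) / 2 = w\<^sup>2 / (2 * q)"
    using t(1) by (simp add: t(4)[symmetric] power2_eq_square field_simps)
  have qw: "w - 1 \<le> q" using t by linarith
  have U2: "w\<^sup>2 / (2 * q) \<le> w\<^sup>2 / (2 * (w - 1))"
    using qw t by (intro divide_left_mono mult_pos_pos) auto
  have KR: "K \<subseteq> R" using range lines by (auto simp: R_def trap_def)
  have KRa: "ar K \<le> ar R" using ar_mono[OF K(1) cR KR] .
  have bound: "ar K \<le> w\<^sup>2 / (2 * (w - 1))" using KRa V U Uval U2 by linarith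
  have "cross_hull K w" if eq: "ar K = w\<^sup>2 / (2 * (w - 1))"
  proof -
    define Y Z where "Y = (- \<sigma>) * (w * (p - q))" and "Z = (1 / q) * (w * (p - q))"
    have YZ: "ar R \<le> w + Y / 2" "w + Y / 2 \<le> w + Z / 2" "w + Z / 2 = w\<^sup>2 / (2 * q)"
      using V U Uval unfolding Y_def Z_def .
    have e0: "ar R \<le> ar K" "w\<^sup>2 / (2 * q) = w\<^sup>2 / (2 * (w - 1))" "Y = Z"
      using KRa YZ U2 eq by linarith+
    note e = e0[unfolded Y_def Z_def]
    have q: "q = w - 1" and p: "p = 1" using e(2) t by (auto simp: field_simps)
    have V0: "0 < (m * - p + 1 - (n * - p + 0)) + (m * q + 1 - (n * q + 0))"
    proof -
      have "0 < ar K" using eq t by simp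
      moreover have "w + (- \<sigma>) * (w * (p - q)) / 2 = w * (2 + (- \<sigma>) * (p - q)) / 2"
        by (simp add: field_simps)
      ultimately have "0 < w * (2 + (- \<sigma>) * (p - q)) / 2" using KRa V by linarith
      then have "0 < w * (2 + (- \<sigma>) * (p - q))" by simp
      then have "0 < 2 + (- \<sigma>) * (p - q)" using t by (simp add: zero_less_mult_iff)
      then show ?thesis by (simp add: \<sigma>_def algebra_simps)
    qed
    have "R \<subseteq> K"
      using convex_ar_eq_imp_subset[OF cR _ _ K(1)] e(1) KR convex_trap interior_trap[OF pq V0]
      by (simp add: R_def inf_absorb1)
    then have RK: "z \<in> K" if "- p \<le> fst z" "fst z \<le> q" "n * fst z \<le> snd z" "snd z \<le> m * fst z + 1" for z
      using that by (auto simp: R_def trap_def)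
    have "(\<sigma> + 1 / q) * (p - q) = 0"
    proof -
      have "w * ((\<sigma> + x) * (p - q)) = x * (w * (p - q)) - (- \<sigma>) * (w * (p - q))" for x
        by (simp add: algebra_simps)
      then have "w * ((\<sigma> + 1 / q) * (p - q)) = 0" using e(3) by simp
      then show ?thesis using t by simp
    qed
    then have "\<sigma> + 1 / q = 0 \<or> q = 1" using p by simp
    moreover have "\<sigma> * q = - 1" if "\<sigma> + 1 / q = 0"
    proof -
      have "(\<sigma> + 1 / q) * q = \<sigma> * q + 1" using t(1) by (simp add: distrib_right)
      then show ?thesis using that by simp
    qed
    \<comment> \<open>Either the right end is a point, or w = 2. In the latter case the area leaves
      \<sigma> free: \<sigma> = 1 makes the left end a point, and values between -1 and 1 need
      further width conditions.\<close>
    ultimately consider "\<sigma> * q = - 1" | "q = 1" "\<sigma> \<noteq> - 1" "\<sigma> \<noteq> 1" | "q = 1" "\<sigma> = 1"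
      by (cases "\<sigma> = - 1") auto
    then show ?thesis
    proof cases
      case 1
      then have mq: "m * q + 1 = n * q" by (simp add: \<sigma>_def algebra_simps)
      have "1 \<le> 1 / q" using t by simp
      have m: "m = n - 1 / q" using mq t(1) by (simp add: field_simps)
      have nq: "n * q \<le> 1" "0 \<le> n * q" using n t p mult_mono[of n 1 q 1] by auto
      have f: "- n \<le> n * q" "n * q \<le> 1 - m" "- n \<le> 1 - m"
        using nq n m \<open>1 \<le> 1 / q\<close> by linarith+
      show ?thesis
      proof (rule cross_hullI[OF K(1-3) t(5)])
        show "(-1, n * q) \<in> K" "(q, n * q) \<in> K" "(-1, - n) \<in> K" "(-1, 1 - m) \<in> K"
          using p t(1) mq f by (intro RK; simp)+
        show "(q, n * q) - (- 1, n * q) = (w, 0)" using t p by simp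
        show "(- 1 :: real, 1 - m) - (- 1, - n) = (0, w / (w - 1))"
        proof -
          have "1 - m - (- n) = 1 + 1 / q" by (simp add: m)
          also have "\<dots> = w / (w - 1)" using t(5) by (simp add: q field_simps)
          finally show ?thesis by simp
        qed
        show "snd (- 1 :: real, n * q) \<le> snd (- 1 :: real, 1 - m)" using nq \<open>1 \<le> 1 / q\<close> n m by simp
      qed (use t nq n f eq in auto)
    next
      case 2
      have w2: "w = 2" using 2 q by simp
      have s1: "\<bar>\<sigma>\<bar> < 1" using 2 \<sigma> p by auto
      have x1: "\<bar>fst z\<bar> \<le> 1" if "z \<in> K" for z using range[OF that] p 2(1) by auto
      have ab: "c * v \<le> \<bar>c\<bar>" "- (c * v) \<le> \<bar>c\<bar>" if "\<bar>v\<bar> \<le> 1" for c v :: real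
      proof -
        have "\<bar>c * v\<bar> \<le> \<bar>c\<bar> * 1" unfolding abs_mult using that by (intro mult_left_mono) auto
        then show "c * v \<le> \<bar>c\<bar>" "- (c * v) \<le> \<bar>c\<bar>" by linarith+
      qed
      \<comment> \<open>The width in direction (k, 1) is at least 2. Together with |\<sigma>| < 1,
        the choices k = 0 and k = -1 give m + n \<ge> 1 and m + n \<le> 1.\<close>
      have gap: "1 \<le> \<bar>m + of_int k\<bar> + \<bar>n + of_int k\<bar>" for k
      proof -
        obtain x y where xy: "x \<in> K" "y \<in> K" "w \<le> of_int k * (fst x - fst y) + of_int 1 * (snd x - snd y)"
          by (rule wideD[OF K(4), of k 1]) auto
        have "of_int k * fst x + snd x \<le> (m + of_int k) * fst x + 1" using lines(2)[OF xy(1)] by (simp add: algebra_simps)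
        also have "(m + of_int k) * fst x \<le> \<bar>m + of_int k\<bar>" using ab(1)[OF x1[OF xy(1)]] .
        finally have 1: "of_int k * fst x + snd x \<le> \<bar>m + of_int k\<bar> + 1" by simp
        have "- ((n + of_int k) * fst y) \<le> \<bar>n + of_int k\<bar>" using ab(2)[OF x1[OF xy(2)]] .
        then have "- \<bar>n + of_int k\<bar> \<le> of_int k * fst y + snd y" using lines(1)[OF xy(2)] by (simp add: algebra_simps)
        then show ?thesis using 1 xy(3) w2 by (simp add: algebra_simps)
      qed
      have mn: "m = 1 - n" "0 < n"
        using gap[of 0] gap[of "-1"] s1 n unfolding \<sigma>_def by (auto simp: abs_if split: if_splits)
      \<comment> \<open>For m = 1 - n the trapezoid has one horizontal diagonal and one in direction
        (1, 1); this shear makes the latter vertical and keeps the former.\<close>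
      define T where "T = umap 1 (-1) 0 1 0 0"
      have T: "unimodular T" unfolding T_def by (intro unimodular_umap) simp
      have "cross_hull (T ` K) w"
      proof (rule cross_hullI)
        show "compact (T ` K)" "convex (T ` K)" using compact_unimodular convex_unimodular T K by auto
        show "interior (T ` K) \<noteq> {}" using interior_unimodular[OF T, of K] K(3) by simp
        have "(-1, n) \<in> K" "(1, n) \<in> K" "(-1, - n) \<in> K" "(1, 2 - n) \<in> K"
          using p 2(1) mn n by (intro RK; simp)+
        then show "T (-1, n) \<in> T ` K" "T (1, n) \<in> T ` K" "T (-1, - n) \<in> T ` K" "T (1, 2 - n) \<in> T ` K" by auto
        show "ar (T ` K) \<le> w\<^sup>2 / (2 * (w - 1))" using ar_unimodular[OF T K(1)] eq by simp
      qed (use mn n w2 in \<open>auto simp: T_def umap_def\<close>)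
      then show ?thesis using cross_hull_image T by blast
    next
      case 3
      have w2: "w = 2" using 3 q by simp
      have m: "m = n + 1" using 3 by (simp add: \<sigma>_def)
      \<comment> \<open>K is a triangle with apex on x = -1; the shear makes its chord of direction
        (1, 1) from the apex horizontal and keeps the opposite side vertical.\<close>
      define T where "T = umap 1 0 (-1) 1 0 0"
      have T: "unimodular T" unfolding T_def by (intro unimodular_umap) simp
      have "cross_hull (T ` K) w"
      proof (rule cross_hullI)
        show "compact (T ` K)" "convex (T ` K)" using compact_unimodular convex_unimodular T K by auto
        show "interior (T ` K) \<noteq> {}" using interior_unimodular[OF T, of K] K(3) by simp
        have "(-1, - n) \<in> K" "(1, 2 - n) \<in> K" "(1, n) \<in> K" "(1, 2 + n) \<in> K"
          using p 3 m n by (intro RK; simp)+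
        then show "T (-1, - n) \<in> T ` K" "T (1, 2 - n) \<in> T ` K" "T (1, n) \<in> T ` K" "T (1, 2 + n) \<in> T ` K" by auto
        show "ar (T ` K) \<le> w\<^sup>2 / (2 * (w - 1))" using ar_unimodular[OF T K(1)] eq by simp
      qed (use m n w2 in \<open>auto simp: T_def umap_def\<close>)
      then show ?thesis using cross_hull_image T by blast
    qed
  qed
  then show ?thesis using bound by blast
qed

lemma one_column_bound_sheared:
  assumes K: "compact K" "convex K" "interior K \<noteq> {}" "wide K w"
    and t: "0 < q" "q \<le> p" "p \<le> 1" "p + q = w" "1 < w"
    and range: "\<And>z. z \<in> K \<Longrightarrow> - p \<le> fst z" "\<And>z. z \<in> K \<Longrightarrow> fst z \<le> q"
    and ends: "l \<in> K" "fst l = - p" "r \<in> K" "fst r = q"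
    and lines: "\<And>z. z \<in> K \<Longrightarrow> n * fst z \<le> snd z" "\<And>z. z \<in> K \<Longrightarrow> snd z \<le> m * fst z + 1"
  shows "ar K \<le> w\<^sup>2 / (2 * (w - 1)) \<and> (ar K = w\<^sup>2 / (2 * (w - 1)) \<longrightarrow> cross_hull K w)"
proof -
  define k where "k = \<lfloor>n\<rfloor>"
  define T where "T = umap 1 0 (- k) 1 0 0"
  have T: "unimodular T" unfolding T_def by (intro unimodular_umap) simp
  have fT: "fst (T z) = fst z" "snd (T z) = snd z - of_int k * fst z" for z by (simp_all add: T_def umap_def)
  have "ar (T ` K) \<le> w\<^sup>2 / (2 * (w - 1)) \<and> (ar (T ` K) = w\<^sup>2 / (2 * (w - 1)) \<longrightarrow> cross_hull (T ` K) w)"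
  proof (rule one_column_bound_aux[where n = "frac n" and m = "m - of_int k" and l = "T l" and r = "T r"])
    show "compact (T ` K)" "convex (T ` K)" "wide (T ` K) w" 
      using compact_unimodular convex_unimodular wide_unimodular T K by auto
    show "interior (T ` K) \<noteq> {}" using interior_unimodular[OF T, of K] K(3) by simp
    show "frac n * fst z \<le> snd z" "snd z \<le> (m - of_int k) * fst z + 1" "- p \<le> fst z" "fst z \<le> q" if z: "z \<in> T ` K" for z
    proof -
      obtain x where x: "x \<in> K" "z = T x" using z by blast
      show "frac n * fst z \<le> snd z" "snd z \<le> (m - of_int k) * fst z + 1" "- p \<le> fst z" "fst z \<le> q"
        using lines[OF x(1)] range[OF x(1)] unfolding x(2) fT by (simp_all add: frac_def k_def algebra_simps)
    qed
  qed (use t ends in \<open>auto simp: fT frac_lt_1\<close>)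
  then show ?thesis using cross_hull_image[OF T, of K w] unfolding ar_unimodular[OF T K(1)] by blast
qed

text \<open>A reflection in the column moves the longer part to the left.\<close>

lemma one_column_bound:
  assumes K: "compact K" "convex K" "interior K \<noteq> {}" "wide K w"
    and t: "0 < q" "q \<le> 1" "0 < p" "p \<le> 1" "p + q = w" "1 < w"
    and range: "\<And>z. z \<in> K \<Longrightarrow> - p \<le> fst z" "\<And>z. z \<in> K \<Longrightarrow> fst z \<le> q"
    and ends: "l \<in> K" "fst l = - p" "r \<in> K" "fst r = q"
    and lines: "\<And>z. z \<in> K \<Longrightarrow> n * fst z \<le> snd z" "\<And>z. z \<in> K \<Longrightarrow> snd z \<le> m * fst z + 1"
  shows "ar K \<le> w\<^sup>2 / (2 * (w - 1)) \<and> (ar K = w\<^sup>2 / (2 * (w - 1)) \<longrightarrow> cross_hull K w)"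
proof (cases "q \<le> p")
  case True
  show ?thesis by (rule one_column_bound_sheared[OF K t(1) True t(4,5,6) range ends lines])
next
  case False
  define T where "T = umap (-1) 0 0 1 0 0"
  have T: "unimodular T" unfolding T_def by (intro unimodular_umap) simp
  have fT: "fst (T z) = - fst z" "snd (T z) = snd z" for z by (simp_all add: T_def umap_def)
  have "ar (T ` K) \<le> w\<^sup>2 / (2 * (w - 1)) \<and> (ar (T ` K) = w\<^sup>2 / (2 * (w - 1)) \<longrightarrow> cross_hull (T ` K) w)"
  proof (rule one_column_bound_sheared[where n = "- n" and m = "- m" and l = "T r" and r = "T l" and p = q and q = p])
    show "compact (T ` K)" "convex (T ` K)" "wide (T ` K) w" 
      using compact_unimodular convex_unimodular wide_unimodular T K by auto
    show "interior (T ` K) \<noteq> {}" using interior_unimodular[OF T, of K] K(3) by simp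
    show "- n * fst z \<le> snd z" "snd z \<le> - m * fst z + 1" "- q \<le> fst z" "fst z \<le> p" if z: "z \<in> T ` K" for z
    proof -
      obtain x where x: "x \<in> K" "z = T x" using z by blast
      show "- n * fst z \<le> snd z" "snd z \<le> - m * fst z + 1" "- q \<le> fst z" "fst z \<le> p"
        using lines[OF x(1)] range[OF x(1)] unfolding x(2) fT by simp_all
    qed
  qed (use t ends False in \<open>auto simp: fT\<close>)
  then show ?thesis using cross_hull_image[OF T, of K w] unfolding ar_unimodular[OF T K(1)] by blast
qed

text \<open>A translation fixes the first inner lattice line as x = 0. A shear fixing this line can
  still raise the next column by any integer, so both columns can be brought to the segment from
  height 0 to 1.\<close>

lemma upper_bound_normal_position:
  assumes K: "compact K" "convex K" "interior K \<noteq> {}" "interior K \<inter> Z2 = {}" "wide K w" "thin K w" and w: "1 < w"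
  obtains T a l r y0 where "unimodular T" "-1 \<le> a" "a < 0" "\<And>z. z \<in> T ` K \<Longrightarrow> a \<le> fst z \<and> fst z \<le> a + w"
    "l \<in> T ` K" "fst l = a" "r \<in> T ` K" "fst r = a + w" 
    "(0, y0) \<in> interior (T ` K)" "0 < y0" "y0 < 1"
    "1 < a + w \<Longrightarrow> \<exists>y1. (1, y1) \<in> interior (T ` K) \<and> 0 < y1 \<and> y1 < 1"
proof -
  have ne: "K \<noteq> {}" using K(3) by auto
  obtain S where S: "unimodular S" "\<And>x y. x \<in> S ` K \<Longrightarrow> y \<in> S ` K \<Longrightarrow> fst x - fst y \<le> w"
    using thin_fst[OF K(6) ne] w by auto
  define J where "J = S ` K"
  have J: "compact J" "convex J" "wide J w"
    using compact_unimodular convex_unimodular wide_unimodular S(1) K by (auto simp: J_def)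
  have Ji: "interior J \<noteq> {}" using interior_unimodular[OF S(1), of K] K(3) by (simp add: J_def)
  have free: "(of_int i, of_int j) \<notin> interior J" for i j
  proof
    assume "(of_int i, of_int j) \<in> interior J"
    then obtain z where z: "z \<in> interior K" "S z = (of_int i, of_int j)"
      using interior_unimodular[OF S(1), of K] by (auto simp: J_def)
    then have "z \<in> Z2" using unimodular_Z2[OF S(1), of z] by simp
    then show False using z K(4) by blast
  qed
  obtain r l where rl: "r \<in> J" "l \<in> J" "w \<le> of_int 1 * (fst r - fst l) + of_int 0 * (snd r - snd l)"
    by (rule wideD[OF J(3), of 1 0]) auto
  define c where "c = fst l"
  have rc: "fst r = c + w" using rl S(2)[of r l] by (simp add: J_def c_def)
  have rng: "c \<le> fst z \<and> fst z \<le> c + w" if "z \<in> J" for z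
    using S(2)[of r z] S(2)[of z l] rl that rc by (auto simp: J_def c_def)
  \<comment> \<open>If c is an integer, the lattice line through the left end is skipped, since the
    column has to pass through the interior. This is why a = -1 may occur, but not a = 0.\<close>
  define m where "m = \<lfloor>c\<rfloor> + 1"
  have m: "c < of_int m" "of_int m \<le> c + 1" by (simp_all add: m_def)
  obtain y where y: "(of_int m, y) \<in> interior J"
    using column_interior[OF J(2) Ji rl(2,1), of "of_int m"] m w rc by (auto simp: c_def)
  \<comment> \<open>Without a second column y' is arbitrary; the shear built from it is unimodular
    all the same and leaves the first column in place.\<close>
  have "\<exists>y'. of_int m + 1 < c + w \<longrightarrow> (of_int m + 1, y') \<in> interior J"
    using column_interior[OF J(2) Ji rl(2,1), of "of_int m + 1"] m w rc by (auto simp: c_def)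
  then obtain y' where y': "of_int m + 1 < c + w \<Longrightarrow> (of_int m + 1, y') \<in> interior J" by blast
  define j where "j = \<lfloor>y\<rfloor>"
  define k where "k = \<lfloor>y'\<rfloor> - j"
  define U where "U = umap 1 0 (- k) 1 (- m) (- j + k * m)"
  have U: "unimodular U" unfolding U_def by (intro unimodular_umap) simp
  have fU: "fst (U z) = fst z - of_int m" "snd (U z) = snd z - of_int j - of_int k * (fst z - of_int m)" for z
    by (simp_all add: U_def umap_def algebra_simps)
  have US: "(U \<circ> S) ` K = U ` J" by (simp only: J_def image_comp)
  have int: "interior (U ` J) = U ` interior J" by (rule interior_unimodular[OF U])
  have yj: "y \<noteq> of_int j" using free[of m j] y by auto
  show thesis
  proof (rule that[of "U \<circ> S" "c - of_int m" "U l" "U r" "y - of_int j"], unfold US)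
    show "unimodular (U \<circ> S)" by (rule unimodular_comp[OF U S(1)])
    show "c - of_int m \<le> fst z \<and> fst z \<le> c - of_int m + w" if "z \<in> U ` J" for z
      using that rng by (auto simp: fU)
    have "U (of_int m, y) = (0, y - of_int j)" by (simp add: prod_eq_iff fU)
    then show "(0, y - of_int j) \<in> interior (U ` J)" using y unfolding int by (metis imageI)
    show "0 < y - of_int j" "y - of_int j < 1" using yj by (simp_all add: j_def less_le) linarith+
    show "\<exists>y1. (1, y1) \<in> interior (U ` J) \<and> 0 < y1 \<and> y1 < 1" if "1 < c - of_int m + w"
    proof -
      have i: "(of_int m + 1, y') \<in> interior J" using y' that by simp
      have "U (of_int m + 1, y') = (1, y' - of_int \<lfloor>y'\<rfloor>)" by (simp add: prod_eq_iff fU k_def)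
      then have "(1, y' - of_int \<lfloor>y'\<rfloor>) \<in> interior (U ` J)" using i unfolding int by (metis imageI)
      moreover have "y' \<noteq> of_int \<lfloor>y'\<rfloor>" using free[of "m + 1" "\<lfloor>y'\<rfloor>"] i by auto
      then have "0 < y' - of_int \<lfloor>y'\<rfloor>" "y' - of_int \<lfloor>y'\<rfloor> < 1"
        using of_int_floor_le[of y'] by linarith+
      ultimately show ?thesis by blast
    qed
    show "U l \<in> U ` J" "U r \<in> U ` J" using rl by auto
  qed (use m rc in \<open>auto simp: fU c_def\<close>)
qed

theorem area_upper_bound_le_2:
  assumes K: "compact K" "convex K" "interior K \<noteq> {}" "interior K \<inter> Z2 = {}" "wide K w" "thin K w" and w: "1 < w" "w \<le> 2"
  shows "ar K \<le> w\<^sup>2 / (2 * (w - 1)) \<and> (ar K = w\<^sup>2 / (2 * (w - 1)) \<longrightarrow> cross_hull K w)"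
proof -
  obtain T a l r y0 where T: "unimodular T" and a: "-1 \<le> a" "a < 0"
    and rng: "\<And>z. z \<in> T ` K \<Longrightarrow> a \<le> fst z \<and> fst z \<le> a + w"
    and ends: "l \<in> T ` K" "fst l = a" "r \<in> T ` K" "fst r = a + w" 
    and y0: "(0, y0) \<in> interior (T ` K)" "0 < y0" "y0 < 1"
    and y1: "1 < a + w \<Longrightarrow> \<exists>y1. (1, y1) \<in> interior (T ` K) \<and> 0 < y1 \<and> y1 < 1"
    by (rule upper_bound_normal_position[OF K w(1)]) blast
  define J where "J = T ` K"
  have J: "compact J" "convex J" "interior J \<noteq> {}" "wide J w"
    using compact_unimodular convex_unimodular wide_unimodular T K y0 by (auto simp: J_def)
  have Jfree: "interior J \<inter> Z2 = {}"
    using interior_unimodular[OF T, of K] unimodular_Z2[OF T] K(4) by (auto simp: J_def)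
  have l1: "\<exists>n m. \<forall>z\<in>J. n * fst z \<le> snd z \<and> snd z \<le> m * fst z + 1"
  proof -
    obtain n m where nm: "\<And>z. z \<in> J \<Longrightarrow> n * (fst z - of_int 0) + of_int 0 \<le> snd z"
      "\<And>z. z \<in> J \<Longrightarrow> snd z \<le> m * (fst z - of_int 0) + of_int 0 + 1"
      by (rule column_lines[OF J(2) Jfree, of 0 y0 0]) (use y0 in \<open>auto simp: J_def\<close>)
    have "n * fst z \<le> snd z \<and> snd z \<le> m * fst z + 1" if "z \<in> J" for z
      using nm[OF that] by simp
    then show ?thesis by blast
  qed
  then obtain n1 m1 where L1: "\<And>z. z \<in> J \<Longrightarrow> n1 * fst z \<le> snd z" "\<And>z. z \<in> J \<Longrightarrow> snd z \<le> m1 * fst z + 1" by blast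
  have "ar J \<le> w\<^sup>2 / (2 * (w - 1)) \<and> (ar J = w\<^sup>2 / (2 * (w - 1)) \<longrightarrow> cross_hull J w)"
  proof (cases "1 < a + w")
    case True
    then obtain y1 where y1: "(1, y1) \<in> interior J" "0 < y1" "y1 < 1" using y1 by (auto simp: J_def)
    have "\<exists>n m. \<forall>z\<in>J. n * (fst z - 1) \<le> snd z \<and> snd z \<le> m * (fst z - 1) + 1"
    proof -
      obtain n m where nm: "\<And>z. z \<in> J \<Longrightarrow> n * (fst z - of_int 1) + of_int 0 \<le> snd z"
        "\<And>z. z \<in> J \<Longrightarrow> snd z \<le> m * (fst z - of_int 1) + of_int 0 + 1"
        by (rule column_lines[OF J(2) Jfree, of 1 y1 0]) (use y1 in auto)
      have "n * (fst z - 1) \<le> snd z \<and> snd z \<le> m * (fst z - 1) + 1" if "z \<in> J" for z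
        using nm[OF that] by simp
      then show ?thesis by blast
    qed
    then obtain n2 m2 where L2: "\<And>z. z \<in> J \<Longrightarrow> n2 * (fst z - 1) \<le> snd z" "\<And>z. z \<in> J \<Longrightarrow> snd z \<le> m2 * (fst z - 1) + 1"
      by blast
    show ?thesis
    proof (rule two_column_bound[OF J, of "- a" "a + w - 1" l r y0 y1 n1 m1 n2 m2])
      show "(0, y0) \<in> J" "(1, y1) \<in> J" using y0(1) y1(1) interior_subset by (auto simp: J_def)
    qed (use a w True rng ends y0 y1 L1 L2 in \<open>auto simp: J_def\<close>)
  next
    case False
    show ?thesis
      by (rule one_column_bound[OF J, of "a + w" "- a" l r n1 m1])
        (use a w False rng ends L1 in \<open>auto simp: J_def\<close>)
  qed
  then show ?thesis
    using cross_hull_image[OF T, of K w] unfolding J_def ar_unimodular[OF T K(1)] by blast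
qed

text \<open>The converse in the equality case: the two segments are chords of K with cross product
  w^2 / (w - 1).\<close>

lemma cross_hull_ar_ge:
  assumes K: "compact K" "convex K" and w: "1 < w" and ch: "cross_hull K w"
  shows "w\<^sup>2 / (2 * (w - 1)) \<le> ar K"
proof -
  obtain T t1 t2 where T: "unimodular T" "T ` K = convex hull ((\<lambda>x. t1 + x) ` (convex hull {(0, 0), (w, 0)}) \<union>
      (\<lambda>x. t2 + x) ` (convex hull {(0, 0), (0, w / (w - 1))}))"
    using ch unfolding cross_hull_def Let_def by blast
  have "t1 + x \<in> (\<lambda>x. t1 + x) ` (convex hull {(0, 0), (w, 0)})" if "x \<in> {(0, 0), (w, 0)}" for x
    using that by (intro imageI hull_inc)
  moreover have "t2 + x \<in> (\<lambda>x. t2 + x) ` (convex hull {(0, 0), (0, w / (w - 1))})" if "x \<in> {(0, 0), (0, w / (w - 1))}" for x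
    using that by (intro imageI hull_inc)
  ultimately have "t1 + (0, 0) \<in> T ` K" "t1 + (w, 0) \<in> T ` K" "t2 + (0, 0) \<in> T ` K" "t2 + (0, w / (w - 1)) \<in> T ` K"
    unfolding T(2) by (meson UnI1 UnI2 hull_inc insertI1 insertI2)+
  from two_chords[OF compact_unimodular[OF T(1) K(1)] convex_unimodular[OF T(1) K(2)] this]
  have "w * (w / (w - 1)) / 2 \<le> ar (T ` K)" using w by (simp add: cross2_def)
  then show ?thesis using ar_unimodular[OF T(1) K(1)] w by (simp add: power2_eq_square mult.commute)
qed

section \<open>Lattice width greater than 2\<close>

text \<open>Adding the inequalities at two corners of a vertical side bounds x; a weighted sum at
  two corners of a horizontal side bounds y. For w > 2 the first kind gives P Q < R, while the
  second gives R < P Q, because the defect in the estimate is the square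
  \<open>(a * d - b * c)\<^sup>2\<close>.\<close>

lemma square_lines_width:
  assumes w: "wide K w" and abcd: "0 < a" "0 < b" "0 < c" "0 < d"
    and lines: "\<And>z. z \<in> K \<Longrightarrow> 0 \<le> a * fst z + snd z" "\<And>z. z \<in> K \<Longrightarrow> 0 \<le> b * (1 - fst z) + snd z"
      "\<And>z. z \<in> K \<Longrightarrow> 0 \<le> c * fst z + (1 - snd z)" "\<And>z. z \<in> K \<Longrightarrow> 0 \<le> d * (1 - fst z) + (1 - snd z)"
  shows "w \<le> 2"
proof (rule ccontr)
  assume "\<not> w \<le> 2"
  then have w2: "2 < w" by simp
  define P Q R where "P = a + c" and "Q = b + d" and "R = a + b + c + d"
  have x: "- 1 \<le> P * fst z" "- 1 \<le> Q * (1 - fst z)" if "z \<in> K" for z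
    using lines[OF that] by (auto simp: P_def Q_def algebra_simps)
  have y: "- (a * b) \<le> (a + b) * snd z" "- (c * d) \<le> (c + d) * (1 - snd z)" if "z \<in> K" for z
  proof -
    have "0 \<le> b * (a * fst z + snd z) + a * (b * (1 - fst z) + snd z)"
         "0 \<le> d * (c * fst z + (1 - snd z)) + c * (d * (1 - fst z) + (1 - snd z))"
      by (rule add_nonneg_nonneg[OF mult_nonneg_nonneg mult_nonneg_nonneg]; use lines[OF that] abcd in linarith)+
    then show "- (a * b) \<le> (a + b) * snd z" "- (c * d) \<le> (c + d) * (1 - snd z)" by (simp_all add: algebra_simps)
  qed
  have pos: "0 < P" "0 < Q" "0 < R" "0 < a + b" "0 < c + d" using abcd by (simp_all add: P_def Q_def R_def)
  obtain p q where "p \<in> K" "q \<in> K" "w \<le> of_int 1 * (fst p - fst q) + of_int 0 * (snd p - snd q)"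
    by (rule wideD[OF w, of 1 0]) auto
  moreover have "- (1 / P) \<le> fst q" "- (1 / Q) \<le> 1 - fst p"
    using x(1)[OF \<open>q \<in> K\<close>] x(2)[OF \<open>p \<in> K\<close>] pos by (simp_all add: field_simps)
  ultimately have T: "1 < 1 / P + 1 / Q" using w2 by simp
  obtain p q where "p \<in> K" "q \<in> K" "w \<le> of_int 0 * (fst p - fst q) + of_int 1 * (snd p - snd q)"
    by (rule wideD[OF w, of 0 1]) auto
  moreover have "- (a * b / (a + b)) \<le> snd q" "- (c * d / (c + d)) \<le> 1 - snd p"
    using y(1)[OF \<open>q \<in> K\<close>] y(2)[OF \<open>p \<in> K\<close>] pos by (simp_all add: field_simps)
  ultimately have S: "1 < a * b / (a + b) + c * d / (c + d)" using w2 by simp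
  have PQ: "P * Q < R"
  proof -
    have "1 / P + 1 / Q = R / (P * Q)" using pos by (simp add: P_def Q_def R_def field_simps)
    then show ?thesis using T pos by (simp add: field_simps)
  qed
  have "(a * b / (a + b) + c * d / (c + d)) * R \<le> P * Q"
  proof -
    have "(X / U + Y / V) * (U * V) = X * V + Y * U" if "0 < U" "0 < V" for X Y U V :: real
      using that by (simp add: field_simps)
    from this[OF pos(4,5), of "a * b" "c * d"]
    have "(P * Q - (a * b / (a + b) + c * d / (c + d)) * R) * ((a + b) * (c + d)) =
        P * Q * ((a + b) * (c + d)) - (a * b * (c + d) + c * d * (a + b)) * R" by algebra
    also have "\<dots> = (a * d - b * c)\<^sup>2" by (simp add: P_def Q_def R_def power2_eq_square algebra_simps)
    finally have "0 \<le> (P * Q - (a * b / (a + b) + c * d / (c + d)) * R) * ((a + b) * (c + d))" by simp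
    moreover have "0 < (a + b) * (c + d)" using pos by simp
    ultimately have "0 \<le> P * Q - (a * b / (a + b) + c * d / (c + d)) * R"
      by (metis mult_neg_pos not_le)
    then show ?thesis by simp
  qed
  moreover have "1 * R < (a * b / (a + b) + c * d / (c + d)) * R"
    using S pos by (intro mult_strict_right_mono) auto
  ultimately show False using PQ by linarith
qed

lemma lattice_affine_coords:
  assumes T: "unimodular T" "T z0 = (0, 0)" "T z1 = (1, 0)" "T z2 = (0, 1)"
  shows "z = (1 - fst (T z) - snd (T z)) *\<^sub>R z0 + fst (T z) *\<^sub>R z1 + snd (T z) *\<^sub>R z2"
proof -
  obtain S where S: "unimodular S" "\<And>z. S (T z) = z" "\<And>z. T (S z) = z"
    using unimodular_inverse[OF T(1)] by blast
  obtain a b c d e f where Se: "S = umap a b c d e f" using S(1) unimodular_cases by metis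
  have "z0 = (of_int e, of_int f)" "z1 = (of_int a + of_int e, of_int c + of_int f)" "z2 = (of_int b + of_int e, of_int d + of_int f)"
    using S(2)[of z0] S(2)[of z1] S(2)[of z2] T by (auto simp: Se umap_def)
  then show ?thesis
    using S(2)[of z] by (simp add: Se umap_def prod_eq_iff algebra_simps)
qed

text \<open>T records affine coordinates with respect to z0, z1, z2, so every affine functional is
  interpolated from its values at these points.\<close>

lemma lattice_affine_functional:
  assumes T: "unimodular T" "T z0 = (0, 0)" "T z1 = (1, 0)" "T z2 = (0, 1)"
  shows "b - a \<bullet> z = (b - a \<bullet> z0) * (1 - fst (T z) - snd (T z)) + (b - a \<bullet> z1) * fst (T z) + (b - a \<bullet> z2) * snd (T z)"
proof -
  have "a \<bullet> z = (1 - fst (T z) - snd (T z)) * (a \<bullet> z0) + fst (T z) * (a \<bullet> z1) + snd (T z) * (a \<bullet> z2)"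
    by (subst lattice_affine_coords[OF T, of z]) (simp add: inner_add_right)
  then show ?thesis by (simp add: algebra_simps)
qed

text \<open>With the four points at the corners of the unit square, the slack of each line is a
  positive combination of the coordinates measured from its corner; dividing by one coefficient
  gives the form of \<open>square_lines_width\<close>.\<close>

lemma parallelogram_width:
  assumes w: "wide K w" and Z: "z0 \<in> Z2" "z1 \<in> Z2" "z2 \<in> Z2" "\<bar>cross2 (z1 - z0) (z2 - z0)\<bar> = 1" "z3 = z1 + z2 - z0"
    and on: "a0 \<bullet> z0 = b0" "a1 \<bullet> z1 = b1" "a2 \<bullet> z2 = b2" "a3 \<bullet> z3 = b3"
    and K: "\<And>x. x \<in> K \<Longrightarrow> a0 \<bullet> x \<le> b0" "\<And>x. x \<in> K \<Longrightarrow> a1 \<bullet> x \<le> b1" "\<And>x. x \<in> K \<Longrightarrow> a2 \<bullet> x \<le> b2" "\<And>x. x \<in> K \<Longrightarrow> a3 \<bullet> x \<le> b3"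
    and strict: "a0 \<bullet> z1 < b0" "a0 \<bullet> z2 < b0" "a1 \<bullet> z0 < b1" "a1 \<bullet> z3 < b1" "a2 \<bullet> z0 < b2" "a2 \<bullet> z3 < b2" "a3 \<bullet> z1 < b3" "a3 \<bullet> z2 < b3"
  shows "w \<le> 2"
proof -
  obtain T where T: "unimodular T" "T z0 = (0, 0)" "T z1 = (1, 0)" "T z2 = (0, 1)"
    using lattice_triangle_normal_form[OF Z(1-4)] by blast
  have i3: "a \<bullet> z3 = a \<bullet> z1 + a \<bullet> z2 - a \<bullet> z0" for a by (simp add: Z(5) inner_add_right inner_diff_right)
  define A0 B0 where "A0 = b0 - a0 \<bullet> z1" and "B0 = b0 - a0 \<bullet> z2"
  define A1 B1 where "A1 = b1 - a1 \<bullet> z0" and "B1 = b1 - a1 \<bullet> z3"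
  define A2 B2 where "A2 = b2 - a2 \<bullet> z3" and "B2 = b2 - a2 \<bullet> z0"
  define A3 B3 where "A3 = b3 - a3 \<bullet> z2" and "B3 = b3 - a3 \<bullet> z1"
  have pos: "0 < A0" "0 < B0" "0 < A1" "0 < B1" "0 < A2" "0 < B2" "0 < A3" "0 < B3"
    using strict by (simp_all add: A0_def B0_def A1_def B1_def A2_def B2_def A3_def B3_def)
  show ?thesis
  proof (rule square_lines_width[OF wide_unimodular[OF T(1) w], of "A0 / B0" "A1 / B1" "A2 / B2" "A3 / B3"])
    fix y assume "y \<in> T ` K"
    then obtain z where z: "z \<in> K" "y = T z" by blast
    have 0: "0 \<le> A0 * fst y + B0 * snd y"
      using K(1)[OF z(1)] lattice_affine_functional[OF T, of b0 a0 z] on(1) by (simp add: A0_def B0_def z(2))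
    have e1: "b1 - a1 \<bullet> z0 = A1" "b1 - a1 \<bullet> z1 = 0" "b1 - a1 \<bullet> z2 = A1 + B1"
      using on(2) i3[of a1] by (simp_all add: A1_def B1_def)
    have 1: "0 \<le> A1 * (1 - fst y) + B1 * snd y"
      using K(2)[OF z(1)] lattice_affine_functional[OF T, of b1 a1 z] unfolding e1 z(2)
      by (simp add: algebra_simps)
    have e2: "b2 - a2 \<bullet> z0 = B2" "b2 - a2 \<bullet> z2 = 0" "b2 - a2 \<bullet> z1 = A2 + B2"
      using on(3) i3[of a2] by (simp_all add: A2_def B2_def)
    have 2: "0 \<le> A2 * fst y + B2 * (1 - snd y)"
      using K(3)[OF z(1)] lattice_affine_functional[OF T, of b2 a2 z] unfolding e2 z(2)
      by (simp add: algebra_simps)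
    have e3: "b3 - a3 \<bullet> z0 = A3 + B3" "b3 - a3 \<bullet> z1 = B3" "b3 - a3 \<bullet> z2 = A3"
      using on(4) i3[of a3] by (simp_all add: A3_def B3_def)
    have 3: "0 \<le> A3 * (1 - fst y) + B3 * (1 - snd y)"
      using K(4)[OF z(1)] lattice_affine_functional[OF T, of b3 a3 z] unfolding e3 z(2)
      by (simp add: algebra_simps)
    have div: "0 \<le> A / B * s + t" if "0 \<le> A * s + B * t" "0 < B" for A B s t :: real
    proof -
      have "A / B * s + t = (A * s + B * t) / B" using that(2) by (simp add: field_simps)
      then show ?thesis using that by simp
    qed
    show "0 \<le> A0 / B0 * fst y + snd y" "0 \<le> A1 / B1 * (1 - fst y) + snd y"
      "0 \<le> A2 / B2 * fst y + (1 - snd y)" "0 \<le> A3 / B3 * (1 - fst y) + (1 - snd y)"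
      using div 0 1 2 3 pos by blast+
  qed (use pos in auto)
qed

section \<open>The ratio \<open>lam w\<close> and circumscribed triangles\<close>

definition lam :: "real \<Rightarrow> real" where
  "lam w = (3 * w + 1 - sqrt (1 + 6 * w - 3 * w\<^sup>2)) / (6 * w)"

definition lam_triangle :: "(real \<times> real) set \<Rightarrow> real \<Rightarrow> bool" where
  "lam_triangle K w \<longleftrightarrow> (\<exists>q0 q1 q2. \<not> collinear {q0, q1, q2} \<and> K = convex hull {q0, q1, q2}
               \<and> lam w *\<^sub>R q1 + (1 - lam w) *\<^sub>R q2 \<in> Z2
               \<and> lam w *\<^sub>R q2 + (1 - lam w) *\<^sub>R q0 \<in> Z2
               \<and> lam w *\<^sub>R q0 + (1 - lam w) *\<^sub>R q1 \<in> Z2)"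

text \<open>The expression equals 4 - 3 (w - 1)^2 and is the discriminant of the quadratic for
  \<open>lam w\<close>; the upper limit for w is its larger zero.\<close>

lemma discriminant_nonneg:
  assumes "2 < w" "w \<le> 1 + 2 / sqrt 3"
  shows "0 \<le> 1 + 6 * w - 3 * w\<^sup>2" 
proof -
  have "(w - 1)\<^sup>2 \<le> (2 / sqrt 3)\<^sup>2" using assms by (intro power_mono) auto
  also have "\<dots> = 4 / 3" by (simp add: power_divide)
  finally show ?thesis by (simp add: power2_eq_square algebra_simps)
qed

lemma lam_props:
  assumes w: "2 < w" "w \<le> 1 + 2 / sqrt 3"
  shows "1/2 < lam w" "lam w < 1" "w * (1 - 3 * lam w + 3 * (lam w)\<^sup>2) = lam w"
    "\<And>\<mu>. w * (1 - 3 * \<mu> + 3 * \<mu>\<^sup>2) \<le> \<mu> \<Longrightarrow> lam w \<le> \<mu>"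
    "3 * w\<^sup>2 / (3 * w + 1 - sqrt (1 + 6 * w - 3 * w\<^sup>2)) = w / (2 * lam w)"
proof -
  define s where "s = sqrt (1 + 6 * w - 3 * w\<^sup>2)"
  have s0: "0 \<le> s" and s2: "s\<^sup>2 = 1 + 6 * w - 3 * w\<^sup>2"
    using discriminant_nonneg[OF w] by (simp_all add: s_def)
  have ww: "2 * w < w\<^sup>2" using w by (simp add: power2_eq_square)
  \<comment> \<open>Here w > 2 enters: it makes the discriminant smaller than 1, which places the
    root above 1/2.\<close>
  have "s < 1"
  proof (rule ccontr)
    assume "\<not> s < 1"
    then have "1 \<le> s\<^sup>2" by (simp add: power2_eq_square) (use mult_mono[of 1 s 1 s] in simp)
    then show False using s2 ww by linarith
  qed
  have lw: "6 * w * lam w = 3 * w + 1 - s" using w by (simp add: lam_def s_def)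
  have seq: "s = 3 * w + 1 - 6 * w * lam w" using lw by simp
  have "6 * w * (1/2) < 6 * w * lam w" using lw \<open>s < 1\<close> by simp
  then show half: "1/2 < lam w" using w by (simp add: mult_less_cancel_left)
  have "6 * w * lam w < 6 * w * 1" using lw s0 w by simp
  then show "lam w < 1" using w by (simp add: mult_less_cancel_left)
  have "12 * w * (w * (1 - 3 * lam w + 3 * (lam w)\<^sup>2) - lam w) = 0"
    using s2 unfolding seq by (simp add: power2_eq_square algebra_simps)
  then show root: "w * (1 - 3 * lam w + 3 * (lam w)\<^sup>2) = lam w" using w by simp
  show "lam w \<le> \<mu>" if "w * (1 - 3 * \<mu> + 3 * \<mu>\<^sup>2) \<le> \<mu>" for \<mu>
  proof (rule ccontr)
    assume n: "\<not> lam w \<le> \<mu>"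
    \<comment> \<open>The known root is factored out; to the left of the smaller root the quadratic
      is positive.\<close>
    have "w * (1 - 3 * \<mu> + 3 * \<mu>\<^sup>2) - \<mu> = (\<mu> - lam w) * (3 * w * \<mu> + 3 * w * lam w - 3 * w - 1)"
      using root by (simp add: power2_eq_square algebra_simps)
    moreover have "3 * w * \<mu> + 3 * w * lam w - 3 * w - 1 < 0"
    proof -
      have "3 * w * \<mu> < 3 * w * lam w" using n w by (intro mult_strict_left_mono) auto
      then show ?thesis using lw s0 by linarith
    qed
    ultimately have "0 < w * (1 - 3 * \<mu> + 3 * \<mu>\<^sup>2) - \<mu>" using n by (simp add: mult_neg_neg)
    then show False using that by simp
  qed
  have "3 * w\<^sup>2 / (6 * w * lam w) = w / (2 * lam w)"
    using w half by (simp add: power2_eq_square)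
  then show "3 * w\<^sup>2 / (3 * w + 1 - sqrt (1 + 6 * w - 3 * w\<^sup>2)) = w / (2 * lam w)"
    unfolding lw s_def .
qed

text \<open>\<mu> is the least of the three ratios. If \<mu> \<le> 1/2, then D \<ge> \<mu> (1 -
  \<mu>) \<ge> \<mu> / 2 contradicts w D \<le> \<mu>. Otherwise D is at least its value 1 - 3 \<mu>
  + 3 \<mu>^2 at u = v = \<mu>. This gives \<open>lam w\<close> \<le> \<mu>, and that value
  increases with \<mu> beyond 1/2.\<close>

lemma ratio_bound_aux:
  fixes \<mu> u v :: real
  assumes w: "2 < w" "w \<le> 1 + 2 / sqrt 3" and \<mu>: "0 < \<mu>" "\<mu> \<le> u" "\<mu> \<le> v" "1 \<le> \<mu> + u" "1 \<le> \<mu> + v"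
    and D: "D = 1 - (\<mu> + u + v) + (\<mu> * u + \<mu> * v + u * v)" and wD: "w * D \<le> \<mu>"
  shows "lam w / w \<le> D \<and> (D = lam w / w \<longrightarrow> \<mu> = lam w \<and> u = lam w \<and> v = lam w)"
proof (cases "\<mu> \<le> 1/2")
  case True
  have "D = \<mu> * (1 - \<mu>) + (u - (1 - \<mu>)) * (v - (1 - \<mu>))" by (simp add: D algebra_simps)
  moreover have "0 \<le> (u - (1 - \<mu>)) * (v - (1 - \<mu>))" using \<mu> by (intro mult_nonneg_nonneg) auto
  moreover have "\<mu> * (1/2) \<le> \<mu> * (1 - \<mu>)" using True \<mu> by (intro mult_left_mono) auto
  ultimately have "\<mu> / 2 \<le> D" by linarith
  then have "w * (\<mu> / 2) \<le> w * D" using w by (intro mult_left_mono) auto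
  moreover have "2 * (\<mu> / 2) < w * (\<mu> / 2)" using w \<mu> by (intro mult_strict_right_mono) auto
  ultimately show ?thesis using wD by linarith
next
  case False
  define l where "l = lam w"
  note L = lam_props[OF w, folded l_def]
  have Dg: "D = (1 - 3 * \<mu> + 3 * \<mu>\<^sup>2) + ((2 * \<mu> - 1) * ((u - \<mu>) + (v - \<mu>)) + (u - \<mu>) * (v - \<mu>))"
    by (simp add: D power2_eq_square algebra_simps)
  have p1: "0 \<le> (2 * \<mu> - 1) * ((u - \<mu>) + (v - \<mu>))" using False \<mu> by (intro mult_nonneg_nonneg) auto
  have p2: "0 \<le> (u - \<mu>) * (v - \<mu>)" using \<mu> by (intro mult_nonneg_nonneg) auto
  have "w * (1 - 3 * \<mu> + 3 * \<mu>\<^sup>2) \<le> w * D" using w Dg p1 p2 by (intro mult_left_mono) auto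
  then have lm: "l \<le> \<mu>" using L(4)[of \<mu>] wD by linarith
  have gd: "(1 - 3 * \<mu> + 3 * \<mu>\<^sup>2) = (1 - 3 * l + 3 * l\<^sup>2) + 3 * (\<mu> - l) * (\<mu> + l - 1)"
    by (simp add: power2_eq_square algebra_simps)
  have p3: "0 \<le> 3 * (\<mu> - l) * (\<mu> + l - 1)" using lm L(1) False by (intro mult_nonneg_nonneg) auto
  have lw: "1 - 3 * l + 3 * l\<^sup>2 = l / w" using L(3) w by (simp add: field_simps)
  have "\<mu> = l \<and> u = l \<and> v = l" if "D = l / w"
  proof -
    have z: "3 * (\<mu> - l) * (\<mu> + l - 1) = 0" "(2 * \<mu> - 1) * ((u - \<mu>) + (v - \<mu>)) = 0"
      using that Dg gd lw p1 p2 p3 by linarith+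
    then have "\<mu> = l" using L(1) False by auto
    moreover have "(u - \<mu>) + (v - \<mu>) = 0" using z(2) False by simp
    ultimately show ?thesis using \<mu> by linarith
  qed
  moreover have "l / w \<le> D" using Dg gd lw p1 p2 p3 by linarith
  ultimately show ?thesis by (simp add: l_def)
qed

lemma ratio_bound:
  fixes u v t :: real
  assumes w: "2 < w" "w \<le> 1 + 2 / sqrt 3" and pos: "0 < u" "0 < v" "0 < t" and s: "1 \<le> u + v" "1 \<le> v + t" "1 \<le> u + t"
    and D: "D = 1 - (u + v + t) + (u * v + v * t + u * t)" and wD: "w * D \<le> u" "w * D \<le> v" "w * D \<le> t"
  shows "lam w / w \<le> D \<and> (D = lam w / w \<longrightarrow> u = lam w \<and> v = lam w \<and> t = lam w)"
proof -
  consider "u \<le> v \<and> u \<le> t" | "v \<le> u \<and> v \<le> t" | "t \<le> u \<and> t \<le> v" by linarith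
  then show ?thesis
  proof cases
    case 1
    have D': "D = 1 - (u + v + t) + (u * v + u * t + v * t)" by (simp add: D algebra_simps)
    show ?thesis by (rule ratio_bound_aux[OF w pos(1) _ _ s(1) s(3) D' wD(1)]) (use 1 in auto)
  next
    case 2
    have D': "D = 1 - (v + u + t) + (v * u + v * t + u * t)" by (simp add: D algebra_simps)
    have "1 \<le> v + u" using s(1) by simp
    from ratio_bound_aux[OF w pos(2) _ _ this s(2) D' wD(2)] 2 show ?thesis by blast
  next
    case 3
    have D': "D = 1 - (t + u + v) + (t * u + t * v + u * v)" by (simp add: D algebra_simps)
    have "1 \<le> t + u" "1 \<le> t + v" using s by simp_all
    from ratio_bound_aux[OF w pos(3) _ _ this D' wD(3)] 3 show ?thesis by blast
  qed
qed

lemma collinear_cross2: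
  assumes "collinear {a, b, c}"
  shows "cross2 (b - a) (c - a) = 0"
proof -
  obtain u where u: "\<And>x y. x \<in> {a, b, c} \<Longrightarrow> y \<in> {a, b, c} \<Longrightarrow> \<exists>k. x - y = k *\<^sub>R u"
    using assms unfolding collinear_def by blast
  obtain k l where "b - a = k *\<^sub>R u" "c - a = l *\<^sub>R u" using u[of b a] u[of c a] by auto
  then show ?thesis by (simp add: cross2_def)
qed

text \<open>The three lines g0 = 0, g1 = 0, g2 = 0 pass through (0,0), (1,0), (0,1). The ratios E_i / N below
  are the ratios in which these points divide the sides of the triangle bounded by the lines, and
  N^2 / (E0 E1 E2) is twice its area.\<close>

lemma pinwheel_normal_form:
  assumes J: "compact J" "convex J" "interior J \<noteq> {}" "wide J w" and w: "2 < w" "w \<le> 1 + 2 / sqrt 3"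
    and \<beta>: "0 < \<beta>0" "\<beta>0 \<le> 1" "0 < \<beta>1" "\<beta>1 \<le> 1" "0 < \<beta>2" "\<beta>2 \<le> 1"
    and g0: "\<And>z. z \<in> J \<Longrightarrow> 0 \<le> fst z + \<beta>0 * snd z"
    and g1: "\<And>z. z \<in> J \<Longrightarrow> 0 \<le> snd z + \<beta>1 * (1 - fst z - snd z)"
    and g2: "\<And>z. z \<in> J \<Longrightarrow> 0 \<le> (1 - fst z - snd z) + \<beta>2 * fst z"
  shows "ar J \<le> w / (2 * lam w) \<and> (ar J = w / (2 * lam w) \<longrightarrow> lam_triangle J w)"
proof -
  \<comment> \<open>E0, E1, E2 are the denominators of the corner coordinates of the circumscribed
    triangle; g0, g1, g2 take the values N / E2, N / E0, N / E1 at the corners opposite to their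
    lines.\<close>
  define E0 E1 E2 N where "E0 = 1 - \<beta>0 + \<beta>0 * \<beta>2" and "E1 = 1 - \<beta>1 + \<beta>1 * \<beta>0"
    and "E2 = 1 - \<beta>2 + \<beta>2 * \<beta>1" and "N = 1 + \<beta>0 * \<beta>1 * \<beta>2"
  have E: "0 < E0" "0 < E1" "0 < E2" "0 < N"
    using \<beta> by (simp_all add: E0_def E1_def E2_def N_def add_nonneg_pos add_pos_pos)
  have NE: "N - E1 = \<beta>1 * E0" "N - E0 = \<beta>0 * E2" "N - E2 = \<beta>2 * E1"
    by (simp_all add: N_def E0_def E1_def E2_def algebra_simps)
  have ranges: "- \<beta>0 \<le> E0 * fst z" "E2 * fst z \<le> 1" "- \<beta>1 \<le> E1 * snd z" "E0 * snd z \<le> 1"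
    "- \<beta>2 \<le> E2 * (1 - fst z - snd z)" "E1 * (1 - fst z - snd z) \<le> 1" if z: "z \<in> J" for z
  proof -
    define x y u where "x = fst z" and "y = snd z" and "u = 1 - fst z - snd z"
    have G: "0 \<le> x + \<beta>0 * y" "0 \<le> y + \<beta>1 * u" "0 \<le> u + \<beta>2 * x"
      using g0[OF z] g1[OF z] g2[OF z] by (simp_all add: x_def y_def u_def)
    have u: "u = 1 - x - y" by (simp add: x_def y_def u_def)
    \<comment> \<open>In each combination two of the barycentric coordinates x, y, u receive the
      coefficient that lets x + y + u = 1 eliminate them, leaving a bound for the third.\<close>
    have "0 \<le> (x + \<beta>0 * y) + \<beta>0 * (u + \<beta>2 * x)" "0 \<le> (y + \<beta>1 * u) + (1 - \<beta>1) * (u + \<beta>2 * x)"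
      "0 \<le> (y + \<beta>1 * u) + \<beta>1 * (x + \<beta>0 * y)" "0 \<le> (u + \<beta>2 * x) + (1 - \<beta>2) * (x + \<beta>0 * y)"
      "0 \<le> (u + \<beta>2 * x) + \<beta>2 * (y + \<beta>1 * u)" "0 \<le> (x + \<beta>0 * y) + (1 - \<beta>0) * (y + \<beta>1 * u)"
      by (rule add_nonneg_nonneg[OF _ mult_nonneg_nonneg]; use G \<beta> in linarith)+
    then show "- \<beta>0 \<le> E0 * fst z" "E2 * fst z \<le> 1" "- \<beta>1 \<le> E1 * snd z" "E0 * snd z \<le> 1"
      "- \<beta>2 \<le> E2 * (1 - fst z - snd z)" "E1 * (1 - fst z - snd z) \<le> 1"
      unfolding u by (simp_all add: E0_def E1_def E2_def x_def y_def algebra_simps)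
  qed
  \<comment> \<open>The affine form ranges from - \<beta> / P to 1 / Q, an interval of length N / (P
    Q). The offset h is 1 for the form 1 - x - y and 0 for x and y.\<close>
  have width: "w * (P * Q) \<le> N" if PQ: "0 < P" "0 < Q" "N - P = \<beta> * Q" and ij: "\<bar>i\<bar> + \<bar>j\<bar> > (0::int)"
    and r: "\<And>z. z \<in> J \<Longrightarrow> - \<beta> \<le> P * (h + (of_int i * fst z + of_int j * snd z))"
       "\<And>z. z \<in> J \<Longrightarrow> Q * (h + (of_int i * fst z + of_int j * snd z)) \<le> 1" for P Q \<beta> i j h
  proof -
    obtain p q where pq: "p \<in> J" "q \<in> J" "w \<le> of_int i * (fst p - fst q) + of_int j * (snd p - snd q)"
      using wideD[OF J(4) ij] by blast
    define X Y where "X = h + (of_int i * fst p + of_int j * snd p)" and "Y = h + (of_int i * fst q + of_int j * snd q)"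
    have "w \<le> X - Y" using pq(3) by (simp add: X_def Y_def algebra_simps)
    then have "w * (P * Q) \<le> (X - Y) * (P * Q)" using PQ by (intro mult_right_mono) auto
    also have "\<dots> = P * (Q * X) - Q * (P * Y)" by (simp add: algebra_simps)
    also have "\<dots> \<le> P * 1 - Q * (- \<beta>)"
      using r(1)[OF pq(2)] r(2)[OF pq(1)] PQ unfolding X_def[symmetric] Y_def[symmetric]
      by (intro diff_mono mult_left_mono) auto
    also have "\<dots> = N" using PQ(3) by (simp add: algebra_simps)
    finally show ?thesis .
  qed
  have W1: "w * (E0 * E2) \<le> N"
    by (rule width[of E0 E2 \<beta>0 1 0 0]) (use E NE ranges in auto)
  have W2: "w * (E1 * E0) \<le> N"
    by (rule width[of E1 E0 \<beta>1 0 1 0]) (use E NE ranges in auto)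
  have W0: "w * (E2 * E1) \<le> N"
    by (rule width[of E2 E1 \<beta>2 "-1" "-1" 1]) (use E NE ranges in \<open>auto simp: algebra_simps\<close>)
  define \<nu>0 \<nu>1 \<nu>2 where "\<nu>0 = E0 / N" and "\<nu>1 = E1 / N" and "\<nu>2 = E2 / N"
  have \<nu>: "0 < \<nu>0" "0 < \<nu>1" "0 < \<nu>2" using E by (simp_all add: \<nu>0_def \<nu>1_def \<nu>2_def)
  have c: "1 - \<nu>1 = \<beta>1 * \<nu>0" "1 - \<nu>0 = \<beta>0 * \<nu>2" "1 - \<nu>2 = \<beta>2 * \<nu>1"
    using NE E by (simp_all add: \<nu>0_def \<nu>1_def \<nu>2_def field_simps)
  \<comment> \<open>The reciprocal of twice the area of the circumscribed triangle.\<close>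
  define D where "D = E0 * E1 * E2 / (N * N)"
  have Dpos: "0 < D" using E by (simp add: D_def)
  have D\<nu>: "D = \<nu>0 * \<nu>1 * \<nu>2 * N" using E by (simp add: D_def \<nu>0_def \<nu>1_def \<nu>2_def)
  have Dsum: "D = 1 - (\<nu>0 + \<nu>1 + \<nu>2) + (\<nu>0 * \<nu>1 + \<nu>1 * \<nu>2 + \<nu>0 * \<nu>2)"
  proof -
    have "1 - (\<nu>0 + \<nu>1 + \<nu>2) + (\<nu>0 * \<nu>1 + \<nu>1 * \<nu>2 + \<nu>0 * \<nu>2) = \<nu>0 * \<nu>1 * \<nu>2 + (1 - \<nu>0) * (1 - \<nu>1) * (1 - \<nu>2)"
      by (simp add: algebra_simps)
    also have "\<dots> = \<nu>0 * \<nu>1 * \<nu>2 * N" unfolding c by (simp add: N_def algebra_simps)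
    finally show ?thesis using D\<nu> by simp
  qed
  have s: "1 \<le> \<nu>0 + \<nu>1" "1 \<le> \<nu>1 + \<nu>2" "1 \<le> \<nu>0 + \<nu>2"
  proof -
    have "\<beta>1 * \<nu>0 \<le> 1 * \<nu>0" "\<beta>2 * \<nu>1 \<le> 1 * \<nu>1" "\<beta>0 * \<nu>2 \<le> 1 * \<nu>2"
      using \<beta> \<nu> by (intro mult_right_mono; simp)+
    then show "1 \<le> \<nu>0 + \<nu>1" "1 \<le> \<nu>1 + \<nu>2" "1 \<le> \<nu>0 + \<nu>2" using c by linarith+
  qed
  have wD: "w * D \<le> \<nu>0" "w * D \<le> \<nu>1" "w * D \<le> \<nu>2"
  proof -
    have A: "w * D = w * (E2 * E1) * (\<nu>0 / N)" "w * D = w * (E0 * E2) * (\<nu>1 / N)" "w * D = w * (E1 * E0) * (\<nu>2 / N)"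
      by (simp_all add: D_def \<nu>0_def \<nu>1_def \<nu>2_def)
    have B: "w * (E2 * E1) * (\<nu>0 / N) \<le> N * (\<nu>0 / N)" "w * (E0 * E2) * (\<nu>1 / N) \<le> N * (\<nu>1 / N)"
        "w * (E1 * E0) * (\<nu>2 / N) \<le> N * (\<nu>2 / N)"
      using W0 W1 W2 E \<nu> by (intro mult_right_mono; simp)+
    have n: "N * (x / N) = x" for x using E by simp
    show "w * D \<le> \<nu>0" using B(1) unfolding A(1)[symmetric] n .
    show "w * D \<le> \<nu>1" using B(2) unfolding A(2)[symmetric] n .
    show "w * D \<le> \<nu>2" using B(3) unfolding A(3)[symmetric] n .
  qed
  have bnd: "lam w / w \<le> D" and bnd_eq: "D = lam w / w \<Longrightarrow> \<nu>0 = lam w \<and> \<nu>1 = lam w \<and> \<nu>2 = lam w"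
    using ratio_bound[OF w \<nu> s Dsum wD] by blast+
  \<comment> \<open>Each corner is the intersection of the two lines with the other indices.\<close>
  define q0 q1 q2 where "q0 = (1 / E2, \<beta>1 * \<beta>2 / E2)" and "q1 = (- \<beta>0 / E0, 1 / E0)" and "q2 = (\<beta>0 * \<beta>1 / E1, - \<beta>1 / E1)"
  have cr: "cross2 (q1 - q0) (q2 - q0) = 1 / D"
  proof -
    have "cross2 (q1 - q0) (q2 - q0) = cross2 q0 q1 + cross2 q1 q2 + cross2 q2 q0"
      by (simp add: cross2_def algebra_simps)
    also have "cross2 q0 q1 = N / (E0 * E2)" using E by (simp add: cross2_def q0_def q1_def N_def field_simps)
    also have "cross2 q1 q2 = 0" using E by (simp add: cross2_def q1_def q2_def)
    also have "cross2 q2 q0 = \<beta>1 * N / (E1 * E2)" using E by (simp add: cross2_def q0_def q2_def N_def field_simps)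
    also have "N / (E0 * E2) + 0 + \<beta>1 * N / (E1 * E2) = N * (E1 + \<beta>1 * E0) / (E0 * E1 * E2)"
      using E by (simp add: field_simps)
    also have "E1 + \<beta>1 * E0 = N" using NE(1) by simp
    finally show ?thesis by (simp add: D_def)
  qed
  have art: "ar (convex hull {q0, q1, q2}) = 1 / (2 * D)"
    using cr Dpos by (simp add: ar_triangle)
  have sub: "J \<subseteq> convex hull {q0, q1, q2}"
  proof
    fix z assume z: "z \<in> J"
    define x y u where "x = fst z" and "y = snd z" and "u = 1 - fst z - snd z"
    define G0 G1 G2 where "G0 = x + \<beta>0 * y" and "G1 = y + \<beta>1 * u" and "G2 = u + \<beta>2 * x"
    have G: "0 \<le> G0" "0 \<le> G1" "0 \<le> G2"
      using g0[OF z] g1[OF z] g2[OF z] by (simp_all add: x_def y_def u_def G0_def G1_def G2_def)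
    have u: "u = 1 - x - y" by (simp add: x_def y_def u_def)
    show "z \<in> convex hull {q0, q1, q2}"
    \<comment> \<open>Each weight is the value of a line form divided by its value at the opposite
      corner.\<close>
    proof (rule triangle_memI[of "G0 * E2 / N" "G1 * E0 / N" "G2 * E1 / N"])
      have "G0 * E2 + G1 * E0 + G2 * E1 = N"
        unfolding G0_def G1_def G2_def u by (simp add: E0_def E1_def E2_def N_def algebra_simps)
      then show "G0 * E2 / N + G1 * E0 / N + G2 * E1 / N = 1" using E by (simp add: field_simps)
      have "G0 - \<beta>0 * G1 + \<beta>0 * \<beta>1 * G2 = x * N" "\<beta>1 * \<beta>2 * G0 + G1 - \<beta>1 * G2 = y * N"
        unfolding G0_def G1_def G2_def u by (simp_all add: N_def algebra_simps)
      then have "x = (G0 - \<beta>0 * G1 + \<beta>0 * \<beta>1 * G2) / N" "y = (\<beta>1 * \<beta>2 * G0 + G1 - \<beta>1 * G2) / N"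
        using E by (simp_all add: field_simps)
      then show "z = (G0 * E2 / N) *\<^sub>R q0 + (G1 * E0 / N) *\<^sub>R q1 + (G2 * E1 / N) *\<^sub>R q2"
        using E by (simp add: prod_eq_iff q0_def q1_def q2_def x_def y_def diff_divide_distrib add_divide_distrib mult.commute)
    qed (use G E in auto)
  qed
  note L = lam_props[OF w]
  have le1: "ar J \<le> 1 / (2 * D)" using ar_mono[OF J(1) compact_triangle sub] art by simp
  have le2: "1 / (2 * D) \<le> w / (2 * lam w)"
  proof -
    have "lam w \<le> w * D" using bnd w by (simp add: field_simps)
    then show ?thesis using Dpos L(1) by (simp add: field_simps)
  qed
  have "lam_triangle J w" if eq: "ar J = w / (2 * lam w)"
  proof -
    define l where "l = lam w"
    have "1 / (2 * D) = w / (2 * lam w)" using eq le1 le2 by linarith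
    then have "D = lam w / w" using Dpos L(1) w by (simp add: field_simps)
    then have \<nu>l: "\<nu>0 = l" "\<nu>1 = l" "\<nu>2 = l" using bnd_eq by (simp_all add: l_def)
    have l: "1/2 < l" "l < 1" using L by (simp_all add: l_def)
    define \<beta> where "\<beta> = (1 - l) / l"
    have bl: "\<beta>0 = \<beta>" "\<beta>1 = \<beta>" "\<beta>2 = \<beta>" using c l unfolding \<nu>l by (simp_all add: \<beta>_def field_simps)
    have \<beta>l: "l * \<beta> = 1 - l" using l by (simp add: \<beta>_def)
    define e where "e = 1 - \<beta> + \<beta> * \<beta>"
    have Ee: "E0 = e" "E1 = e" "E2 = e" by (simp_all add: E0_def E1_def E2_def e_def bl)
    have e: "0 < e" using E Ee by simp
    have le: "l * (1 + \<beta> * \<beta> * \<beta>) = e"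
      using \<nu>l(1) E by (simp add: \<nu>0_def Ee N_def bl field_simps)
    have q: "q0 = (1 / e, \<beta> * \<beta> / e)" "q1 = (- \<beta> / e, 1 / e)" "q2 = (\<beta> * \<beta> / e, - \<beta> / e)"
      by (simp_all add: q0_def q1_def q2_def bl Ee)
    have "convex hull {q0, q1, q2} \<subseteq> J"
    proof (rule convex_ar_eq_imp_subset[OF compact_triangle convex_convex_hull _ J(1)])
      show "interior (convex hull {q0, q1, q2}) \<noteq> {}" using interior_mono[OF sub] J(3) by blast
      show "ar (convex hull {q0, q1, q2}) \<le> ar (J \<inter> convex hull {q0, q1, q2})"
        using sub art eq le2 by (simp add: inf_absorb1)
    qed
    \<comment> \<open>The order q0, q2, q1 is the orientation in which \<open>lam_triangle\<close>
      divides the sides.\<close>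
    then have Jq: "J = convex hull {q0, q2, q1}" using sub by (simp add: insert_commute)
    have nc: "\<not> collinear {q0, q2, q1}"
      using collinear_cross2[of q0 q1 q2] cr Dpos by (auto simp: insert_commute)
    have m: "l *\<^sub>R q2 + (1 - l) *\<^sub>R q1 = (0, 0)" "l *\<^sub>R q1 + (1 - l) *\<^sub>R q0 = (0, 1)" "l *\<^sub>R q0 + (1 - l) *\<^sub>R q2 = (1, 0)"
      unfolding q \<beta>l[symmetric] using e le by (simp_all add: field_simps)
    show ?thesis
      unfolding lam_triangle_def l_def[symmetric]
      by (intro exI[of _ q0] exI[of _ q2] exI[of _ q1]) (simp add: nc Jq m)
  qed
  then show ?thesis using le1 le2 by linarith
qed

lemma cross2_zero_parallel:
  assumes "cross2 u v = 0" "u \<noteq> 0"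
  obtains c where "v = c *\<^sub>R u"
proof (cases "fst u = 0")
  case True
  then have "snd u \<noteq> 0" using assms(2) by (simp add: prod_eq_iff)
  then have "v = (snd v / snd u) *\<^sub>R u" using assms(1) True by (simp add: cross2_def prod_eq_iff)
  then show thesis by (rule that)
next
  case False
  then have "v = (fst v / fst u) *\<^sub>R u" using assms(1) by (simp add: cross2_def prod_eq_iff field_simps)
  then show thesis by (rule that)
qed

lemma collinear_iff_cross2: "collinear {a, b, c} \<longleftrightarrow> cross2 (b - a) (c - a) = 0"
proof
  assume "cross2 (b - a) (c - a) = 0"
  then have "collinear {0, b - a, c - a}"
    unfolding collinear_lemma using cross2_zero_parallel by metis
  then show "collinear {a, b, c}"
    using collinear_3[of b a c] by (simp add: insert_commute)
qed (rule collinear_cross2)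

lemma lam_triangle_image:
  assumes T: "unimodular T" and lt: "lam_triangle (T ` K) w"
  shows "lam_triangle K w"
proof -
  obtain S where S: "unimodular S" "\<And>z. S (T z) = z" "\<And>z. T (S z) = z"
    using unimodular_inverse[OF T] by blast
  obtain q0 q1 q2 where q: "\<not> collinear {q0, q1, q2}" "T ` K = convex hull {q0, q1, q2}"
      "lam w *\<^sub>R q1 + (1 - lam w) *\<^sub>R q2 \<in> Z2" "lam w *\<^sub>R q2 + (1 - lam w) *\<^sub>R q0 \<in> Z2"
      "lam w *\<^sub>R q0 + (1 - lam w) *\<^sub>R q1 \<in> Z2"
    using lt unfolding lam_triangle_def by blast
  have Z: "lam w *\<^sub>R S p + (1 - lam w) *\<^sub>R S q \<in> Z2" if "lam w *\<^sub>R p + (1 - lam w) *\<^sub>R q \<in> Z2" for p q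
    using that unimodular_Z2[OF S(1)] by (simp add: unimodular_affine_comb[OF S(1), symmetric])
  obtain a b c d e f where Se: "S = umap a b c d e f" using S(1) unimodular_cases by metis
  define L where "L z = (of_int a * fst z + of_int b * snd z, of_int c * fst z + of_int d * snd z)" for z :: "real \<times> real"
  have L: "linear L" unfolding L_def by (rule linearI) (auto simp: algebra_simps)
  have SL: "S = (\<lambda>z. (of_int e, of_int f) + L z)" by (auto simp: Se umap_def L_def fun_eq_iff)
  have "K = S ` (T ` K)" by (simp add: image_image S(2))
  also have "\<dots> = convex hull (S ` {q0, q1, q2})"
    unfolding q(2) SL
    by (simp only: image_image[symmetric, of _ L] convex_hull_linear_image[OF L, symmetric] convex_hull_translation)
  finally have K: "K = convex hull {S q0, S q1, S q2}" by simp
  obtain a b c d e f where det: "\<bar>a * d - b * c\<bar> = 1" and Se: "S = umap a b c d e f"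
    using S(1) by (rule unimodular_cases)
  have "cross2 (S q1 - S q0) (S q2 - S q0) = of_int (a * d - b * c) * cross2 (q1 - q0) (q2 - q0)"
    by (simp add: Se umap_def cross2_def algebra_simps)
  moreover have "real_of_int (a * d - b * c) \<noteq> 0" using det by (metis abs_0 of_int_eq_0_iff zero_neq_one)
  ultimately have "\<not> collinear {S q0, S q1, S q2}"
    using q(1) unfolding collinear_iff_cross2 by (simp del: of_int_diff of_int_mult)
  then show ?thesis unfolding lam_triangle_def using K Z q(3-5) by blast
qed

text \<open>Strictness on one side carries over because \<open>wide\<close> supplies an actual
  chord. This refutes w > 2 when a line is parallel to a side of the lattice triangle.\<close>

lemma lattice_wide_compare:
  assumes w: "wide K w" and ij: "\<bar>i\<bar> + \<bar>j\<bar> > (0::int)"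
    and r: "\<And>z. z \<in> K \<Longrightarrow> c < of_int i * fst z + of_int j * snd z" "\<And>z. z \<in> K \<Longrightarrow> of_int i * fst z + of_int j * snd z \<le> c + 2"
  shows "w < 2"
proof -
  obtain x y where xy: "x \<in> K" "y \<in> K" "w \<le> of_int i * (fst x - fst y) + of_int j * (snd x - snd y)"
    using wideD[OF w ij] by blast
  show ?thesis using xy(3) r(2)[OF xy(1)] r(1)[OF xy(2)] by (simp add: algebra_simps)
qed

text \<open>The degenerate sign pattern: one of the three lines is parallel to a side of the lattice triangle.\<close>

lemma parallel_side_aux:
  fixes u v t :: real
  assumes "u + v + t = 1" "0 \<le> A * u + B * v" "0 < B" "B < A" "0 \<le> C * t + D * u" "0 < C" "C < D"
  shows "- 1 < u"
proof (rule ccontr)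
  assume "\<not> - 1 < u"
  then have u: "u \<le> - 1" by simp
  have "B * (- u) < A * (- u)" using u assms by (intro mult_strict_right_mono) auto
  then have "B * (- u) < B * v" using assms(2) by simp
  then have v: "- u < v" using assms(3) by (simp only: mult_less_cancel_left_pos)
  have "C * (- u) < D * (- u)" using u assms by (intro mult_strict_right_mono) auto
  then have "C * (- u) < C * t" using assms(5) by simp
  then have "- u < t" using assms(6) by (simp only: mult_less_cancel_left_pos)
  then show False using v u assms(1) by linarith
qed

lemma pinwheel_bound:
  assumes J: "compact J" "convex J" "interior J \<noteq> {}" "wide J w" and w: "2 < w" "w \<le> 1 + 2 / sqrt 3"
    and pos: "0 < A0" "0 < B0" "0 < A1" "0 < B1" "0 < A2" "0 < B2" and le: "B0 \<le> A0" "B1 \<le> A1" "B2 \<le> A2"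
    and G: "\<And>z. z \<in> J \<Longrightarrow> 0 \<le> A0 * fst z + B0 * snd z"
      "\<And>z. z \<in> J \<Longrightarrow> 0 \<le> A1 * snd z + B1 * (1 - fst z - snd z)"
      "\<And>z. z \<in> J \<Longrightarrow> 0 \<le> A2 * (1 - fst z - snd z) + B2 * fst z"
  shows "ar J \<le> w / (2 * lam w) \<and> (ar J = w / (2 * lam w) \<longrightarrow> lam_triangle J w)"
proof (rule pinwheel_normal_form[OF J w, of "B0 / A0" "B1 / A1" "B2 / A2"])
  have div: "0 \<le> s + B / A * t" if "0 \<le> A * s + B * t" "0 < A" for A B s t :: real
  proof -
    have "s + B / A * t = (A * s + B * t) / A" using that(2) by (simp add: field_simps)
    then show ?thesis using that by simp
  qed
  fix z assume z: "z \<in> J"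
  show "0 \<le> fst z + B0 / A0 * snd z" "0 \<le> snd z + B1 / A1 * (1 - fst z - snd z)"
    "0 \<le> (1 - fst z - snd z) + B2 / A2 * fst z"
    using div[OF G(1)[OF z]] div[OF G(2)[OF z]] div[OF G(3)[OF z]] pos by blast+
qed (use pos le in auto)

text \<open>A and B are the slacks of a line at the two other lattice points, and comparing them
  tells which way the line is tilted. Either the three tilts agree cyclically, or one line is
  parallel to a side.\<close>

lemma triangle_bound:
  assumes K: "compact K" "convex K" "interior K \<noteq> {}" "wide K w" and w: "2 < w" "w \<le> 1 + 2 / sqrt 3"
    and Z: "z0 \<in> Z2" "z1 \<in> Z2" "z2 \<in> Z2" "\<bar>cross2 (z1 - z0) (z2 - z0)\<bar> = 1"
    and on: "a0 \<bullet> z0 = b0" "a1 \<bullet> z1 = b1" "a2 \<bullet> z2 = b2"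
    and lines: "\<And>x. x \<in> K \<Longrightarrow> a0 \<bullet> x \<le> b0" "\<And>x. x \<in> K \<Longrightarrow> a1 \<bullet> x \<le> b1" "\<And>x. x \<in> K \<Longrightarrow> a2 \<bullet> x \<le> b2"
    and strict: "a0 \<bullet> z1 < b0" "a0 \<bullet> z2 < b0" "a1 \<bullet> z2 < b1" "a1 \<bullet> z0 < b1" "a2 \<bullet> z0 < b2" "a2 \<bullet> z1 < b2"
    and cover: "\<And>z. z \<in> Z2 \<Longrightarrow> b0 \<le> a0 \<bullet> z \<or> b1 \<le> a1 \<bullet> z \<or> b2 \<le> a2 \<bullet> z"
  shows "ar K \<le> w / (2 * lam w) \<and> (ar K = w / (2 * lam w) \<longrightarrow> lam_triangle K w)"
proof -
  obtain T where T: "unimodular T" "T z0 = (0, 0)" "T z1 = (1, 0)" "T z2 = (0, 1)"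
    using lattice_triangle_normal_form[OF Z] by blast
  define J where "J = T ` K"
  have J: "compact J" "convex J" "wide J w"
    using compact_unimodular convex_unimodular wide_unimodular T(1) K by (auto simp: J_def)
  have Ji: "interior J \<noteq> {}" using interior_unimodular[OF T(1), of K] K(3) by (simp add: J_def)
  define A0 B0 where "A0 = b0 - a0 \<bullet> z1" and "B0 = b0 - a0 \<bullet> z2"
  define A1 B1 where "A1 = b1 - a1 \<bullet> z2" and "B1 = b1 - a1 \<bullet> z0"
  define A2 B2 where "A2 = b2 - a2 \<bullet> z0" and "B2 = b2 - a2 \<bullet> z1"
  have pos: "0 < A0" "0 < B0" "0 < A1" "0 < B1" "0 < A2" "0 < B2"
    using strict by (simp_all add: A0_def B0_def A1_def B1_def A2_def B2_def)
  have G: "0 \<le> A0 * fst y + B0 * snd y" "0 \<le> A1 * snd y + B1 * (1 - fst y - snd y)"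
    "0 \<le> A2 * (1 - fst y - snd y) + B2 * fst y" if y: "y \<in> J" for y
  proof -
    obtain z where z: "z \<in> K" "y = T z" using y by (auto simp: J_def)
    show "0 \<le> A0 * fst y + B0 * snd y" "0 \<le> A1 * snd y + B1 * (1 - fst y - snd y)"
      "0 \<le> A2 * (1 - fst y - snd y) + B2 * fst y"
      using lines[OF z(1)] lattice_affine_functional[OF T, of b0 a0 z] lattice_affine_functional[OF T, of b1 a1 z]
        lattice_affine_functional[OF T, of b2 a2 z] on
      by (simp_all add: A0_def B0_def A1_def B1_def A2_def B2_def z(2))
  qed
  \<comment> \<open>The reflection of z0 in the midpoint of z1 and z2 has slack A0 + B0 > 0 for the
    first line, so one of the other two lines must exclude it.\<close>
  have n0: "A1 \<le> B1 \<or> B2 \<le> A2"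
    using cover[of "z1 + z2 - z0"] Z pos on Z2_add Z2_diff
    by (auto simp: A0_def B0_def A1_def B1_def A2_def B2_def inner_add_right inner_diff_right)
  have n1: "A2 \<le> B2 \<or> B0 \<le> A0"
    using cover[of "z2 + z0 - z1"] Z pos on Z2_add Z2_diff
    by (auto simp: A0_def B0_def A1_def B1_def A2_def B2_def inner_add_right inner_diff_right)
  have n2: "A0 \<le> B0 \<or> B1 \<le> A1"
    using cover[of "z0 + z1 - z2"] Z pos on Z2_add Z2_diff
    by (auto simp: A0_def B0_def A1_def B1_def A2_def B2_def inner_add_right inner_diff_right)
  consider "B0 \<le> A0 \<and> B1 \<le> A1 \<and> B2 \<le> A2" | "A0 \<le> B0 \<and> A1 \<le> B1 \<and> A2 \<le> B2"
    | "B0 < A0 \<and> A1 = B1 \<and> A2 < B2" | "B1 < A1 \<and> A2 = B2 \<and> A0 < B0" | "B2 < A2 \<and> A0 = B0 \<and> A1 < B1"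
    using n0 n1 n2 by linarith
  then have "ar J \<le> w / (2 * lam w) \<and> (ar J = w / (2 * lam w) \<longrightarrow> lam_triangle J w)"
  proof cases
    case 1
    then show ?thesis by (intro pinwheel_bound[OF J(1,2) Ji J(3) w pos _ _ _ G]) auto
  next
    case 2
    \<comment> \<open>Swapping the coordinates reverses the cyclic order: A and B change roles, and
      so do the last two lines.\<close>
    define R where "R = umap 0 1 1 0 0 0"
    have R: "unimodular R" unfolding R_def by (intro unimodular_umap) simp
    have fR: "fst (R z) = snd z" "snd (R z) = fst z" for z by (simp_all add: R_def umap_def)
    have "ar (R ` J) \<le> w / (2 * lam w) \<and> (ar (R ` J) = w / (2 * lam w) \<longrightarrow> lam_triangle (R ` J) w)"
    proof (rule pinwheel_bound[OF _ _ _ _ w pos(2,1,6,5,4,3)])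
      show "compact (R ` J)" "convex (R ` J)" "wide (R ` J) w"
        using compact_unimodular convex_unimodular wide_unimodular R J by auto
      show "interior (R ` J) \<noteq> {}" using interior_unimodular[OF R, of J] Ji by simp
      fix y assume "y \<in> R ` J"
      then obtain z where z: "z \<in> J" "y = R z" by blast
      show "0 \<le> B0 * fst y + A0 * snd y" "0 \<le> B2 * snd y + A2 * (1 - fst y - snd y)"
        "0 \<le> B1 * (1 - fst y - snd y) + A1 * fst y"
        using G[OF z(1)] by (simp_all add: z(2) fR algebra_simps)
    qed (use 2 in auto)
    then show ?thesis using lam_triangle_image[OF R, of J w] unfolding ar_unimodular[OF R J(1)] by blast
  next
    case 3
    \<comment> \<open>The line through (1, 0) is x = 1 here, and the other two lines keep K strictly
      to the right of x = -1.\<close>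
    have "w < 2"
    proof (rule lattice_wide_compare[OF J(3), of 1 0 "-1"])
      fix y assume y: "y \<in> J"
      show "- 1 < of_int 1 * fst y + of_int 0 * snd y"
        using parallel_side_aux[of "fst y" "snd y" "1 - fst y - snd y" A0 B0 A2 B2] G[OF y] 3 pos by simp
      have "0 \<le> A1 * (1 - fst y)" using G(2)[OF y] 3 by (simp add: algebra_simps)
      then show "of_int 1 * fst y + of_int 0 * snd y \<le> - 1 + 2" using pos by (simp add: zero_le_mult_iff)
    qed simp
    then show ?thesis using w by simp
  next
    case 4
    have "w < 2"
    proof (rule lattice_wide_compare[OF J(3), of 0 1 "-1"])
      fix y assume y: "y \<in> J"
      show "- 1 < of_int 0 * fst y + of_int 1 * snd y"
        using parallel_side_aux[of "snd y" "1 - fst y - snd y" "fst y" A1 B1 A0 B0] G[OF y] 4 pos by simp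
      have "0 \<le> A2 * (1 - snd y)" using G(3)[OF y] 4 by (simp add: algebra_simps)
      then show "of_int 0 * fst y + of_int 1 * snd y \<le> - 1 + 2" using pos by (simp add: zero_le_mult_iff)
    qed simp
    then show ?thesis using w by simp
  next
    case 5
    have "w < 2"
    proof (rule lattice_wide_compare[OF J(3), of "-1" "-1" "-2"])
      fix y assume y: "y \<in> J"
      show "- 2 < of_int (- 1) * fst y + of_int (- 1) * snd y"
        using parallel_side_aux[of "1 - fst y - snd y" "fst y" "snd y" A2 B2 A1 B1] G[OF y] 5 pos by simp
      have "0 \<le> A0 * (fst y + snd y)" using G(1)[OF y] 5 by (simp add: algebra_simps)
      then have "0 \<le> fst y + snd y" using pos by (simp add: zero_le_mult_iff)
      then show "of_int (- 1) * fst y + of_int (- 1) * snd y \<le> - 2 + 2" by simp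
    qed simp
    then show ?thesis using w by simp
  qed
  then show ?thesis
    using lam_triangle_image[OF T(1), of K w] unfolding J_def ar_unimodular[OF T(1) K(1)] by blast
qed

section \<open>Covers of the lattice by halfplanes\<close>

text \<open>Indexing by numbers below n allows the least n to be taken and a single offset to be
  changed by a function update. Lattice points may lie on the boundary lines, hence the weak
  inequality.\<close>

definition cover :: "(real \<times> real) set \<Rightarrow> nat \<Rightarrow> (nat \<Rightarrow> real \<times> real) \<Rightarrow> (nat \<Rightarrow> real) \<Rightarrow> bool" where
  "cover K n a b \<longleftrightarrow> (\<forall>i<n. a i \<noteq> 0 \<and> (\<forall>x\<in>K. a i \<bullet> x \<le> b i)) \<and> (\<forall>z\<in>Z2. \<exists>i<n. b i \<le> a i \<bullet> z)"

text \<open>Finitely many lattice points near K are cut off one by one by separating lines; the four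
  sides of a box around K dispose of the rest.\<close>

lemma cover_exists:
  assumes K: "compact K" "convex K" "interior K \<noteq> {}" "interior K \<inter> Z2 = {}"
  shows "\<exists>n a b. cover K n a b"
proof -
  obtain R where R: "\<And>x. x \<in> K \<Longrightarrow> norm x \<le> R"
    using compact_imp_bounded[OF K(1)] by (auto simp: bounded_iff)
  \<comment> \<open>Beyond norm 2 R some coordinate exceeds R in absolute value, because the norm is
    at most the sum of both.\<close>
  define F where "F = {z \<in> Z2. norm z \<le> 2 * R}"
  have "\<exists>a. a \<noteq> 0 \<and> (\<forall>x\<in>K. a \<bullet> x \<le> a \<bullet> z)" if "z \<in> Z2" for z
  proof -
    have "z \<notin> interior K" using K(4) that by blast
    then obtain a where "a \<noteq> 0" "\<And>x. x \<in> K \<Longrightarrow> 0 \<le> a \<bullet> (x - z)"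
      using separating_point_interior[OF K(2,3)] by blast
    then show ?thesis by (intro exI[of _ "- a"]) (auto simp: inner_diff_right)
  qed
  then obtain s where s: "\<And>z. z \<in> Z2 \<Longrightarrow> s z \<noteq> 0" "\<And>z x. z \<in> Z2 \<Longrightarrow> x \<in> K \<Longrightarrow> s z \<bullet> x \<le> s z \<bullet> z"
    by metis
  define G where "G = (\<lambda>z. (s z, s z \<bullet> z)) ` F \<union> {((1,0), R), ((-1,0), R), ((0,1), R), ((0,-1), R)}"
  have "finite G" unfolding G_def F_def by (simp add: finite_Z2_bounded)
  then obtain L where L: "set L = G" using finite_list by blast
  have GK: "a \<noteq> 0 \<and> (\<forall>x\<in>K. a \<bullet> x \<le> b)" if "(a, b) \<in> G" for a b
  proof -
    have coord: "\<bar>fst x\<bar> \<le> R \<and> \<bar>snd x\<bar> \<le> R" if "x \<in> K" for x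
      using R[OF that] norm_fst_le[of "fst x" "snd x"] norm_snd_le[of "snd x" "fst x"] by auto
    show ?thesis using that coord s unfolding G_def F_def
      by (fastforce simp: inner_prod_def zero_prod_def abs_le_iff)
  qed
  have GZ: "\<exists>(a, b)\<in>G. b \<le> a \<bullet> z" if z: "z \<in> Z2" for z
  proof (cases "z \<in> F")
    case True
    then show ?thesis unfolding G_def by (intro bexI[of _ "(s z, s z \<bullet> z)"]) auto
  next
    case False
    then have "2 * R < norm z" using z by (simp add: F_def)
    moreover have "norm z \<le> \<bar>fst z\<bar> + \<bar>snd z\<bar>"
      using norm_Pair_le[of "fst z" "snd z"] by simp
    ultimately have "R \<le> fst z \<or> R \<le> - fst z \<or> R \<le> snd z \<or> R \<le> - snd z" by linarith
    then show ?thesis unfolding G_def by (auto simp: inner_prod_def)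
  qed
  have "cover K (length L) (\<lambda>i. fst (L ! i)) (\<lambda>i. snd (L ! i))"
    unfolding cover_def
  proof (intro conjI allI impI ballI)
    fix i assume "i < length L"
    then have "(fst (L ! i), snd (L ! i)) \<in> G" using L nth_mem by force
    from GK[OF this] show "fst (L ! i) \<noteq> 0" "\<And>x. x \<in> K \<Longrightarrow> fst (L ! i) \<bullet> x \<le> snd (L ! i)" by auto
  next
    fix z assume "z \<in> Z2"
    then obtain a b where "(a, b) \<in> set L" "b \<le> a \<bullet> z" using GZ L by blast
    then show "\<exists>i<length L. snd (L ! i) \<le> fst (L ! i) \<bullet> z" by (auto simp: in_set_conv_nth)
  qed
  then show ?thesis by blast
qed

definition polyhedron_of :: "nat \<Rightarrow> (nat \<Rightarrow> real \<times> real) \<Rightarrow> (nat \<Rightarrow> real) \<Rightarrow> (real \<times> real) set" where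
  "polyhedron_of n a b = {x. \<forall>i<n. a i \<bullet> x \<le> b i}"

lemma closed_polyhedron_of: "closed (polyhedron_of n a b)"
proof -
  have "polyhedron_of n a b = (\<Inter>i\<in>{..<n}. {x. a i \<bullet> x \<le> b i})" by (auto simp: polyhedron_of_def)
  then show ?thesis by (simp add: closed_INT closed_halfspace_le)
qed

lemma convex_polyhedron_of: "convex (polyhedron_of n a b)"
proof -
  have "polyhedron_of n a b = (\<Inter>i\<in>{..<n}. {x. a i \<bullet> x \<le> b i})" by (auto simp: polyhedron_of_def)
  then show ?thesis by (simp add: convex_INT convex_halfspace_le)
qed

lemma wide_not_in_split:
  assumes "wide K w" "1 < w" "is_split S" "K \<subseteq> S"
  shows False
proof -
  obtain a1 a2 b :: int where ab: "coprime a1 a2" "S = {x. of_int b \<le> of_int a1 * fst x + of_int a2 * snd x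
              \<and> of_int a1 * fst x + of_int a2 * snd x \<le> of_int b + 1}"
    using assms(3) unfolding is_split_def by blast
  have "\<bar>a1\<bar> + \<bar>a2\<bar> > 0" using ab(1) by (cases "a1 = 0") auto
  then obtain x y where "x \<in> K" "y \<in> K" "w \<le> of_int a1 * (fst x - fst y) + of_int a2 * (snd x - snd y)"
    using wideD[OF assms(1)] by blast
  moreover have "x \<in> S" "y \<in> S" using \<open>x \<in> K\<close> \<open>y \<in> K\<close> assms(4) by auto
  ultimately show False using assms(2) by (simp add: ab(2) algebra_simps)
qed

lemma cover_excludes:
  assumes "cover K n a b" "z \<in> Z2"
  obtains i where "i < n" "b i \<le> a i \<bullet> z"
proof -
  have "\<exists>i<n. b i \<le> a i \<bullet> z" using assms by (simp add: cover_def)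
  with that show thesis by blast
qed

lemma cover_subset: "cover K n a b \<Longrightarrow> K \<subseteq> polyhedron_of n a b"
  by (auto simp: cover_def polyhedron_of_def)

text \<open>The interior of the polyhedron is lattice-free, so if unbounded it would lie in a split,
  against w > 1. Boundedness leaves only finitely many lattice points below a given level when a
  halfplane is pushed.\<close>

lemma cover_bounded:
  assumes K: "interior K \<noteq> {}" "wide K w" "1 < w" and cov: "cover K n a b"
  shows "bounded (polyhedron_of n a b)"
proof (rule ccontr)
  assume nb: "\<not> bounded (polyhedron_of n a b)"
  let ?P = "polyhedron_of n a b"
  have KP: "K \<subseteq> ?P" by (rule cover_subset[OF cov])
  have "interior ?P \<inter> Z2 = {}"
  proof (rule ccontr)
    assume "interior ?P \<inter> Z2 \<noteq> {}"
    then obtain z where z: "z \<in> interior ?P" "z \<in> Z2" by blast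
    obtain i where i: "i < n" "b i \<le> a i \<bullet> z" by (rule cover_excludes[OF cov z(2)])
    have "a i \<noteq> 0" using cov i by (auto simp: cover_def)
    moreover have "interior ?P \<subseteq> interior {x. a i \<bullet> x \<le> b i}"
      using i by (intro interior_mono) (auto simp: polyhedron_of_def)
    ultimately have "a i \<bullet> z < b i" using z interior_halfspace_le[of "a i" "b i"] by auto
    then show False using i by simp
  qed
  moreover have "interior ?P \<noteq> {}" using interior_mono[OF KP] K(1) by blast
  ultimately obtain S where "is_split S" "?P \<subseteq> S"
    using unbounded_lattice_free_split[OF closed_polyhedron_of convex_polyhedron_of nb] by blast
  then show False using wide_not_in_split[OF K(2,3)] KP by blast
qed

lemma bounded_polyhedron_no_ray:
  assumes "bounded (polyhedron_of n a b)" and y: "y \<in> polyhedron_of n a b" and ar: "\<And>i. i < n \<Longrightarrow> a i \<bullet> r \<le> 0"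
  shows "r = 0"
proof (rule ccontr)
  assume r0: "r \<noteq> 0"
  obtain B where B: "\<And>x. x \<in> polyhedron_of n a b \<Longrightarrow> norm x \<le> B"
    using assms(1) by (auto simp: bounded_iff)
  define t where "t = (B + norm y + 1) / norm r"
  have B0: "0 \<le> B + norm y + 1" using B[OF y] norm_ge_zero[of y] by linarith
  then have "0 \<le> t" unfolding t_def by (intro divide_nonneg_nonneg) auto
  have "a i \<bullet> y + t * (a i \<bullet> r) \<le> b i" if "i < n" for i
    using y that mult_nonneg_nonpos[OF \<open>0 \<le> t\<close> ar[OF that]] by (fastforce simp: polyhedron_of_def)
  then have "norm (y + t *\<^sub>R r) \<le> B" by (intro B) (simp add: polyhedron_of_def inner_add_right)
  moreover have "norm (t *\<^sub>R r) \<le> norm (y + t *\<^sub>R r) + norm y"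
    using norm_triangle_ineq4[of "y + t *\<^sub>R r" y] by simp
  moreover have "norm (t *\<^sub>R r) = B + norm y + 1"
    using r0 B0 by (simp add: t_def abs_of_nonneg)
  ultimately show False by simp
qed

text \<open>Directions of recession depend on the normals alone: the condition
  \<open>a i \<bullet> r \<le> 0\<close> does not involve the offsets.\<close>

lemma bounded_polyhedron_relax:
  assumes "bounded (polyhedron_of n a b)" "polyhedron_of n a b \<noteq> {}"
  shows "bounded (polyhedron_of n a b')"
proof (rule ccontr)
  assume nb: "\<not> bounded (polyhedron_of n a b')"
  obtain r where r: "norm r = 1" "\<And>x t. x \<in> polyhedron_of n a b' \<Longrightarrow> 0 \<le> t \<Longrightarrow> x + t *\<^sub>R r \<in> polyhedron_of n a b'"
    using unbounded_convex_ray[OF closed_polyhedron_of convex_polyhedron_of nb] by blast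
  have "polyhedron_of n a b' \<noteq> {}" using nb by auto
  then obtain x where x: "x \<in> polyhedron_of n a b'" by blast
  have ar: "a i \<bullet> r \<le> 0" if i: "i < n" for i
  proof (rule ccontr)
    assume n: "\<not> a i \<bullet> r \<le> 0"
    define t where "t = (b' i - a i \<bullet> x) / (a i \<bullet> r) + 1"
    have "a i \<bullet> x \<le> b' i" using x i by (auto simp: polyhedron_of_def)
    then have "0 \<le> t" using n by (simp add: t_def)
    then have "a i \<bullet> (x + t *\<^sub>R r) \<le> b' i" using r(2)[OF x] i by (auto simp: polyhedron_of_def)
    moreover have "t * (a i \<bullet> r) = b' i - a i \<bullet> x + a i \<bullet> r" using n by (simp add: t_def distrib_right)
    ultimately show False using n by (simp add: inner_add_right)
  qed
  obtain y where y: "y \<in> polyhedron_of n a b" using assms(2) by blast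
  show False using bounded_polyhedron_no_ray[OF assms(1) y ar] r(1) by force
qed

text \<open>The last halfplane moves into slot k, so that the remaining ones are again numbered
  below n.\<close>

lemma cover_drop:
  assumes cov: "cover K (Suc n) a b" and k: "k \<le> n"
    and un: "\<And>z. z \<in> Z2 \<Longrightarrow> \<exists>i<Suc n. i \<noteq> k \<and> b i \<le> a i \<bullet> z"
  shows "cover K n (a(k := a n)) (b(k := b n))"
  unfolding cover_def
proof (intro conjI allI impI ballI)
  fix i assume "i < n"
  then show "(a(k := a n)) i \<noteq> 0" using cov k by (auto simp: cover_def)
  show "(a(k := a n)) i \<bullet> x \<le> (b(k := b n)) i" if "x \<in> K" for x
    using that \<open>i < n\<close> cov k by (auto simp: cover_def)
next
  fix z assume "z \<in> Z2"
  then obtain i where i: "i < Suc n" "i \<noteq> k" "b i \<le> a i \<bullet> z" using un by blast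
  show "\<exists>i<n. (b(k := b n)) i \<le> (a(k := a n)) i \<bullet> z"
  proof (cases "i = n")
    case True
    then show ?thesis using i k by (intro exI[of _ k]) auto
  next
    case False
    then show ?thesis using i by (intro exI[of _ i]) auto
  qed
qed

text \<open>In a cover with as few halfplanes as possible every halfplane is the only one to exclude some
  lattice point, so it can be pushed outwards until its boundary meets the first such point.\<close>

lemma pushed_cover:
  assumes K: "interior K \<noteq> {}" "wide K w" "1 < w" and cov: "cover K n a b0"
    and min: "\<And>m a' b'. m < n \<Longrightarrow> \<not> cover K m a' b'"
  shows "k \<le> n \<Longrightarrow> \<exists>b. cover K n a b \<and> (\<forall>i<k. \<exists>z\<in>Z2. a i \<bullet> z = b i \<and> (\<forall>j<n. j \<noteq> i \<longrightarrow> a j \<bullet> z < b j))"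
proof (induction k)
  case 0
  then show ?case using cov by auto
next
  case (Suc k)
  then obtain b where b: "cover K n a b"
    and pushed: "\<And>i. i < k \<Longrightarrow> \<exists>z\<in>Z2. a i \<bullet> z = b i \<and> (\<forall>j<n. j \<noteq> i \<longrightarrow> a j \<bullet> z < b j)" by auto
  have kn: "k < n" using Suc.prems by simp
  \<comment> \<open>The lattice points that no halfplane other than k excludes. If there were none,
    k could be dropped.\<close>
  define F where "F = {z \<in> Z2. \<forall>j<n. j \<noteq> k \<longrightarrow> a j \<bullet> z < b j}"
  have "F \<noteq> {}"
  proof
    assume "F = {}"
    have "\<exists>i<n. i \<noteq> k \<and> b i \<le> a i \<bullet> z" if z: "z \<in> Z2" for z
    proof -
      have "z \<notin> F" using \<open>F = {}\<close> by blast
      then show ?thesis using z by (simp add: F_def not_less)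
    qed
    then have "cover K (n - 1) (a(k := a (n - 1))) (b(k := b (n - 1)))"
      using cover_drop[of K "n - 1" a b k] b kn by simp
    moreover have "n - 1 < n" using kn by simp
    ultimately show False using min by blast
  qed
  then obtain z1 where z1: "z1 \<in> F" by blast
  \<comment> \<open>Cutting at the level of z1 leaves finitely many candidates, so a lowest one
    exists.\<close>
  define F1 where "F1 = {z \<in> F. a k \<bullet> z \<le> a k \<bullet> z1}"
  have KP: "polyhedron_of n a b \<noteq> {}"
    using K(1) cover_subset[OF b] interior_subset by blast
  have "bounded (polyhedron_of n a (b(k := a k \<bullet> z1)))"
    by (rule bounded_polyhedron_relax[OF cover_bounded[OF K b] KP])
  then obtain B where B: "\<And>x. x \<in> polyhedron_of n a (b(k := a k \<bullet> z1)) \<Longrightarrow> norm x \<le> B" by (auto simp: bounded_iff)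
  have "F1 \<subseteq> {z \<in> Z2. norm z \<le> B}"
  proof
    fix z assume z: "z \<in> F1"
    then have "z \<in> polyhedron_of n a (b(k := a k \<bullet> z1))"
      by (auto simp: F1_def F_def polyhedron_of_def less_imp_le)
    then show "z \<in> {z \<in> Z2. norm z \<le> B}" using z B by (simp add: F1_def F_def)
  qed
  then have "finite F1" using finite_Z2_bounded finite_subset by blast
  moreover have "z1 \<in> F1" using z1 by (simp add: F1_def)
  ultimately obtain zm where zm: "zm \<in> F1" "\<And>z. z \<in> F1 \<Longrightarrow> a k \<bullet> zm \<le> a k \<bullet> z"
    using arg_min_if_finite(1)[of F1 "\<lambda>z. a k \<bullet> z"] arg_min_least[of F1 _ "\<lambda>z. a k \<bullet> z"] by blast
  have zmin: "a k \<bullet> zm \<le> a k \<bullet> z" if "z \<in> F" for z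
    using zm(2)[of z] zm(1) that by (cases "a k \<bullet> z \<le> a k \<bullet> z1") (auto simp: F1_def)
  have zmF: "zm \<in> Z2" "\<And>j. j < n \<Longrightarrow> j \<noteq> k \<Longrightarrow> a j \<bullet> zm < b j" using zm(1) by (auto simp: F1_def F_def)
  \<comment> \<open>The offset can only grow, so the strict inequalities for the points chosen
    earlier remain valid.\<close>
  have bk: "b k \<le> a k \<bullet> zm"
  proof -
    obtain i where "i < n" "b i \<le> a i \<bullet> zm" by (rule cover_excludes[OF b zmF(1)])
    then show ?thesis using zmF(2)[of i] by (cases "i = k") auto
  qed
  define b' where "b' = b(k := a k \<bullet> zm)"
  have b'_ge: "b i \<le> b' i" for i using bk by (simp add: b'_def)
  have "cover K n a b'"
    unfolding cover_def
  proof (intro conjI allI impI ballI)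
    fix i assume "i < n"
    then show "a i \<noteq> 0" using b by (auto simp: cover_def)
    show "a i \<bullet> x \<le> b' i" if "x \<in> K" for x
      using b \<open>i < n\<close> that b'_ge[of i] by (fastforce simp: cover_def)
  next
    fix z assume z: "z \<in> Z2"
    show "\<exists>i<n. b' i \<le> a i \<bullet> z"
    proof (cases "z \<in> F")
      case True
      then show ?thesis using zmin kn by (intro exI[of _ k]) (simp add: b'_def)
    next
      case False
      then obtain j where "j < n" "j \<noteq> k" "b j \<le> a j \<bullet> z" using z by (auto simp: F_def not_less)
      then show ?thesis by (intro exI[of _ j]) (simp add: b'_def)
    qed
  qed
  moreover have "\<exists>z\<in>Z2. a i \<bullet> z = b' i \<and> (\<forall>j<n. j \<noteq> i \<longrightarrow> a j \<bullet> z < b' j)" if i: "i < Suc k" for i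
  proof (cases "i = k")
    case True
    then show ?thesis using zmF by (intro bexI[of _ zm]) (auto simp: b'_def)
  next
    case False
    then have "i < k" using i by simp
    then obtain z where z: "z \<in> Z2" "a i \<bullet> z = b i" "\<And>j. j < n \<Longrightarrow> j \<noteq> i \<Longrightarrow> a j \<bullet> z < b j" using pushed by blast
    show ?thesis
    proof (rule bexI[OF _ z(1)], intro conjI allI impI)
      show "a i \<bullet> z = b' i" using z(2) False by (simp add: b'_def)
      show "a j \<bullet> z < b' j" if "j < n" "j \<noteq> i" for j using z(3)[OF that] b'_ge[of j] by simp
    qed
  qed
  ultimately show ?case by blast
qed

lemma covering_points:
  assumes K: "compact K" "convex K" "interior K \<noteq> {}" "interior K \<inter> Z2 = {}" "wide K w" "1 < w"
  obtains n a b z where "3 \<le> n" "n \<le> 4" "cover K n a b" "\<And>i. i < n \<Longrightarrow> z i \<in> Z2" "\<And>i. i < n \<Longrightarrow> a i \<bullet> z i = b i"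
    "\<And>i j. i < n \<Longrightarrow> j < n \<Longrightarrow> i \<noteq> j \<Longrightarrow> a j \<bullet> z i < b j"
proof -
  define n where "n = (LEAST n. \<exists>a b. cover K n a b)"
  have "\<exists>a b. cover K n a b"
    unfolding n_def using cover_exists[OF K(1-4)] by (rule LeastI_ex)
  then obtain a b0 where ab0: "cover K n a b0" by blast
  have min: "\<not> cover K m a' b'" if "m < n" for m a' b'
    using that not_less_Least unfolding n_def by blast
  obtain b where b: "cover K n a b"
    and "\<And>i. i < n \<Longrightarrow> \<exists>z\<in>Z2. a i \<bullet> z = b i \<and> (\<forall>j<n. j \<noteq> i \<longrightarrow> a j \<bullet> z < b j)"
    using pushed_cover[OF K(3,5,6) ab0 min, of n] by blast
  then obtain z where z: "\<And>i. i < n \<Longrightarrow> z i \<in> Z2" "\<And>i. i < n \<Longrightarrow> a i \<bullet> z i = b i"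
    "\<And>i j. i < n \<Longrightarrow> j < n \<Longrightarrow> j \<noteq> i \<Longrightarrow> a j \<bullet> z i < b j" by metis
  have "3 \<le> n"
  proof (rule ccontr)
    assume "\<not> 3 \<le> n"
    then have n2: "n \<le> 2" by simp
    \<comment> \<open>A vector orthogonal to the first normal, with its sign chosen against the
      second, would be a direction of recession; for n = 0 any nonzero vector is one.\<close>
    define p where "p = (if n = 0 then (1, 0) else (- snd (a 0), fst (a 0)))"
    have p0: "p \<noteq> 0"
    proof (cases "n = 0")
      case False
      then have "a 0 \<noteq> 0" using b by (auto simp: cover_def)
      then show ?thesis using False by (auto simp: p_def prod_eq_iff)
    qed (simp add: p_def zero_prod_def)
    define r where "r = (if a 1 \<bullet> p \<le> 0 then p else - p)"
    have r0: "r \<noteq> 0" using p0 by (simp add: r_def)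
    have ar: "a i \<bullet> r \<le> 0" if "i < n" for i
    proof -
      have "i = 0 \<or> i = 1" using that n2 by linarith
      then show ?thesis
      proof
        assume "i = 0"
        then have "a i \<bullet> p = 0" using that by (simp add: p_def inner_prod_def)
        then show ?thesis by (simp add: r_def)
      next
        assume "i = 1"
        then show ?thesis by (simp add: r_def)
      qed
    qed
    obtain y where y: "y \<in> polyhedron_of n a b"
      using K(3) cover_subset[OF b] interior_subset by blast
    show False using bounded_polyhedron_no_ray[OF cover_bounded[OF K(3,5,6) b] y ar] r0 by blast
  qed
  moreover have "n \<le> 4"
  proof -
    define f where "f i = (even \<lfloor>fst (z i)\<rfloor>, even \<lfloor>snd (z i)\<rfloor>)" for i
    have "inj_on f {..<n}"
    proof (rule inj_onI, rule ccontr)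
      fix i j assume ij: "i \<in> {..<n}" "j \<in> {..<n}" "f i = f j" "i \<noteq> j"
      obtain x1 y1 where zi: "z i = (of_int x1, of_int y1)" using z(1)[of i] ij by (auto elim: Z2_cases)
      obtain x2 y2 where zj: "z j = (of_int x2, of_int y2)" using z(1)[of j] ij by (auto elim: Z2_cases)
      have "even (x1 + x2)" "even (y1 + y2)" using ij(3) by (auto simp: f_def zi zj)
      then obtain x y where xy: "x1 + x2 = 2 * x" "y1 + y2 = 2 * y" by (metis evenE)
      have m: "2 *\<^sub>R (real_of_int x, real_of_int y) = z i + z j"
        using xy by (simp add: zi zj flip: of_int_add)
      have "(real_of_int x, real_of_int y) \<in> Z2" by simp
      then obtain l where l: "l < n" "b l \<le> a l \<bullet> (real_of_int x, real_of_int y)"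
        using cover_excludes[OF b] by blast
      have "2 * (a l \<bullet> (real_of_int x, real_of_int y)) = a l \<bullet> z i + a l \<bullet> z j"
        using arg_cong[OF m, of "\<lambda>v. a l \<bullet> v"] by (simp only: inner_scaleR_right inner_add_right)
      \<comment> \<open>At least one of the two points lies strictly inside halfplane l, and neither
        lies outside, so the midpoint is strictly inside.\<close>
      moreover have "a l \<bullet> z i \<le> b l \<and> a l \<bullet> z j \<le> b l \<and> (a l \<bullet> z i < b l \<or> a l \<bullet> z j < b l)"
        using z(2)[of i] z(2)[of j] z(3)[of i l] z(3)[of j l] ij l(1) by (cases "l = i"; cases "l = j") auto
      ultimately show False using l(2) by linarith
    qed
    then have "card {..<n} \<le> card (UNIV :: (bool \<times> bool) set)" by (intro card_inj_on_le[of f]) auto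
    then show ?thesis by (simp add: card_UNIV_bool flip: UNIV_Times_UNIV add: card_cartesian_product)
  qed
  ultimately show thesis using that b z by blast
qed

text \<open>A lattice point of the triangle is excluded by some halfplane l, while all corners
  satisfy it, strictly except for \<open>z l\<close>. So its whole weight sits on that corner, and
  the triangle is empty.\<close>

lemma pushed_points_unimodular:
  assumes cov: "cover K n a b" and z: "\<And>i. i < n \<Longrightarrow> z i \<in> Z2" "\<And>i. i < n \<Longrightarrow> a i \<bullet> z i = b i"
    "\<And>i j. i < n \<Longrightarrow> j < n \<Longrightarrow> i \<noteq> j \<Longrightarrow> a j \<bullet> z i < b j"
    and ijk: "i < n" "j < n" "k < n" "i \<noteq> j" "i \<noteq> k" "j \<noteq> k"
  shows "\<bar>cross2 (z j - z i) (z k - z i)\<bar> = 1"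
proof (rule empty_lattice_triangle)
  show "z i \<in> Z2" "z j \<in> Z2" "z k \<in> Z2" using z(1) ijk by auto
  have le: "a l \<bullet> z m \<le> b l" if "l < n" "m < n" for l m
    using z(2)[of l] z(3)[of m l] that by (cases "l = m") auto
  \<comment> \<open>No chosen point lies between two others, because it would then be strictly
    inside its own halfplane.\<close>
  have btw: False if "l < n" "p < n" "q < n" "p \<noteq> l" "q \<noteq> l" "0 \<le> s" "s \<le> 1" "z l = (1 - s) *\<^sub>R z p + s *\<^sub>R z q" for l p q s
  proof -
    have "b l = (1 - s) * (a l \<bullet> z p) + s * (a l \<bullet> z q)"
      using z(2)[OF that(1)] arg_cong[OF that(8), of "\<lambda>v. a l \<bullet> v"] by (simp add: inner_add_right)
    moreover have "a l \<bullet> z p < b l" "a l \<bullet> z q < b l" using z(3) that by auto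
    ultimately show False
      using convex_bound_lt[of "a l \<bullet> z p" "b l" "a l \<bullet> z q" "1 - s" s] that by simp
  qed
  show "cross2 (z j - z i) (z k - z i) \<noteq> 0"
  proof
    assume c0: "cross2 (z j - z i) (z k - z i) = 0"
    have "z j - z i \<noteq> 0"
    proof
      assume "z j - z i = 0"
      then have "z j = z i" by simp
      then show False using z(2)[OF ijk(1)] z(3)[OF ijk(2,1)] ijk by simp
    qed
    then obtain c where c: "z k - z i = c *\<^sub>R (z j - z i)" using cross2_zero_parallel[OF c0] by blast
    then have zk: "z k = (1 - c) *\<^sub>R z i + c *\<^sub>R z j" by (simp add: algebra_simps)
    \<comment> \<open>The three cases tell which point is in the middle: \<open>z i\<close>,
      \<open>z k\<close> or \<open>z j\<close>.\<close>
    consider "c < 0" | "0 \<le> c" "c \<le> 1" | "1 < c" by linarith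
    then show False
    proof cases
      case 1
      define s where "s = 1 / (1 - c)"
      have s: "0 \<le> s" "s \<le> 1" "s * (1 - c) = 1" using 1 by (auto simp: s_def)
      have "s *\<^sub>R z k = (s * (1 - c)) *\<^sub>R z i + (s * c) *\<^sub>R z j" by (simp add: zk scaleR_add_right)
      moreover have "s * c = s - 1" using s(3) by (simp add: algebra_simps)
      ultimately have "s *\<^sub>R z k = z i + (s - 1) *\<^sub>R z j" using s(3) by simp
      then have "z i = (1 - s) *\<^sub>R z j + s *\<^sub>R z k" by (simp add: algebra_simps)
      then show False using btw[of i j k s] ijk s by auto
    next
      case 2
      then show False using btw[of k i j c] ijk zk by auto
    next
      case 3
      define s where "s = 1 / c"
      have s: "0 \<le> s" "s \<le> 1" "s * c = 1" using 3 by (auto simp: s_def)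
      have "s *\<^sub>R z k = (s * (1 - c)) *\<^sub>R z i + (s * c) *\<^sub>R z j" by (simp add: zk scaleR_add_right)
      moreover have "s * (1 - c) = s - 1" using s(3) by (simp add: algebra_simps)
      ultimately have "z j = (1 - s) *\<^sub>R z i + s *\<^sub>R z k" using s(3) by (simp add: algebra_simps)
      then show False using btw[of j i k s] ijk s by auto
    qed
  qed
  fix y assume y: "y \<in> Z2" "y \<in> convex hull {z i, z j, z k}"
  obtain r s t where rst: "0 \<le> r" "0 \<le> s" "0 \<le> t" "r + s + t = 1" "y = r *\<^sub>R z i + s *\<^sub>R z j + t *\<^sub>R z k"
    using y(2) by (auto simp: convex_hull_3)
  obtain l where l: "l < n" "b l \<le> a l \<bullet> y" by (rule cover_excludes[OF cov y(1)])
  have "b l = (r + s + t) * b l" using rst(4) by simp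
  then have "0 \<le> r * (a l \<bullet> z i - b l) + s * (a l \<bullet> z j - b l) + t * (a l \<bullet> z k - b l)"
    using l(2) unfolding rst(5) by (simp add: inner_add_right algebra_simps)
  moreover have "r * (a l \<bullet> z i - b l) \<le> 0" "s * (a l \<bullet> z j - b l) \<le> 0" "t * (a l \<bullet> z k - b l) \<le> 0"
    using le l(1) ijk rst by (auto intro!: mult_nonneg_nonpos)
  ultimately have zero: "r * (a l \<bullet> z i - b l) = 0" "s * (a l \<bullet> z j - b l) = 0" "t * (a l \<bullet> z k - b l) = 0" by linarith+
  have "l \<noteq> m \<Longrightarrow> m < n \<Longrightarrow> a l \<bullet> z m - b l \<noteq> 0" for m using z(3)[of m l] l(1) by force
  then have "(l \<noteq> i \<longrightarrow> r = 0) \<and> (l \<noteq> j \<longrightarrow> s = 0) \<and> (l \<noteq> k \<longrightarrow> t = 0)" using zero ijk by auto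
  then have "(s = 0 \<and> t = 0) \<or> (r = 0 \<and> t = 0) \<or> (r = 0 \<and> s = 0)" using ijk(4-6) by metis
  then show "y \<in> {z i, z j, z k}" using rst(4,5) by auto
qed

theorem area_upper_bound_gt_2:
  assumes K: "compact K" "convex K" "interior K \<noteq> {}" "interior K \<inter> Z2 = {}" "wide K w"
    and w: "2 < w" "w \<le> 1 + 2 / sqrt 3"
  shows "ar K \<le> w / (2 * lam w) \<and> (ar K = w / (2 * lam w) \<longrightarrow> lam_triangle K w)"
proof -
  have w1: "1 < w" using w by simp
  obtain n a b z where n: "3 \<le> n" "n \<le> 4" and cov: "cover K n a b"
    and z: "\<And>i. i < n \<Longrightarrow> z i \<in> Z2" "\<And>i. i < n \<Longrightarrow> a i \<bullet> z i = b i"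
    "\<And>i j. i < n \<Longrightarrow> j < n \<Longrightarrow> i \<noteq> j \<Longrightarrow> a j \<bullet> z i < b j"
    by (rule covering_points[OF K w1]) blast
  have U: "\<bar>cross2 (z j - z i) (z k - z i)\<bar> = 1"
    if "i < n" "j < n" "k < n" "i \<noteq> j" "i \<noteq> k" "j \<noteq> k" for i j k
    using pushed_points_unimodular[OF cov z] that by blast
  have Kl: "\<And>x. x \<in> K \<Longrightarrow> a i \<bullet> x \<le> b i" if "i < n" for i using cov that by (auto simp: cover_def)
  show ?thesis
  proof (cases "n = 3")
    case True
    have cv: "b 0 \<le> a 0 \<bullet> y \<or> b 1 \<le> a 1 \<bullet> y \<or> b 2 \<le> a 2 \<bullet> y" if yZ: "y \<in> Z2" for y
    proof -
      obtain i where "i < n" "b i \<le> a i \<bullet> y" by (rule cover_excludes[OF cov yZ])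
      moreover from this(1) have "i = 0 \<or> i = 1 \<or> i = 2" using True by linarith
      ultimately show ?thesis by blast
    qed
    have l: "0 < n" "1 < n" "2 < n" using True by auto
    have d: "(0::nat) \<noteq> 1" "(0::nat) \<noteq> 2" "(1::nat) \<noteq> 2" by auto
    show ?thesis
      by (rule triangle_bound[OF K(1-3,5) w z(1)[OF l(1)] z(1)[OF l(2)] z(1)[OF l(3)] U[OF l d]
        z(2)[OF l(1)] z(2)[OF l(2)] z(2)[OF l(3)] Kl[OF l(1)] Kl[OF l(2)] Kl[OF l(3)]
        z(3)[OF l(2,1) d(1)[symmetric]] z(3)[OF l(3,1) d(2)[symmetric]] z(3)[OF l(3,2) d(3)[symmetric]]
        z(3)[OF l(1,2) d(1)] z(3)[OF l(1,3) d(2)] z(3)[OF l(2,3) d(3)] cv]; assumption)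
  next
    case False
    then have n4: "n = 4" using n by simp
    have par: "w \<le> 2" if "z l = z j + z k - z i" "{i, j, k, l} = {0, 1, 2, 3}" "i < 4" "j < 4" "k < 4" "l < 4" for i j k l
    proof -
      have "card {i, j, k, l} = 4" using that(2) by simp
      then have d: "i \<noteq> j" "i \<noteq> k" "i \<noteq> l" "j \<noteq> k" "j \<noteq> l" "k \<noteq> l"
        by (auto simp: card_insert_if split: if_splits)
      have i: "i < n" and j: "j < n" and k: "k < n" and l: "l < n" using that n4 by auto
      show ?thesis
        by (rule parallelogram_width[OF K(5) z(1)[OF i] z(1)[OF j] z(1)[OF k] U[OF i j k d(1,2,4)] that(1)
          z(2)[OF i] z(2)[OF j] z(2)[OF k] z(2)[OF l] Kl[OF i] Kl[OF j] Kl[OF k] Kl[OF l]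
          z(3)[OF j i d(1)[symmetric]] z(3)[OF k i d(2)[symmetric]] z(3)[OF i j d(1)] z(3)[OF l j d(5)[symmetric]]
          z(3)[OF i k d(2)] z(3)[OF l k d(6)[symmetric]] z(3)[OF j l d(5)] z(3)[OF k l d(6)]]; assumption)
    qed
    \<comment> \<open>All four triples are unimodular, so the affine coordinates of
      \<open>z 3\<close> with respect to the other points are 1 or -1. As they sum to 1, exactly one
      is -1, and the four points form a parallelogram.\<close>
    have U': "\<bar>cross2 (z 1 - z 0) (z 2 - z 0)\<bar> = 1" "\<bar>cross2 (z 1 - z 0) (z 3 - z 0)\<bar> = 1"
       "\<bar>cross2 (z 2 - z 0) (z 3 - z 0)\<bar> = 1" "\<bar>cross2 (z 2 - z 1) (z 3 - z 1)\<bar> = 1"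
      using U n4 by auto
    obtain T where T: "unimodular T" "T (z 0) = (0, 0)" "T (z 1) = (1, 0)" "T (z 2) = (0, 1)"
      using lattice_triangle_normal_form[OF _ _ _ U'(1)] z n4 by auto
    define x y where "x = fst (T (z 3))" and "y = snd (T (z 3))"
    have z3: "z 3 = (1 - x - y) *\<^sub>R z 0 + x *\<^sub>R z 1 + y *\<^sub>R z 2"
      unfolding x_def y_def by (rule lattice_affine_coords[OF T])
    define D where "D = cross2 (z 1 - z 0) (z 2 - z 0)"
    have "cross2 (z 1 - z 0) (z 3 - z 0) = y * D" "cross2 (z 2 - z 0) (z 3 - z 0) = - (x * D)"
      "cross2 (z 2 - z 1) (z 3 - z 1) = (1 - x - y) * D"
      unfolding z3 D_def by (simp_all add: cross2_def algebra_simps)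
    then have "\<bar>y\<bar> = 1" "\<bar>x\<bar> = 1" "\<bar>1 - x - y\<bar> = 1" using U' by (simp_all add: D_def abs_mult)
    then consider "x = 1 \<and> y = 1" | "x = 1 \<and> y = -1" | "x = -1 \<and> y = 1" by (auto simp: abs_if split: if_splits)
    then have "w \<le> 2"
    proof cases
      case 1
      then show ?thesis using z3 by (intro par[of 3 1 2 0]) (auto simp: algebra_simps)
    next
      case 2
      then show ?thesis using z3 by (intro par[of 3 0 1 2]) (auto simp: algebra_simps)
    next
      case 3
      then show ?thesis using z3 by (intro par[of 3 0 2 1]) (auto simp: algebra_simps)
    qed
    then show ?thesis using w by simp
  qed
qed

text \<open>The division points lie inside the sides, so the inscribed triangle without its corners
  is in the interior of K and contains no lattice point. Hence it is unimodular, and K exceeds it by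
  the factor 1 / g.\<close>

lemma lam_triangle_ar:
  assumes K: "interior K \<noteq> {}" "interior K \<inter> Z2 = {}" and w: "2 < w" "w \<le> 1 + 2 / sqrt 3" and lt: "lam_triangle K w"
  shows "ar K = w / (2 * lam w)"
proof -
  define l where "l = lam w"
  note L = lam_props[OF w, folded l_def]
  obtain q0 q1 q2 where q: "\<not> collinear {q0, q1, q2}" "K = convex hull {q0, q1, q2}"
      "l *\<^sub>R q1 + (1 - l) *\<^sub>R q2 \<in> Z2" "l *\<^sub>R q2 + (1 - l) *\<^sub>R q0 \<in> Z2" "l *\<^sub>R q0 + (1 - l) *\<^sub>R q1 \<in> Z2"
    using lt unfolding lam_triangle_def l_def by blast
  define p0 p1 p2 where "p0 = l *\<^sub>R q1 + (1 - l) *\<^sub>R q2" and "p1 = l *\<^sub>R q2 + (1 - l) *\<^sub>R q0" and "p2 = l *\<^sub>R q0 + (1 - l) *\<^sub>R q1"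
  define C where "C = cross2 (q1 - q0) (q2 - q0)"
  define g where "g = 1 - 3 * l + 3 * l\<^sup>2"
  have g1: "g = l / w" using L(3) w by (simp add: g_def field_simps)
  have g2: "0 < g" unfolding g1 using L(1) w by simp
  note g = g1 g2
  have "0 < ar K" using K(1) q(2) by (intro ar_pos_open[of "interior K"]) (auto simp: interior_subset compact_triangle)
  then have C0: "C \<noteq> 0" by (auto simp: q(2) ar_triangle C_def)
  have cp: "cross2 (p1 - p0) (p2 - p0) = g * C"
    unfolding p0_def p1_def p2_def C_def g_def by (simp add: cross2_def power2_eq_square algebra_simps)
  have "\<bar>cross2 (p1 - p0) (p2 - p0)\<bar> = 1"
  proof (rule empty_lattice_triangle)
    show "p0 \<in> Z2" "p1 \<in> Z2" "p2 \<in> Z2" using q by (simp_all add: p0_def p1_def p2_def)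
    show "cross2 (p1 - p0) (p2 - p0) \<noteq> 0" using cp g2 C0 by simp
    fix z assume z: "z \<in> Z2" "z \<in> convex hull {p0, p1, p2}"
    obtain r s t where rst: "0 \<le> r" "0 \<le> s" "0 \<le> t" "r + s + t = 1" "z = r *\<^sub>R p0 + s *\<^sub>R p1 + t *\<^sub>R p2"
      using z(2) by (auto simp: convex_hull_3)
    show "z \<in> {p0, p1, p2}"
    proof (rule ccontr)
      assume nz: "z \<notin> {p0, p1, p2}"
      have r1: "\<not> (s = 0 \<and> t = 0)" "\<not> (r = 0 \<and> t = 0)" "\<not> (r = 0 \<and> s = 0)" using nz rst by auto
      \<comment> \<open>The barycentric coordinates of z with respect to q0, q1, q2; all are
        positive as soon as two of r, s, t are.\<close>
      define c0 c1 c2 where "c0 = s * (1 - l) + t * l" and "c1 = r * l + t * (1 - l)" and "c2 = r * (1 - l) + s * l"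
      have pos: "0 < x * (1 - l) + y * l" "0 < x * l + y * (1 - l)" if "0 \<le> x" "0 \<le> y" "\<not> (x = 0 \<and> y = 0)" for x y
      proof -
        have "0 < x \<or> 0 < y" using that by linarith
        then show "0 < x * (1 - l) + y * l" "0 < x * l + y * (1 - l)"
          using that L(1,2) by (auto intro: add_pos_nonneg add_nonneg_pos)
      qed
      have "0 < c0" "0 < c1" "0 < c2" using pos rst r1 by (auto simp: c0_def c1_def c2_def)
      moreover have "c0 + c1 + c2 = 1" using rst(4) by (simp add: c0_def c1_def c2_def algebra_simps)
      moreover have "c0 *\<^sub>R q0 + c1 *\<^sub>R q1 + c2 *\<^sub>R q2 = z"
        unfolding rst(5) p0_def p1_def p2_def by (simp add: c0_def c1_def c2_def prod_eq_iff algebra_simps)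
      ultimately have "z \<in> interior K"
        unfolding q(2) using interior_convex_hull_3_minimal[OF q(1)] by auto
      then show False using K(2) z(1) by blast
    qed
  qed
  then have "\<bar>C\<bar> = 1 / g" using cp g(2) by (simp add: abs_mult field_simps)
  then have "ar K = 1 / g / 2" by (simp add: q(2) ar_triangle C_def)
  then show ?thesis using g L(1) w by (simp add: l_def)
qed

section \<open>The area inequalities\<close>

theorem theorem2:
  fixes K :: "(real \<times> real) set" and w :: real and A :: ennreal
  assumes "closed K" and "convex K" and "interior K \<noteq> {}" and "interior K \<inter> Z2 = {}"
  defines "w \<equiv> real_of_ereal (lattice_width K)"
      and "A \<equiv> area K"
  shows
    "(0 < lattice_width K \<and> lattice_width K \<le> 1 \<longrightarrow> A \<le> \<infinity>)
   \<and> (1 < lattice_width K \<and> lattice_width K \<le> 2 \<longrightarrow> A \<le> ennreal (w\<^sup>2 / (2 * (w - 1))))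
   \<and> (2 < lattice_width K \<and> lattice_width K \<le> ereal (1 + 2 / sqrt 3) \<longrightarrow>
        A \<le> ennreal (3 * w\<^sup>2 / (3 * w + 1 - sqrt (1 + 6 * w - 3 * w\<^sup>2))))
   \<and> (0 < lattice_width K \<and> lattice_width K \<le> ereal (1 + 2 / sqrt 3) \<longrightarrow>
        ennreal (3 / 8 * w\<^sup>2) \<le> A)
   \<and> (0 < lattice_width K \<and> lattice_width K \<le> 1 \<longrightarrow>
        (A = \<infinity> \<longleftrightarrow> \<not> bounded K \<and> (\<exists>S. is_split S \<and> K \<subseteq> S)))
   \<and> (1 < lattice_width K \<and> lattice_width K \<le> 2 \<longrightarrow>
        (A = ennreal (w\<^sup>2 / (2 * (w - 1))) \<longleftrightarrow>
          (\<exists>T t1 t2. unimodular T \<and>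
             (let I1 = (\<lambda>x. t1 + x) ` (convex hull {(0, 0), (w, 0)});
                  I2 = (\<lambda>x. t2 + x) ` (convex hull {(0, 0), (0, w / (w - 1))})
              in I1 \<inter> I2 \<noteq> {} \<and> T ` K = convex hull (I1 \<union> I2)))))
   \<and> (2 < lattice_width K \<and> lattice_width K \<le> ereal (1 + 2 / sqrt 3) \<longrightarrow>
        (A = ennreal (3 * w\<^sup>2 / (3 * w + 1 - sqrt (1 + 6 * w - 3 * w\<^sup>2))) \<longleftrightarrow>
          (let lam = (3 * w + 1 - sqrt (1 + 6 * w - 3 * w\<^sup>2)) / (6 * w)
           in \<exists>q0 q1 q2. \<not> collinear {q0, q1, q2} \<and> K = convex hull {q0, q1, q2}
               \<and> lam *\<^sub>R q1 + (1 - lam) *\<^sub>R q2 \<in> Z2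
               \<and> lam *\<^sub>R q2 + (1 - lam) *\<^sub>R q0 \<in> Z2
               \<and> lam *\<^sub>R q0 + (1 - lam) *\<^sub>R q1 \<in> Z2)))
   \<and> (0 < lattice_width K \<and> lattice_width K \<le> 2 \<longrightarrow>
        (A = ennreal (3 / 8 * w\<^sup>2) \<longleftrightarrow>
          (\<exists>T t. unimodular T \<and>
             T ` K = (\<lambda>x. t + x) ` ((\<lambda>x. (w / 2) *\<^sub>R x) ` (convex hull {(1, 0), (0, 1), (-1, -1)})))))"
proof (cases "bounded K")
  case unb: False
  obtain S where S: "is_split S" "K \<subseteq> S"
    using unbounded_lattice_free_split[OF assms(1,2) unb assms(3,4)] by blast
  have "K \<noteq> {}" using unb by auto
  \<comment> \<open>All claims for widths above 1 are void for unbounded K. Infinite area settles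
    the others, except that the triangle in the last equivalence must be ruled out.\<close>
  then have lw: "\<not> 1 < lattice_width K" using split_lattice_width[OF S] by (simp add: not_less)
  then have lw2: "\<not> 2 < lattice_width K"
    by (metis ereal_less_eq(3) not_less numeral_eq_ereal one_ereal_def one_le_numeral order_trans)
  have A: "A = \<infinity>" unfolding A_def using unbounded_area[OF assms(1,2) unb assms(3)] .
  have no: "\<not> scaled_triangle K w"
  proof
    assume "scaled_triangle K w"
    then obtain T t where T: "unimodular T"
      "T ` K = (\<lambda>x. t + x) ` ((\<lambda>x. (w / 2) *\<^sub>R x) ` (convex hull {(1, 0), (0, 1), (-1, -1)}))"
      unfolding scaled_triangle_def by blast
    obtain R where R: "unimodular R" "\<And>z. R (T z) = z" "\<And>z. T (R z) = z"
      using unimodular_inverse[OF T(1)] by blast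
    have "compact (T ` K)" unfolding T(2) scaled_triangle_image by (rule compact_triangle)
    then have "compact (R ` (T ` K))" by (rule compact_unimodular[OF R(1)])
    also have "R ` (T ` K) = K" by (simp add: image_image R(2))
    finally show False using unb compact_imp_bounded by blast
  qed
  have "\<exists>S. is_split S \<and> K \<subseteq> S" using S by blast
  then show ?thesis using lw lw2 A no unb unfolding scaled_triangle_def by simp
next
  case bnd: True
  have K: "compact K" "K \<noteq> {}" using bnd assms(1,3) by (auto simp: compact_eq_bounded_closed)
  obtain v where v: "lattice_width K = ereal v" "0 < v" "wide K v" "thin K v"
    using compact_lattice_width[OF K(1) assms(3)] by blast
  have wv: "w = v" by (simp add: w_def v(1))
  have A: "A = ennreal (ar K)" by (simp add: A_def area_compact[OF K(1)])
  \<comment> \<open>\<open>ennreal\<close> sends negative reals to 0, so the comparison needs a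
    nonnegative bound; for this reason \<open>top\<close> below also records nonnegativity.\<close>
  have le_iff: "A \<le> ennreal x \<longleftrightarrow> ar K \<le> x" "ennreal x \<le> A \<longleftrightarrow> x \<le> ar K" "A = ennreal x \<longleftrightarrow> ar K = x" if "0 \<le> x" for x
    using that ar_nonneg[of K] by (simp_all add: A)
  have low: "3 / 8 * w\<^sup>2 \<le> ar K"
    and low_eq: "ar K = 3 / 8 * w\<^sup>2 \<longleftrightarrow> scaled_triangle K w"
    unfolding wv using area_lower_bound[OF K(1) assms(2) K(2) v(3,4,2)] area_lower_bound_eq[OF K(1) assms(2) K(2) v(3,4,2)] .
  have mid: "ar K \<le> w\<^sup>2 / (2 * (w - 1)) \<and> (ar K = w\<^sup>2 / (2 * (w - 1)) \<longleftrightarrow> cross_hull K w)" if "1 < w" "w \<le> 2"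
    using area_upper_bound_le_2[OF K(1) assms(2,3,4) v(3,4), folded wv, OF that]
      cross_hull_ar_ge[OF K(1) assms(2) that(1)] by fastforce
  have top: "ar K \<le> 3 * w\<^sup>2 / (3 * w + 1 - sqrt (1 + 6 * w - 3 * w\<^sup>2)) \<and>
      (ar K = 3 * w\<^sup>2 / (3 * w + 1 - sqrt (1 + 6 * w - 3 * w\<^sup>2)) \<longleftrightarrow> lam_triangle K w) \<and>
      0 \<le> 3 * w\<^sup>2 / (3 * w + 1 - sqrt (1 + 6 * w - 3 * w\<^sup>2))" if "2 < w" "w \<le> 1 + 2 / sqrt 3"
    unfolding lam_props(5)[OF that]
    using area_upper_bound_gt_2[OF K(1) assms(2,3,4) v(3), folded wv, OF that] lam_triangle_ar[OF assms(3,4) that]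
      lam_props(1)[OF that] that by auto
  have conv: "1 < lattice_width K \<longleftrightarrow> 1 < w" "lattice_width K \<le> 2 \<longleftrightarrow> w \<le> 2" "2 < lattice_width K \<longleftrightarrow> 2 < w"
      "lattice_width K \<le> ereal x \<longleftrightarrow> w \<le> x" for x
    by (simp_all add: v(1) wv one_ereal_def numeral_eq_ereal)
  have inf: "A \<noteq> \<infinity>" by (simp add: A)
  have nn: "0 \<le> 3 / 8 * w\<^sup>2" "1 < w \<Longrightarrow> 0 \<le> w\<^sup>2 / (2 * (w - 1))" by simp_all
  show ?thesis
    unfolding cross_hull_def[symmetric] scaled_triangle_def[symmetric] conv
    unfolding Let_def lam_def[symmetric]
    unfolding lam_triangle_def[symmetric]
    using inf bnd low low_eq mid top le_iff nn by auto
qed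

end
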